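(* Let $d\in\{2,3,\dots\}\cup\{\infty\}$. Let $(\mathbf b,\mathbf n)$ and $(\mathbf c,\mathbf m)$ be two pairs of weight and frequency data of length $d$. Suppose that $V_1$ and $V_2$ are the multiplier varieties associated with $K_{\mathbf b,\mathbf n}$ and $K_{\mathbf c,\mathbf m}$, respectively. Then the following statements are equivalent. (i) The pairs $(\mathbf b,\mathbf n)$ and $(\mathbf c,\mathbf m)$ admit a similar pattern. (ii) $V_1=V_2$. (iii) The identity map $\mathrm{Id}:\mathcal M_{V_1}\to\mathcal M_{V_2}$ is an isometric isomorphism. (iv) There exists an isometric isomorphism $\Phi:\mathcal M(\mathcal H(K_{\mathbf b,\mathbf n}))\to\mathcal M(\mathcal H(K_{\mathbf c,\mathbf m}))$ such that $C_{f_{\mathbf c,\mathbf m}}^{-1}\circ\Phi\circ C_{f_{\mathbf b,\mathbf n}}=\mathrm{Id}:\mathcal M_{V_1}\to\mathcal M_{V_2}$.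
   Context: Conventions: $\mathbb N=\{1,2,\dots\}$ and $\mathbb N_{\ge2}=\{2,3,\dots\}$. For $d=\infty$ the index set $\{1,\dots,d\}$ means $\mathbb N$ and $\mathbb C^d$ means the Hilbert space of square-summable sequences. $\mathbb B_d$ is the open unit ball of $\mathbb C^d$, and $\mathbb H_\rho=\{s\in\mathbb C:\operatorname{Re}(s)>\rho\}$. A pair $(\mathbf b,\mathbf n)$ of weight and frequency data of length $d$ consists of a $d$-tuple $\mathbf b=(b_j)_{j=1}^d$ of positive reals and a $d$-tuple $\mathbf n=(n_j)_{j=1}^d$ of distinct elements of $\mathbb N_{\ge2}$; if $d=\infty$ it is always assumed that $\sigma_a(\sum_j b_jn_j^{-s})<\infty$, where $\sigma_a$ is the abscissa of absolute convergence of a Dirichlet series. Choose $\rho\in\mathbb R$ such that $\sum_j b_jn_j^{-2\operatorname{Re}(s)}<1$ for all $s\in\mathbb H_\rho$. The associated kernel is $K_{\mathbf b,\mathbf n}(s,u)=\dfrac1{1-\sum_{j=1}^d b_jn_j^{-s-\overline u}}$ on $\mathbb H_\rho\times\mathbb H_\rho$, and $f_{\mathbf b,\mathbf n}:\mathbb H_\rho\to\mathbb B_d$ is $f_{\mathbf b,\mathbf n}(s)=(\sqrt{b_j}\,n_j^{-s})_{j=1}^d$. $\mathcal H(K)$ denotes the reproducing kernel Hilbert space of $K$ and $\mathcal M(\mathcal H(K))$ its multiplier algebra, with $\|\varphi\|$ the operator norm of $M_\varphi:h\mapsto\varphi h$. $\mathcal M_d$ is the multiplier algebra of the Drury–Arveson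 space $H^2_d$, the reproducing kernel Hilbert space on $\mathbb B_d$ with kernel $1/(1-\langle\mathbf z,\mathbf w\rangle)$. The multiplier variety associated with $K_{\mathbf b,\mathbf n}$ is $$V=\{\mathbf z\in\mathbb B_d:g(\mathbf z)=0\text{ for all }g\in\mathcal M_d\text{ with }g|_{f_{\mathbf b,\mathbf n}(\mathbb H_\rho)}\equiv0\}.$$ $\mathcal M_V=\{g|_V:g\in\mathcal M_d\}$ with norm $\|h\|=\inf\{\|g\|_{\mathcal M_d}:g|_V=h\}$. The composition map $C_{f_{\mathbf b,\mathbf n}}:\mathcal M_V\to\mathcal M(\mathcal H(K_{\mathbf b,\mathbf n}))$, $h\mapsto h\circ f_{\mathbf b,\mathbf n}$, is an isometric isomorphism. An isometric isomorphism means an isometric algebra isomorphism. The identity map $\mathrm{Id}:\mathcal M_{V_1}\to\mathcal M_{V_2}$ is $g|_{V_1}\mapsto g|_{V_2}$ for $g\in\mathcal M_d$; asserting that it is an isometric isomorphism (or that a map equals it) includes that it is well defined. $\mathcal J(\mathbf n)$ is the collection of all $J\subseteq\{1,\dots,d\}$ such that $\{\ln n_j:j\in J\}$ is linearly dependent over $\mathbb Q$ and $\{\ln n_j:j\in J'\}$ is linearly independent over $\mathbb Q$ for every $J'\subsetneq J$ (each such $J$ is finite). For each $J\in\mathcal J(\mathbf n)$ there are a unique (unordered) partition $\{J_1,J_2\}$ of $J$ and a unique tuple $(\beta_j)_{j\in J}\in\mathbb N^{|J|}$ with $\gcd(\beta_j)_{j\in J}=1$ such that $\prod_{i\in J_1}n_i^{\beta_i}=\prod_{i\in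 J_2}n_i^{\beta_i}$; these are called the unique partition and unique tuple associated with $J$ (relative to $\mathbf n$). Two pairs $(\mathbf b,\mathbf n)$, $(\mathbf c,\mathbf m)$ of length $d$ admit a similar pattern if: (1) $\mathcal J(\mathbf n)=\mathcal J(\mathbf m)$; and (2) for each $J\in\mathcal J(\mathbf n)$, the unique partition $\{J_1,J_2\}$ and unique tuple $(\beta_i)_{i\in J}$ associated with $J$ are the same relative to $\mathbf n$ and relative to $\mathbf m$, and $\prod_{i\in J_1}c_i^{\beta_i}\prod_{i\in J_2}b_i^{\beta_i}=\prod_{i\in J_2}c_i^{\beta_i}\prod_{i\in J_1}b_i^{\beta_i}$. *)

theory Defs
  imports "HOL-Analysis.Analysis" "HOL-Library.Extended_Nat" "HOL-Library.Function_Algebras"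
begin

text \<open>
  A function on a set \<open>X\<close> is represented by a total function that vanishes outside \<open>X\<close>.
  Sums and products of functions are the pointwise ones of \<^theory>\<open>HOL-Library.Function_Algebras\<close>;
  they preserve this convention.
\<close>

definition functions_on :: "'x set \<Rightarrow> ('x \<Rightarrow> complex) set" where
  "functions_on X = {f. \<forall>x. x \<notin> X \<longrightarrow> f x = 0}"

definition restrict0 :: "'x set \<Rightarrow> ('x \<Rightarrow> complex) \<Rightarrow> 'x \<Rightarrow> complex" where
  "restrict0 X f = (\<lambda>x. if x \<in> X then f x else 0)"

definition scale_fun :: "complex \<Rightarrow> ('x \<Rightarrow> complex) \<Rightarrow> 'x \<Rightarrow> complex" where
  "scale_fun c f = (\<lambda>x. c * f x)"


section \<open>Reproducing kernel Hilbert spaces and multipliers\<close>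

text \<open>
  \<open>H\<close> with inner product \<open>ip\<close> (linear in the first argument) is a Hilbert space of functions on
  \<open>X\<close> with reproducing kernel \<open>K\<close>. Nothing is required of \<open>ip\<close> outside \<open>H\<close>.
\<close>

locale reproducing_kernel_Hilbert_space =
  fixes X :: "'x set"
    and K :: "'x \<Rightarrow> 'x \<Rightarrow> complex"
    and H :: "('x \<Rightarrow> complex) set"
    and ip :: "('x \<Rightarrow> complex) \<Rightarrow> ('x \<Rightarrow> complex) \<Rightarrow> complex"
  assumes subset_functions: "H \<subseteq> functions_on X"
    and zero_mem: "0 \<in> H"
    and add_mem: "\<And>f g. f \<in> H \<Longrightarrow> g \<in> H \<Longrightarrow> f + g \<in> H"
    and scale_mem: "\<And>a f. f \<in> H \<Longrightarrow> scale_fun a f \<in> H"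
    and ip_add: "\<And>f g h. f \<in> H \<Longrightarrow> g \<in> H \<Longrightarrow> h \<in> H \<Longrightarrow> ip (f + g) h = ip f h + ip g h"
    and ip_scale: "\<And>a f g. f \<in> H \<Longrightarrow> g \<in> H \<Longrightarrow> ip (scale_fun a f) g = a * ip f g"
    and ip_cnj: "\<And>f g. f \<in> H \<Longrightarrow> g \<in> H \<Longrightarrow> ip g f = cnj (ip f g)"
    and ip_nonneg: "\<And>f. f \<in> H \<Longrightarrow> 0 \<le> Re (ip f f)"
    and ip_definite: "\<And>f. f \<in> H \<Longrightarrow> ip f f = 0 \<Longrightarrow> f = 0"
    and complete:
      "\<And>F :: nat \<Rightarrow> 'x \<Rightarrow> complex. (\<And>k. F k \<in> H) \<Longrightarrow>
         (\<And>e. 0 < e \<Longrightarrow> \<exists>N. \<forall>i\<ge>N. \<forall>j\<ge>N. sqrt (Re (ip (F i - F j) (F i - F j))) < e) \<Longrightarrow>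
         \<exists>f\<in>H. (\<lambda>k. sqrt (Re (ip (F k - f) (F k - f)))) \<longlonglongrightarrow> 0"
    and kernel_mem: "\<And>x. x \<in> X \<Longrightarrow> restrict0 X (\<lambda>y. K y x) \<in> H"
    and reproducing: "\<And>x f. x \<in> X \<Longrightarrow> f \<in> H \<Longrightarrow> ip f (restrict0 X (\<lambda>y. K y x)) = f x"

text \<open>
  For a positive semidefinite kernel such a pair exists, \<open>H\<close> is unique, and \<open>ip\<close> is unique on
  \<open>H\<close> (Moore--Aronszajn), so the choice below is immaterial.
\<close>

definition rkhs ::
  "'x set \<Rightarrow> ('x \<Rightarrow> 'x \<Rightarrow> complex) \<Rightarrow>
    ('x \<Rightarrow> complex) set \<times> (('x \<Rightarrow> complex) \<Rightarrow> ('x \<Rightarrow> complex) \<Rightarrow> complex)" where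
  "rkhs X K = (SOME (H, ip). reproducing_kernel_Hilbert_space X K H ip)"

definition rkhs_space :: "'x set \<Rightarrow> ('x \<Rightarrow> 'x \<Rightarrow> complex) \<Rightarrow> ('x \<Rightarrow> complex) set" where
  "rkhs_space X K = fst (rkhs X K)"

definition rkhs_norm :: "'x set \<Rightarrow> ('x \<Rightarrow> 'x \<Rightarrow> complex) \<Rightarrow> ('x \<Rightarrow> complex) \<Rightarrow> real" where
  "rkhs_norm X K f = sqrt (Re (snd (rkhs X K) f f))"

definition multipliers :: "'x set \<Rightarrow> ('x \<Rightarrow> 'x \<Rightarrow> complex) \<Rightarrow> ('x \<Rightarrow> complex) set" where
  "multipliers X K = {\<phi> \<in> functions_on X. \<forall>h \<in> rkhs_space X K. \<phi> * h \<in> rkhs_space X K}"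

text \<open>
  The operator norm of multiplication by \<open>\<phi>\<close>; for a multiplier the set is bounded by the closed
  graph theorem.
\<close>

definition multiplier_norm :: "'x set \<Rightarrow> ('x \<Rightarrow> 'x \<Rightarrow> complex) \<Rightarrow> ('x \<Rightarrow> complex) \<Rightarrow> real" where
  "multiplier_norm X K \<phi> =
     Sup {rkhs_norm X K (\<phi> * h) | h. h \<in> rkhs_space X K \<and> rkhs_norm X K h \<le> 1}"

definition isometric_isomorphism ::
  "('x \<Rightarrow> complex) set \<Rightarrow> (('x \<Rightarrow> complex) \<Rightarrow> real) \<Rightarrow>
   ('y \<Rightarrow> complex) set \<Rightarrow> (('y \<Rightarrow> complex) \<Rightarrow> real) \<Rightarrow>
   (('x \<Rightarrow> complex) \<Rightarrow> ('y \<Rightarrow> complex)) \<Rightarrow> bool" where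
  "isometric_isomorphism A normA B normB T \<longleftrightarrow>
     bij_betw T A B \<and>
     (\<forall>f\<in>A. \<forall>g\<in>A. T (f + g) = T f + T g) \<and>
     (\<forall>a. \<forall>f\<in>A. T (scale_fun a f) = scale_fun a (T f)) \<and>
     (\<forall>f\<in>A. \<forall>g\<in>A. T (f * g) = T f * T g) \<and>
     (\<forall>f\<in>A. normB (T f) = normA f)"


section \<open>The Drury--Arveson space\<close>

definition index_set :: "enat \<Rightarrow> nat set" where
  "index_set d = {j. 1 \<le> j \<and> enat j \<le> d}"

definition C_space :: "enat \<Rightarrow> (nat \<Rightarrow> complex) set" where
  "C_space d = {z \<in> functions_on (index_set d). (\<lambda>j. (cmod (z j))\<^sup>2) summable_on index_set d}"

definition C_inner :: "enat \<Rightarrow> (nat \<Rightarrow> complex) \<Rightarrow> (nat \<Rightarrow> complex) \<Rightarrow> complex" where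
  "C_inner d z w = (\<Sum>\<^sub>\<infinity>j\<in>index_set d. z j * cnj (w j))"

definition unit_ball :: "enat \<Rightarrow> (nat \<Rightarrow> complex) set" where
  "unit_ball d = {z \<in> C_space d. sqrt (\<Sum>\<^sub>\<infinity>j\<in>index_set d. (cmod (z j))\<^sup>2) < 1}"

definition DA_kernel :: "enat \<Rightarrow> (nat \<Rightarrow> complex) \<Rightarrow> (nat \<Rightarrow> complex) \<Rightarrow> complex" where
  "DA_kernel d z w = 1 / (1 - C_inner d z w)"

definition DA_multipliers :: "enat \<Rightarrow> ((nat \<Rightarrow> complex) \<Rightarrow> complex) set" where
  "DA_multipliers d = multipliers (unit_ball d) (DA_kernel d)"

definition DA_multiplier_norm :: "enat \<Rightarrow> ((nat \<Rightarrow> complex) \<Rightarrow> complex) \<Rightarrow> real" where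
  "DA_multiplier_norm d = multiplier_norm (unit_ball d) (DA_kernel d)"

definition variety_algebra ::
  "enat \<Rightarrow> (nat \<Rightarrow> complex) set \<Rightarrow> ((nat \<Rightarrow> complex) \<Rightarrow> complex) set" where
  "variety_algebra d V = restrict0 V ` DA_multipliers d"

definition variety_norm ::
  "enat \<Rightarrow> (nat \<Rightarrow> complex) set \<Rightarrow> ((nat \<Rightarrow> complex) \<Rightarrow> complex) \<Rightarrow> real" where
  "variety_norm d V h =
     Inf {DA_multiplier_norm d g | g. g \<in> DA_multipliers d \<and> restrict0 V g = h}"

text \<open>
  \<open>T\<close> acts as \<open>g|V1 \<mapsto> g|V2\<close>. The existence of such a \<open>T\<close> expresses that this assignment is
  well defined.
\<close>

definition is_identity_map ::
  "enat \<Rightarrow> (nat \<Rightarrow> complex) set \<Rightarrow> (nat \<Rightarrow> complex) set \<Rightarrow>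
   (((nat \<Rightarrow> complex) \<Rightarrow> complex) \<Rightarrow> ((nat \<Rightarrow> complex) \<Rightarrow> complex)) \<Rightarrow> bool" where
  "is_identity_map d V1 V2 T \<longleftrightarrow> (\<forall>g \<in> DA_multipliers d. T (restrict0 V1 g) = restrict0 V2 g)"


section \<open>Weight and frequency data\<close>

definition abs_conv_abscissa :: "nat set \<Rightarrow> (nat \<Rightarrow> complex) \<Rightarrow> (nat \<Rightarrow> nat) \<Rightarrow> ereal" where
  "abs_conv_abscissa I a n =
     Inf {ereal (Re s) | s :: complex. (\<lambda>j. cmod (a j * of_nat (n j) powr (- s))) summable_on I}"

definition weight_frequency_data :: "enat \<Rightarrow> (nat \<Rightarrow> real) \<Rightarrow> (nat \<Rightarrow> nat) \<Rightarrow> bool" where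
  "weight_frequency_data d b n \<longleftrightarrow>
     (\<forall>j \<in> index_set d. 0 < b j) \<and>
     (\<forall>j \<in> index_set d. 2 \<le> n j) \<and>
     inj_on n (index_set d) \<and>
     (d = \<infinity> \<longrightarrow> abs_conv_abscissa (index_set d) (\<lambda>j. of_real (b j)) n < \<infinity>)"

definition half_plane :: "real \<Rightarrow> complex set" where
  "half_plane \<rho> = {s. Re s > \<rho>}"

text \<open>Summability has to be demanded explicitly, as a divergent \<open>infsum\<close> is \<open>0\<close>.\<close>

definition admissible_abscissa :: "enat \<Rightarrow> (nat \<Rightarrow> real) \<Rightarrow> (nat \<Rightarrow> nat) \<Rightarrow> real \<Rightarrow> bool" where
  "admissible_abscissa d b n \<rho> \<longleftrightarrow>
     (\<forall>s \<in> half_plane \<rho>.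
        (\<lambda>j. b j * real (n j) powr (- 2 * Re s)) summable_on index_set d \<and>
        (\<Sum>\<^sub>\<infinity>j\<in>index_set d. b j * real (n j) powr (- 2 * Re s)) < 1)"

definition Dirichlet_kernel ::
  "enat \<Rightarrow> (nat \<Rightarrow> real) \<Rightarrow> (nat \<Rightarrow> nat) \<Rightarrow> complex \<Rightarrow> complex \<Rightarrow> complex" where
  "Dirichlet_kernel d b n s u =
     1 / (1 - (\<Sum>\<^sub>\<infinity>j\<in>index_set d. of_real (b j) * of_nat (n j) powr (- s - cnj u)))"

definition embedding ::
  "enat \<Rightarrow> (nat \<Rightarrow> real) \<Rightarrow> (nat \<Rightarrow> nat) \<Rightarrow> complex \<Rightarrow> (nat \<Rightarrow> complex)" where
  "embedding d b n s =
     restrict0 (index_set d) (\<lambda>j. of_real (sqrt (b j)) * of_nat (n j) powr (- s))"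

definition multiplier_variety ::
  "enat \<Rightarrow> (nat \<Rightarrow> real) \<Rightarrow> (nat \<Rightarrow> nat) \<Rightarrow> real \<Rightarrow> (nat \<Rightarrow> complex) set" where
  "multiplier_variety d b n \<rho> =
     {z \<in> unit_ball d. \<forall>g \<in> DA_multipliers d.
        (\<forall>w \<in> embedding d b n ` half_plane \<rho>. g w = 0) \<longrightarrow> g z = 0}"

definition Dirichlet_multipliers ::
  "enat \<Rightarrow> (nat \<Rightarrow> real) \<Rightarrow> (nat \<Rightarrow> nat) \<Rightarrow> real \<Rightarrow> (complex \<Rightarrow> complex) set" where
  "Dirichlet_multipliers d b n \<rho> = multipliers (half_plane \<rho>) (Dirichlet_kernel d b n)"

definition Dirichlet_multiplier_norm ::
  "enat \<Rightarrow> (nat \<Rightarrow> real) \<Rightarrow> (nat \<Rightarrow> nat) \<Rightarrow> real \<Rightarrow> (complex \<Rightarrow> complex) \<Rightarrow> real" where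
  "Dirichlet_multiplier_norm d b n \<rho> = multiplier_norm (half_plane \<rho>) (Dirichlet_kernel d b n)"

definition composition_map ::
  "enat \<Rightarrow> (nat \<Rightarrow> real) \<Rightarrow> (nat \<Rightarrow> nat) \<Rightarrow> real \<Rightarrow>
   ((nat \<Rightarrow> complex) \<Rightarrow> complex) \<Rightarrow> (complex \<Rightarrow> complex)" where
  "composition_map d b n \<rho> h = restrict0 (half_plane \<rho>) (h \<circ> embedding d b n)"


section \<open>Similar patterns\<close>

text \<open>Since \<open>n\<close> is injective, the family \<open>ln (n j)\<close> may be replaced by the set of its values.\<close>

definition log_dependent :: "(nat \<Rightarrow> nat) \<Rightarrow> nat set \<Rightarrow> bool" where
  "log_dependent n J \<longleftrightarrow>
     module.dependent (\<lambda>(q::rat) (x::real). of_rat q * x) ((\<lambda>j. ln (real (n j))) ` J)"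

definition minimal_dependent :: "enat \<Rightarrow> (nat \<Rightarrow> nat) \<Rightarrow> nat set set" where
  "minimal_dependent d n =
     {J. J \<subseteq> index_set d \<and> log_dependent n J \<and> (\<forall>J'. J' \<subset> J \<longrightarrow> \<not> log_dependent n J')}"

definition associated_relation ::
  "(nat \<Rightarrow> nat) \<Rightarrow> nat set \<Rightarrow> nat set \<Rightarrow> nat set \<Rightarrow> (nat \<Rightarrow> nat) \<Rightarrow> bool" where
  "associated_relation n J J1 J2 \<beta> \<longleftrightarrow>
     J1 \<noteq> {} \<and> J2 \<noteq> {} \<and> J1 \<inter> J2 = {} \<and> J1 \<union> J2 = J \<and>
     (\<forall>j\<in>J. 1 \<le> \<beta> j) \<and> Gcd (\<beta> ` J) = 1 \<and>
     (\<Prod>i\<in>J1. n i ^ \<beta> i) = (\<Prod>i\<in>J2. n i ^ \<beta> i)"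

text \<open>
  For \<open>J\<close> minimally dependent relative to \<open>n\<close>, the partition \<open>{J1, J2}\<close> and the restriction of
  \<open>\<beta>\<close> to \<open>J\<close> in \<^const>\<open>associated_relation\<close> exist and are unique. Hence the partitions and
  tuples relative to \<open>n\<close> and \<open>m\<close> coincide iff one choice serves for both; the weight identity is
  symmetric in \<open>J1\<close> and \<open>J2\<close>.
\<close>

definition similar_pattern ::
  "enat \<Rightarrow> (nat \<Rightarrow> real) \<Rightarrow> (nat \<Rightarrow> nat) \<Rightarrow> (nat \<Rightarrow> real) \<Rightarrow> (nat \<Rightarrow> nat) \<Rightarrow> bool" where
  "similar_pattern d b n c m \<longleftrightarrow>
     minimal_dependent d n = minimal_dependent d m \<and>
     (\<forall>J \<in> minimal_dependent d n. \<exists>J1 J2 \<beta>.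
        associated_relation n J J1 J2 \<beta> \<and> associated_relation m J J1 J2 \<beta> \<and>
        (\<Prod>i\<in>J1. c i ^ \<beta> i) * (\<Prod>i\<in>J2. b i ^ \<beta> i) =
        (\<Prod>i\<in>J2. c i ^ \<beta> i) * (\<Prod>i\<in>J1. b i ^ \<beta> i))"

end

(*
  For g in the Drury--Arveson space with power series coefficients a_w indexed by words w, the
  composition of g with the embedding f_(b,n) is a Dirichlet series whose N-th coefficient is the
  sum of a_w sqrt(b)^w over the words with n^w = N. By uniqueness of Dirichlet coefficients, g
  vanishes on the image of f_(b,n) iff each of these finite sums vanishes. A similar pattern says
  exactly that n and m partition the words into the same classes and that sqrt(b)^w and sqrt(c)^w
  are proportional on every class (the circuits J span all multiplicative relations over the
  rationals), so then the same g vanish on both images: the varieties agree. Moreover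
  g o f_(b,n) |-> g o f_(c,m) is a unitary between the two reproducing kernel spaces, and it
  respects products since these are also determined by the coefficients; hence it restricts to
  the isometric isomorphism of the multiplier algebras in (iv). No interpolation theorem
  (complete Pick property) is needed.

  Conversely each of (ii), (iii), (iv) implies that the same multipliers vanish on both images,
  and testing this on the binomials sqrt(b)^w z^v - sqrt(b)^v z^w with n^v = n^w gives the pattern.
*)
theory Submission
  imports Defs
begin

section \<open>Projections and uniqueness in reproducing kernel Hilbert spaces\<close>

text \<open>The kernel spaces in the statement are picked by \<open>SOME\<close>, so nothing can be
  computed before an explicit model and the uniqueness of a reproducing kernel space are available;
  both are built here. The model comes from a feature map: coefficient families live in
  \<open>ell2\<close> over words, and a function is such a family paired with the features of the
  points. Distinct words may share a monomial or a frequency, so many families give the same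
  function, and the norm of a function is that of its least-norm family. This redundancy reduces the
  unitary to a statement about kernels: under a similar pattern the two synthesis maps annihilate
  the same families, hence share the least-norm families, and the operator that keeps the
  coefficients and changes the embedding is well defined and isometric. Products of functions become
  double sums over pairs of words, so an identity between series with different index sets has to be
  carried over, not merely the vanishing of one series.\<close>

lemma minus_eq_add_scale: "f - g = f + scale_fun (-1) g"
  by (auto simp: scale_fun_def)

lemma scale_fun_apply [simp]: "scale_fun a f x = a * f x"
  by (simp add: scale_fun_def)

context reproducing_kernel_Hilbert_space
begin

definition nrm :: "('x \<Rightarrow> complex) \<Rightarrow> real" where
  "nrm f = sqrt (Re (ip f f))"

abbreviation kern :: "'x \<Rightarrow> 'x \<Rightarrow> complex" where
  "kern x \<equiv> restrict0 X (\<lambda>y. K y x)"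

lemma eq_0_outside: "f \<in> H \<Longrightarrow> x \<notin> X \<Longrightarrow> f x = 0"
  using subset_functions by (auto simp: functions_on_def)

lemma diff_mem: "f \<in> H \<Longrightarrow> g \<in> H \<Longrightarrow> f - g \<in> H"
  by (simp only: minus_eq_add_scale add_mem scale_mem)

lemma ip_add_right: "f \<in> H \<Longrightarrow> g \<in> H \<Longrightarrow> h \<in> H \<Longrightarrow> ip f (g + h) = ip f g + ip f h"
  by (metis add_mem complex_cnj_add ip_add ip_cnj)

lemma ip_scale_right: "f \<in> H \<Longrightarrow> g \<in> H \<Longrightarrow> ip f (scale_fun a g) = cnj a * ip f g"
  by (metis complex_cnj_mult ip_cnj ip_scale scale_mem)

lemma ip_zero_left:
  assumes "f \<in> H"
  shows "ip 0 f = 0"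
proof -
  have "scale_fun 0 f = 0" by (auto simp: scale_fun_def)
  then show ?thesis using ip_scale[OF assms assms, of 0] by simp
qed

lemma ip_zero_right: "f \<in> H \<Longrightarrow> ip f 0 = 0"
  using ip_cnj[OF zero_mem] ip_zero_left by simp

lemma ip_diff: "f \<in> H \<Longrightarrow> g \<in> H \<Longrightarrow> h \<in> H \<Longrightarrow> ip (f - g) h = ip f h - ip g h"
  by (simp only: minus_eq_add_scale ip_add ip_scale scale_mem) simp

lemma ip_diff_right: "f \<in> H \<Longrightarrow> g \<in> H \<Longrightarrow> h \<in> H \<Longrightarrow> ip f (g - h) = ip f g - ip f h"
  by (simp only: minus_eq_add_scale ip_add_right ip_scale_right scale_mem) simp

lemma ip_self_real: "f \<in> H \<Longrightarrow> ip f f = of_real (Re (ip f f))"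
  by (metis Reals_cnj_iff complex_is_Real_iff complex_eq_iff Im_complex_of_real Re_complex_of_real ip_cnj)

lemma Re_ip_commute: "f \<in> H \<Longrightarrow> g \<in> H \<Longrightarrow> Re (ip f g) = Re (ip g f)"
  by (metis ip_cnj complex_cnj(1) complex.sel(1) cnj.sel(1))

lemma nrm_nonneg: "f \<in> H \<Longrightarrow> 0 \<le> nrm f"
  by (simp add: nrm_def ip_nonneg)

lemma nrm_power2: "f \<in> H \<Longrightarrow> (nrm f)\<^sup>2 = Re (ip f f)"
  by (simp add: nrm_def ip_nonneg)

lemma nrm_eq_0: "f \<in> H \<Longrightarrow> nrm f = 0 \<Longrightarrow> f = 0"
  by (metis ip_definite ip_self_real nrm_power2 of_real_0 power_zero_numeral)

lemma nrm_zero: "nrm 0 = 0"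
  by (simp add: nrm_def ip_zero_left[OF zero_mem])

lemma nrm_scale: "f \<in> H \<Longrightarrow> nrm (scale_fun a f) = cmod a * nrm f"
proof -
  assume f: "f \<in> H"
  have "Re (ip (scale_fun a f) (scale_fun a f)) = Re ((a * cnj a) * ip f f)"
    using f by (simp add: ip_scale ip_scale_right scale_mem mult.assoc mult.left_commute[of a])
  also have "\<dots> = (cmod a)\<^sup>2 * Re (ip f f)"
    by (simp only: complex_norm_square[symmetric] of_real_power[symmetric] Re_complex_of_real
        times_complex.sel Im_complex_of_real)
  finally show ?thesis
    by (simp add: nrm_def real_sqrt_mult)
qed

lemma nrm_add_power2:
  "f \<in> H \<Longrightarrow> g \<in> H \<Longrightarrow> (nrm (f + g))\<^sup>2 = (nrm f)\<^sup>2 + 2 * Re (ip f g) + (nrm g)\<^sup>2"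
  using Re_ip_commute[of f g] by (simp add: nrm_power2 add_mem ip_add ip_add_right)

lemma nrm_diff_power2:
  "f \<in> H \<Longrightarrow> g \<in> H \<Longrightarrow> (nrm (f - g))\<^sup>2 = (nrm f)\<^sup>2 - 2 * Re (ip f g) + (nrm g)\<^sup>2"
  using Re_ip_commute[of f g] by (simp add: nrm_power2 diff_mem ip_diff ip_diff_right)

lemma nrm_minus_commute: "f \<in> H \<Longrightarrow> g \<in> H \<Longrightarrow> nrm (f - g) = nrm (g - f)"
  by (rule power2_eq_imp_eq) (simp_all add: nrm_diff_power2 nrm_nonneg diff_mem Re_ip_commute)

lemma Cauchy_Schwarz: "f \<in> H \<Longrightarrow> g \<in> H \<Longrightarrow> cmod (ip f g) \<le> nrm f * nrm g"
proof -
  assume fg: "f \<in> H" "g \<in> H"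
  show ?thesis
  proof (cases "nrm g = 0")
    case True
    then have "g = 0" using nrm_eq_0 fg by blast
    then show ?thesis
      using fg(1) by (simp add: nrm_zero ip_zero_right)
  next
    case False
    then have pos: "0 < (nrm g)\<^sup>2" by simp
    \<comment> \<open>Coefficient of the orthogonal projection of \<open>f\<close> onto
      \<open>g\<close>.\<close>
    define a where "a = ip f g / of_real ((nrm g)\<^sup>2)"
    have "0 \<le> (nrm (f - scale_fun a g))\<^sup>2" by simp
    also have "\<dots> = (nrm f)\<^sup>2 - 2 * Re (cnj a * ip f g) + (cmod a)\<^sup>2 * (nrm g)\<^sup>2"
      using fg by (simp add: nrm_diff_power2 scale_mem ip_scale_right nrm_scale power_mult_distrib)
    also have "cnj a * ip f g = of_real ((cmod (ip f g))\<^sup>2 / (nrm g)\<^sup>2)"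
      by (simp add: a_def complex_norm_square mult.commute del: of_real_power)
    also have "(cmod a)\<^sup>2 * (nrm g)\<^sup>2 = (cmod (ip f g))\<^sup>2 / (nrm g)\<^sup>2"
      using pos by (simp add: a_def norm_divide power_divide power2_eq_square norm_mult)
    finally have "(cmod (ip f g))\<^sup>2 / (nrm g)\<^sup>2 \<le> (nrm f)\<^sup>2"
      by (simp del: of_real_divide of_real_power)
    then have "(cmod (ip f g))\<^sup>2 \<le> (nrm f * nrm g)\<^sup>2"
      using pos by (simp add: field_simps power_mult_distrib)
    then show ?thesis
      by (rule power2_le_imp_le) (simp add: fg nrm_nonneg)
  qed
qed

lemma nrm_triangle: "f \<in> H \<Longrightarrow> g \<in> H \<Longrightarrow> nrm (f + g) \<le> nrm f + nrm g"
proof -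
  assume fg: "f \<in> H" "g \<in> H"
  have "Re (ip f g) \<le> nrm f * nrm g"
    using Cauchy_Schwarz[OF fg] complex_Re_le_cmod order_trans by blast
  then have "(nrm (f + g))\<^sup>2 \<le> (nrm f + nrm g)\<^sup>2"
    using fg by (simp add: nrm_add_power2 power2_sum)
  then show ?thesis
    by (rule power2_le_imp_le) (simp add: fg nrm_nonneg)
qed

lemma nrm_triangle_diff:
  "f \<in> H \<Longrightarrow> g \<in> H \<Longrightarrow> h \<in> H \<Longrightarrow> nrm (f - h) \<le> nrm (f - g) + nrm (g - h)"
  using nrm_triangle[OF diff_mem diff_mem, of f g g h] by simp

lemma nrm_diff_lower: "f \<in> H \<Longrightarrow> g \<in> H \<Longrightarrow> \<bar>nrm f - nrm g\<bar> \<le> nrm (f - g)"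
proof -
  assume fg: "f \<in> H" "g \<in> H"
  have "nrm f \<le> nrm (f - g) + nrm g" "nrm g \<le> nrm (g - f) + nrm f"
    using nrm_triangle[OF diff_mem[OF fg] fg(2)] nrm_triangle[OF diff_mem[OF fg(2,1)] fg(1)]
    by simp_all
  then show ?thesis
    using nrm_minus_commute[OF fg] by linarith
qed

lemma parallelogram:
  "f \<in> H \<Longrightarrow> g \<in> H \<Longrightarrow> (nrm (f + g))\<^sup>2 + (nrm (f - g))\<^sup>2 = 2 * (nrm f)\<^sup>2 + 2 * (nrm g)\<^sup>2"
  using nrm_add_power2[of f g] nrm_diff_power2[of f g] by linarith

lemma evaluation_bound:
  assumes "x \<in> X" "f \<in> H"
  shows "cmod (f x) \<le> nrm f * nrm (kern x)"
  using Cauchy_Schwarz[OF assms(2) kernel_mem[OF assms(1)]] by (simp only: reproducing[OF assms])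

lemma tendsto_evaluation:
  assumes "x \<in> X" "\<And>k. F k \<in> H" "f \<in> H" "(\<lambda>k. nrm (F k - f)) \<longlonglongrightarrow> 0"
  shows "(\<lambda>k. F k x) \<longlonglongrightarrow> f x"
proof -
  have *: "(\<lambda>k. nrm (F k - f) * nrm (kern x)) \<longlonglongrightarrow> 0"
    using tendsto_mult_right[OF assms(4), of "nrm (kern x)"] by simp
  have "cmod (F k x - f x) \<le> nrm (F k - f) * nrm (kern x)" for k
    using evaluation_bound[OF assms(1) diff_mem[OF assms(2,3)], of k] by (simp only: minus_apply)
  then have "(\<lambda>k. F k x - f x) \<longlonglongrightarrow> 0"
    by (intro Lim_null_comparison[OF always_eventually *]) blast
  then show ?thesis
    by (simp add: LIM_zero_iff)
qed

lemma nrm_tendsto_0I: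
  assumes "\<And>k. F k \<in> H" "\<And>k. nrm (F k) \<le> r k" "r \<longlonglongrightarrow> 0"
  shows "(\<lambda>k. nrm (F k)) \<longlonglongrightarrow> 0"
  by (rule Lim_null_comparison[OF always_eventually assms(3)]) (simp add: nrm_nonneg assms(1,2))

lemma tendsto_nrm:
  assumes "\<And>k. F k \<in> H" "f \<in> H" "(\<lambda>k. nrm (F k - f)) \<longlonglongrightarrow> 0"
  shows "(\<lambda>k. nrm (F k)) \<longlonglongrightarrow> nrm f"
proof -
  have "(\<lambda>k. nrm (F k) - nrm f) \<longlonglongrightarrow> 0"
    by (rule Lim_null_comparison[OF always_eventually assms(3)])
      (simp add: nrm_diff_lower assms(1,2))
  then show ?thesis
    by (simp add: LIM_zero_iff)
qed

lemma tendsto_imp_Cauchy: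
  assumes "\<And>k. F k \<in> H" "f \<in> H" "(\<lambda>k. nrm (F k - f)) \<longlonglongrightarrow> 0" "0 < e"
  shows "\<exists>N. \<forall>i\<ge>N. \<forall>j\<ge>N. nrm (F i - F j) < e"
proof -
  obtain N where N: "\<And>k. k \<ge> N \<Longrightarrow> nrm (F k - f) < e / 2"
    using order_tendstoD(2)[OF assms(3), of "e / 2"] assms(4)
    by (auto simp: eventually_sequentially)
  have "nrm (F i - F j) < e" if "i \<ge> N" "j \<ge> N" for i j
    using nrm_triangle_diff[OF assms(1,2,1), of i j] N[OF that(1)] N[OF that(2)]
      nrm_minus_commute[OF assms(2,1), of j] by linarith
  then show ?thesis by blast
qed

text \<open>The closest-point argument. A minimising sequence is Cauchy by the parallelogram law,
  its limit stays in \<open>S\<close> by sequential closedness, and minimality in the direction of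
  \<open>h\<close> forces orthogonality.\<close>

lemma projection_exists:
  assumes SH: "S \<subseteq> H" and S0: "0 \<in> S" and Sadd: "\<And>f g. f \<in> S \<Longrightarrow> g \<in> S \<Longrightarrow> f + g \<in> S"
    and Sscale: "\<And>a f. f \<in> S \<Longrightarrow> scale_fun a f \<in> S"
    and Sclosed: "\<And>F f. (\<And>k. F k \<in> S) \<Longrightarrow> f \<in> H \<Longrightarrow> (\<lambda>k. nrm (F k - f)) \<longlonglongrightarrow> 0 \<Longrightarrow> f \<in> S"
    and f: "f \<in> H"
  shows "\<exists>g\<in>S. \<forall>h\<in>S. ip (f - g) h = 0"
proof -
  define D where "D = (\<lambda>s. (nrm (f - s))\<^sup>2) ` S"
  define \<delta> where "\<delta> = Inf D"
  have D: "D \<noteq> {}" "bdd_below D"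
    using S0 by (auto simp: D_def intro!: bdd_belowI[of _ 0])
  have \<delta>_le: "\<delta> \<le> (nrm (f - s))\<^sup>2" if "s \<in> S" for s
    unfolding \<delta>_def by (rule cInf_lower) (use that D in \<open>auto simp: D_def\<close>)
  have "\<exists>s\<in>S. (nrm (f - s))\<^sup>2 < \<delta> + 1 / Suc k" for k
    using cInf_lessD[OF D(1), of "\<delta> + 1 / Suc k"] by (auto simp: \<delta>_def D_def)
  then obtain s where s: "\<And>k. s k \<in> S" "\<And>k. (nrm (f - s k))\<^sup>2 < \<delta> + 1 / Suc k"
    by metis
  then have sH: "s k \<in> H" for k using SH by blast
  have close: "(nrm (s i - s j))\<^sup>2 \<le> 2 / Suc i + 2 / Suc j" for i j
  proof -
    \<comment> \<open>The midpoint of \<open>s i\<close> and \<open>s j\<close> lies in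
      \<open>S\<close>, so its squared distance to \<open>f\<close> is at least
      \<open>\<delta>\<close>; the parallelogram law turns this into a bound on
      \<open>s i - s j\<close>.\<close>
    let ?m = "scale_fun (1/2) (s i + s j)"
    have "(f - s i) + (f - s j) = scale_fun 2 (f - ?m)" "(f - s i) - (f - s j) = s j - s i"
      by (auto simp: fun_eq_iff scale_fun_def field_simps)
    moreover have "f - ?m \<in> H"
      by (intro diff_mem f scale_mem add_mem sH)
    ultimately have "4 * (nrm (f - ?m))\<^sup>2 + (nrm (s j - s i))\<^sup>2
        = 2 * (nrm (f - s i))\<^sup>2 + 2 * (nrm (f - s j))\<^sup>2"
      using parallelogram[of "f - s i" "f - s j"] f sH
      by (simp add: diff_mem nrm_scale power_mult_distrib)
    moreover have "\<delta> \<le> (nrm (f - ?m))\<^sup>2"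
      by (intro \<delta>_le Sscale Sadd s)
    ultimately show ?thesis
      using s(2)[of i] s(2)[of j] nrm_minus_commute[OF sH sH, of i j] by simp
  qed
  have "\<exists>N. \<forall>i\<ge>N. \<forall>j\<ge>N. nrm (s i - s j) < e" if "0 < e" for e
  proof -
    obtain N where N: "4 / e\<^sup>2 < real (Suc N)"
      using reals_Archimedean2[of "4 / e\<^sup>2"] by (metis less_trans of_nat_less_iff lessI)
    have "nrm (s i - s j) < e" if ij: "i \<ge> N" "j \<ge> N" for i j
    proof -
      have "(nrm (s i - s j))\<^sup>2 \<le> 2 / Suc i + 2 / Suc j" by (rule close)
      also have "\<dots> \<le> 2 / Suc N + 2 / Suc N"
        using ij by (intro add_mono divide_left_mono) auto
      also have "\<dots> = 4 / Suc N" by simp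
      also have "\<dots> < e\<^sup>2"
        using N \<open>0 < e\<close> by (simp add: field_simps)
      finally show ?thesis
        using \<open>0 < e\<close> power_less_imp_less_base by fastforce
    qed
    then show ?thesis by blast
  qed
  then obtain g where g: "g \<in> H" "(\<lambda>k. nrm (s k - g)) \<longlonglongrightarrow> 0"
    using complete[of s] sH unfolding nrm_def by blast
  have gS: "g \<in> S" by (rule Sclosed[OF s(1) g])
  have "(\<lambda>k. nrm ((f - s k) - (f - g))) \<longlonglongrightarrow> 0"
  proof -
    have "nrm ((f - s k) - (f - g)) = nrm (s k - g)" for k
      using nrm_minus_commute[OF sH g(1)] by (simp add: algebra_simps)
    then show ?thesis using g by simp
  qed
  then have "(\<lambda>k. nrm (f - s k)) \<longlonglongrightarrow> nrm (f - g)"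
    by (intro tendsto_nrm diff_mem f sH g)
  then have "(\<lambda>k. (nrm (f - s k))\<^sup>2) \<longlonglongrightarrow> (nrm (f - g))\<^sup>2"
    by (rule tendsto_power)
  moreover have "(\<lambda>k. \<delta> + 1 / real (Suc k)) \<longlonglongrightarrow> \<delta> + 0"
    by (intro tendsto_intros LIMSEQ_Suc lim_1_over_n)
  ultimately have le: "(nrm (f - g))\<^sup>2 \<le> \<delta>"
    using s(2) by (intro LIMSEQ_le) (auto intro: less_imp_le)
  have "ip (f - g) h = 0" if h: "h \<in> S" for h
  proof -
    let ?z = "ip (f - g) h"
    have hH: "h \<in> H" using h SH by blast
    \<comment> \<open>Step length for moving from \<open>g\<close> along \<open>?z\<close> times
      \<open>h\<close>. The first-order gain is \<open>2 * t * |?z|^2\<close>, and \<open>t\<close>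
      times the squared norm of \<open>h\<close> is at most 1, so the second-order cost is at most
      half the gain. The summand 1 also covers \<open>h = 0\<close>.\<close>
    define t where "t = 1 / (1 + (nrm h)\<^sup>2)"
    have t: "0 < t" "t * (nrm h)\<^sup>2 \<le> 1"
      by (auto simp: t_def divide_simps add_pos_nonneg)
    let ?a = "of_real t * ?z"
    have "\<delta> \<le> (nrm (f - (g + scale_fun ?a h)))\<^sup>2"
      by (intro \<delta>_le Sadd Sscale gS h)
    also have "f - (g + scale_fun ?a h) = (f - g) - scale_fun ?a h" by simp
    also have "(nrm \<dots>)\<^sup>2 = (nrm (f - g))\<^sup>2 - 2 * Re (cnj ?a * ?z) + (cmod ?a)\<^sup>2 * (nrm h)\<^sup>2"
      using f g hH by (subst nrm_diff_power2)
        (auto simp: diff_mem scale_mem ip_scale_right nrm_scale power_mult_distrib)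
    also have "cnj ?a * ?z = of_real (t * (cmod ?z)\<^sup>2)"
      by (simp add: complex_norm_square mult_ac del: of_real_power)
    also have "(cmod ?a)\<^sup>2 * (nrm h)\<^sup>2 = (t * (cmod ?z)\<^sup>2) * (t * (nrm h)\<^sup>2)"
      by (simp add: norm_mult power2_eq_square)
    finally have "2 * (t * (cmod ?z)\<^sup>2) \<le> (t * (cmod ?z)\<^sup>2) * (t * (nrm h)\<^sup>2)"
      unfolding Re_complex_of_real using le by linarith
    also have "\<dots> \<le> (t * (cmod ?z)\<^sup>2) * 1"
      using t by (intro mult_left_mono) auto
    finally have "t * (cmod ?z)\<^sup>2 \<le> 0" by simp
    then show ?thesis
      using t by (simp add: mult_le_0_iff)
  qed
  with gS show ?thesis by blast
qed

end

text \<open>The functions on which both inner products agree are dense in \<open>H1\<close>, since a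
  residual orthogonal to all kernel functions vanishes pointwise. An approximating sequence is then
  Cauchy in \<open>H2\<close> too, and its two limits coincide because norm convergence implies
  pointwise convergence in either space.\<close>

lemma rkhs_unique_aux:
  assumes "reproducing_kernel_Hilbert_space X K H1 ip1"
    and "reproducing_kernel_Hilbert_space X K H2 ip2"
    and f: "f \<in> H1"
  shows "f \<in> H2 \<and> sqrt (Re (ip1 f f)) = sqrt (Re (ip2 f f))"
proof -
  interpret A: reproducing_kernel_Hilbert_space X K H1 ip1 by fact
  interpret B: reproducing_kernel_Hilbert_space X K H2 ip2 by fact
  \<comment> \<open>\<open>S\<close> takes the place of the span of the kernel functions: it
    contains them by the reproducing property, is visibly a subspace and carries equal norms,
    without any finite linear combinations. \<open>C\<close> is its closure in
    \<open>H1\<close>.\<close>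
  define S where "S = {f \<in> H1 \<inter> H2. \<forall>g\<in>H1 \<inter> H2. ip1 g f = ip2 g f}"
  define C where "C = {f \<in> H1. \<exists>F. (\<forall>k. F k \<in> S) \<and> (\<lambda>k. A.nrm (F k - f)) \<longlonglongrightarrow> 0}"
  have S_nrm: "A.nrm u = B.nrm u" if "u \<in> S" for u
    using that by (auto simp: S_def A.nrm_def B.nrm_def)
  have Sadd: "u + v \<in> S" if "u \<in> S" "v \<in> S" for u v
    using that by (auto simp: S_def A.add_mem B.add_mem A.ip_add_right B.ip_add_right)
  have Sscale: "scale_fun a u \<in> S" if "u \<in> S" for a u
    using that by (auto simp: S_def A.scale_mem B.scale_mem A.ip_scale_right B.ip_scale_right)
  have Sdiff: "u - v \<in> S" if "u \<in> S" "v \<in> S" for u v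
    using Sadd[OF that(1) Sscale[OF that(2)], of "-1"] by (simp only: minus_eq_add_scale)
  have SH: "S \<subseteq> H1" "S \<subseteq> H2" by (auto simp: S_def)
  have kern_S: "A.kern x \<in> S" if "x \<in> X" for x
    using that by (auto simp: S_def A.kernel_mem B.kernel_mem A.reproducing B.reproducing)
  have SC: "u \<in> C" if "u \<in> S" for u
  proof -
    have "u - u = 0" by (rule diff_self)
    then have "(\<lambda>k :: nat. A.nrm (u - u)) \<longlonglongrightarrow> 0"
      by (simp only: A.nrm_zero tendsto_const)
    then show ?thesis
      using that SH unfolding C_def by (intro CollectI conjI exI[of _ "\<lambda>_. u"]) auto
  qed
  have "0 \<in> S"
    using A.zero_mem B.zero_mem A.ip_zero_right B.ip_zero_right unfolding S_def by fastforce
  then have C0: "0 \<in> C"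
    by (rule SC)
  have Cadd: "u + v \<in> C" if uv: "u \<in> C" "v \<in> C" for u v
  proof -
    obtain F G where F: "\<And>k. F k \<in> S" "(\<lambda>k. A.nrm (F k - u)) \<longlonglongrightarrow> 0"
      and G: "\<And>k. G k \<in> S" "(\<lambda>k. A.nrm (G k - v)) \<longlonglongrightarrow> 0"
      using uv by (auto simp: C_def)
    have H: "u \<in> H1" "v \<in> H1" using uv by (auto simp: C_def)
    have "A.nrm ((F k + G k) - (u + v)) \<le> A.nrm (F k - u) + A.nrm (G k - v)" for k
    proof -
      have "F k - u \<in> H1" "G k - v \<in> H1"
        using H F(1) G(1) SH by (auto intro!: A.diff_mem)
      moreover have "(F k + G k) - (u + v) = (F k - u) + (G k - v)" by simp
      ultimately show ?thesis
        using A.nrm_triangle[of "F k - u" "G k - v"] by metis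
    qed
    moreover have "(F k + G k) - (u + v) \<in> H1" for k
      using H F(1) G(1) SH by (intro A.diff_mem A.add_mem) auto
    ultimately have "(\<lambda>k. A.nrm ((F k + G k) - (u + v))) \<longlonglongrightarrow> 0"
      using tendsto_add[OF F(2) G(2)] by (intro A.nrm_tendsto_0I) simp_all
    then show ?thesis
      using H Sadd[OF F(1) G(1)] A.add_mem unfolding C_def by (auto intro!: exI[of _ "\<lambda>k. F k + G k"])
  qed
  have Cscale: "scale_fun a u \<in> C" if u: "u \<in> C" for a u
  proof -
    obtain F where F: "\<And>k. F k \<in> S" "(\<lambda>k. A.nrm (F k - u)) \<longlonglongrightarrow> 0"
      using u by (auto simp: C_def)
    have H: "u \<in> H1" using u by (auto simp: C_def)
    have eq: "A.nrm (scale_fun a (F k) - scale_fun a u) = cmod a * A.nrm (F k - u)" for k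
    proof -
      have "scale_fun a (F k) - scale_fun a u = scale_fun a (F k - u)"
        by (auto simp: algebra_simps)
      then show ?thesis
        using A.nrm_scale[OF A.diff_mem, of "F k" u a] F(1) H SH by auto
    qed
    have "(\<lambda>k. A.nrm (scale_fun a (F k) - scale_fun a u)) \<longlonglongrightarrow> 0"
      unfolding eq using tendsto_mult_right_zero[OF F(2)] by blast
    then show ?thesis
      using H Sscale[OF F(1)] A.scale_mem unfolding C_def
      by (auto intro!: exI[of _ "\<lambda>k. scale_fun a (F k)"])
  qed
  \<comment> \<open>Each \<open>F k\<close> is replaced by an element of \<open>S\<close> at
    distance below \<open>1 / Suc k\<close>, so closing \<open>C\<close> once more adds
    nothing.\<close>
  have Cclosed: "u \<in> C" if F: "\<And>k. F k \<in> C" and u: "u \<in> H1" and lim: "(\<lambda>k. A.nrm (F k - u)) \<longlonglongrightarrow> 0"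
    for F u
  proof -
    have FH: "F k \<in> H1" for k using F by (auto simp: C_def)
    have "\<exists>v\<in>S. A.nrm (v - F k) < 1 / Suc k" for k
    proof -
      obtain G where "\<And>i. G i \<in> S" "(\<lambda>i. A.nrm (G i - F k)) \<longlonglongrightarrow> 0"
        using F[of k] by (auto simp: C_def)
      then show ?thesis
        using order_tendstoD(2)[of "\<lambda>i. A.nrm (G i - F k)" 0 sequentially "1 / Suc k"]
        by (auto simp: eventually_sequentially)
    qed
    then obtain G where G: "\<And>k. G k \<in> S" "\<And>k. A.nrm (G k - F k) < 1 / Suc k"
      by metis
    have GH: "G k \<in> H1" for k using G SH by auto
    have "A.nrm (G k - u) \<le> 1 / Suc k + A.nrm (F k - u)" for k
      using A.nrm_triangle_diff[OF GH FH u, of k k] G(2)[of k] by linarith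
    moreover have "(\<lambda>k. 1 / real (Suc k) + A.nrm (F k - u)) \<longlonglongrightarrow> 0 + 0"
      by (intro tendsto_add lim LIMSEQ_Suc lim_1_over_n)
    ultimately have "(\<lambda>k. A.nrm (G k - u)) \<longlonglongrightarrow> 0"
      by (intro A.nrm_tendsto_0I A.diff_mem GH u) simp_all
    then show ?thesis
      using G u by (auto simp: C_def)
  qed
  have "\<exists>g\<in>C. \<forall>h\<in>C. ip1 (f - g) h = 0"
    by (rule A.projection_exists[OF _ C0 Cadd Cscale Cclosed f]) (auto simp: C_def)
  then obtain g where g: "g \<in> C" "\<And>h. h \<in> C \<Longrightarrow> ip1 (f - g) h = 0"
    by blast
  have gH: "g \<in> H1" using g by (auto simp: C_def)
  have fg: "f x = g x" for x
  proof (cases "x \<in> X")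
    case True
    then have "(f - g) x = 0"
      using g(2)[OF SC[OF kern_S]] A.reproducing[OF _ A.diff_mem[OF f gH]] by simp
    then show ?thesis by simp
  next
    case False
    then show ?thesis
      using A.eq_0_outside[OF f] A.eq_0_outside[OF gH] by simp
  qed
  then have "f = g" by blast
  then have "f \<in> C" using g(1) by simp
  then obtain F where F: "\<And>k. F k \<in> S" "(\<lambda>k. A.nrm (F k - f)) \<longlonglongrightarrow> 0"
    by (auto simp: C_def)
  have FH: "F k \<in> H1" "F k \<in> H2" for k using F(1) SH by auto
  have "\<exists>N. \<forall>i\<ge>N. \<forall>j\<ge>N. B.nrm (F i - F j) < e" if "0 < e" for e
    using A.tendsto_imp_Cauchy[OF FH(1) f F(2) that] by (simp add: S_nrm[OF Sdiff[OF F(1) F(1)]])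
  then obtain h where h: "h \<in> H2" "(\<lambda>k. B.nrm (F k - h)) \<longlonglongrightarrow> 0"
    using B.complete[of F] FH unfolding B.nrm_def by blast
  have "f x = h x" for x
  proof (cases "x \<in> X")
    case True
    show ?thesis
      using A.tendsto_evaluation[OF True FH(1) f F(2)] B.tendsto_evaluation[OF True FH(2) h]
      by (rule LIMSEQ_unique)
  next
    case False
    then show ?thesis
      using A.eq_0_outside[OF f] B.eq_0_outside[OF h(1)] by simp
  qed
  then have "f = h" by blast
  moreover have "A.nrm f = B.nrm h"
    using A.tendsto_nrm[OF FH(1) f F(2)] B.tendsto_nrm[OF FH(2) h]
    by (intro LIMSEQ_unique[of "\<lambda>k. A.nrm (F k)"]) (simp_all add: S_nrm F(1))
  ultimately show ?thesis
    using h by (simp add: A.nrm_def B.nrm_def)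
qed

lemma rkhs_is_rkhs:
  assumes "reproducing_kernel_Hilbert_space X K H ip"
  shows "reproducing_kernel_Hilbert_space X K (rkhs_space X K) (snd (rkhs X K))"
proof -
  have "case rkhs X K of (H, ip) \<Rightarrow> reproducing_kernel_Hilbert_space X K H ip"
    unfolding rkhs_def by (rule someI[of _ "(H, ip)"]) (use assms in simp)
  then show ?thesis
    by (simp add: rkhs_space_def case_prod_beta)
qed

text \<open>Eliminates the choice operator: any explicit model of the kernel computes
  \<open>rkhs_space\<close> and \<open>rkhs_norm\<close>.\<close>

lemma rkhs_unique:
  assumes "reproducing_kernel_Hilbert_space X K H ip"
  shows "rkhs_space X K = H" and "f \<in> H \<Longrightarrow> rkhs_norm X K f = sqrt (Re (ip f f))"
proof -
  note R = rkhs_is_rkhs[OF assms]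
  show "rkhs_space X K = H"
    using rkhs_unique_aux[OF assms R] rkhs_unique_aux[OF R assms] by blast
  show "rkhs_norm X K f = sqrt (Re (ip f f))" if "f \<in> H"
    using rkhs_unique_aux[OF assms R that] by (simp add: rkhs_norm_def)
qed

section \<open>Reproducing kernel Hilbert spaces from feature maps\<close>

definition ell2 :: "'i set \<Rightarrow> ('i \<Rightarrow> complex) set" where
  "ell2 I = {a \<in> functions_on I. (\<lambda>i. (cmod (a i))\<^sup>2) summable_on I}"

definition ell2_inner :: "'i set \<Rightarrow> ('i \<Rightarrow> complex) \<Rightarrow> ('i \<Rightarrow> complex) \<Rightarrow> complex" where
  "ell2_inner I a b = (\<Sum>\<^sub>\<infinity>i\<in>I. a i * cnj (b i))"

lemma abs_summable_mult_square:
  fixes a b :: "'i \<Rightarrow> complex"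
  assumes "(\<lambda>i. (cmod (a i))\<^sup>2) summable_on I" "(\<lambda>i. (cmod (b i))\<^sup>2) summable_on I"
  shows "(\<lambda>i. norm (a i * b i)) summable_on I"
  by (rule Infinite_Sum.abs_summable_product) (use assms in \<open>simp_all add: norm_mult power2_eq_square\<close>)

lemma ell2_mult_summable:
  assumes "a \<in> ell2 I" "b \<in> ell2 I"
  shows "(\<lambda>i. a i * cnj (b i)) summable_on I"
  by (rule abs_summable_summable, rule abs_summable_mult_square) (use assms in \<open>auto simp: ell2_def\<close>)

lemma ell2_inner_self: "a \<in> ell2 I \<Longrightarrow> ell2_inner I a a = of_real (\<Sum>\<^sub>\<infinity>i\<in>I. (cmod (a i))\<^sup>2)"
proof -
  assume "a \<in> ell2 I"
  then have "((\<lambda>i. (cmod (a i))\<^sup>2) has_sum (\<Sum>\<^sub>\<infinity>i\<in>I. (cmod (a i))\<^sup>2)) I"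
    by (simp add: ell2_def)
  from has_sum_of_real[OF this, where ?'a = complex] show ?thesis
    unfolding ell2_inner_def complex_norm_square by (rule infsumI)
qed

lemma ell2_add: "a \<in> ell2 I \<Longrightarrow> b \<in> ell2 I \<Longrightarrow> a + b \<in> ell2 I"
proof -
  assume ab: "a \<in> ell2 I" "b \<in> ell2 I"
  have "(\<lambda>i. 2 * (cmod (a i))\<^sup>2 + 2 * (cmod (b i))\<^sup>2) summable_on I"
    using ab by (intro summable_on_add summable_on_cmult_right) (auto simp: ell2_def)
  moreover have "(cmod (a i + b i))\<^sup>2 \<le> 2 * (cmod (a i))\<^sup>2 + 2 * (cmod (b i))\<^sup>2" for i
  proof -
    have "(cmod (a i + b i))\<^sup>2 \<le> (cmod (a i) + cmod (b i))\<^sup>2"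
      by (intro power_mono norm_triangle_ineq) auto
    also have "\<dots> \<le> 2 * (cmod (a i))\<^sup>2 + 2 * (cmod (b i))\<^sup>2"
      using sum_squares_bound[of "cmod (a i)" "cmod (b i)"] by (simp add: power2_sum)
    finally show ?thesis .
  qed
  ultimately have "(\<lambda>i. (cmod (a i + b i))\<^sup>2) summable_on I"
    by (rule summable_on_comparison_test) auto
  then show ?thesis
    using ab by (auto simp: ell2_def functions_on_def)
qed

lemma ell2_scale: "a \<in> ell2 I \<Longrightarrow> scale_fun z a \<in> ell2 I"
  by (auto simp: ell2_def functions_on_def scale_fun_def norm_mult power_mult_distrib
      intro!: summable_on_cmult_right)

lemma ell2_zero: "0 \<in> ell2 I"
  by (simp add: ell2_def functions_on_def)

text \<open>Bounds on finite partial sums survive pointwise limits, which is how they enter the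
  proof of completeness.\<close>

lemma ell2_bounded_by_finite_sums:
  assumes "a \<in> functions_on I" "\<And>S. finite S \<Longrightarrow> S \<subseteq> I \<Longrightarrow> (\<Sum>i\<in>S. (cmod (a i))\<^sup>2) \<le> C"
  shows "a \<in> ell2 I" "Re (ell2_inner I a a) \<le> C"
proof -
  have "(\<lambda>i. (cmod (a i))\<^sup>2) summable_on I"
    by (rule nonneg_bdd_above_summable_on) (use assms in \<open>auto intro!: bdd_aboveI2[of _ _ C]\<close>)
  then show "a \<in> ell2 I" "Re (ell2_inner I a a) \<le> C"
    using assms by (auto simp: ell2_inner_self ell2_def intro: infsum_le_finite_sums)
qed

lemma ell2_finite_sum_le:
  assumes "a \<in> ell2 I" "finite S" "S \<subseteq> I"
  shows "(\<Sum>i\<in>S. (cmod (a i))\<^sup>2) \<le> Re (ell2_inner I a a)"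
  using assms by (auto simp: ell2_inner_self ell2_def intro!: finite_sum_le_infsum)

text \<open>A Cauchy sequence converges at each index, and the Cauchy bound passes to the pointwise
  limit on every finite subset, hence to the whole sum. Membership of the limit follows from that of
  \<open>F N - f\<close>.\<close>

lemma ell2_complete:
  fixes F :: "nat \<Rightarrow> 'i \<Rightarrow> complex"
  assumes F: "\<And>k. F k \<in> ell2 I"
    and Cauchy: "\<And>e. 0 < e \<Longrightarrow>
      \<exists>N. \<forall>i\<ge>N. \<forall>j\<ge>N. sqrt (Re (ell2_inner I (F i - F j) (F i - F j))) < e"
  shows "\<exists>f\<in>ell2 I. (\<lambda>k. sqrt (Re (ell2_inner I (F k - f) (F k - f)))) \<longlonglongrightarrow> 0"
proof -
  have F_diff: "a - b \<in> ell2 I" if "a \<in> ell2 I" "b \<in> ell2 I" for a b :: "'i \<Rightarrow> complex"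
    using ell2_add[OF that(1) ell2_scale[OF that(2)], of "-1"] by (simp only: minus_eq_add_scale)
  have F_outside: "F k x = 0" if "x \<notin> I" for k x
    using F[of k] that by (auto simp: ell2_def functions_on_def)
  have C: "\<exists>N. \<forall>i\<ge>N. \<forall>j\<ge>N. Re (ell2_inner I (F i - F j) (F i - F j)) < e\<^sup>2" if "0 < e" for e
    using Cauchy[OF that] that by (metis real_less_rsqrt real_sqrt_abs real_sqrt_less_iff abs_of_pos)
  have "convergent (\<lambda>k. F k x)" for x
  proof (cases "x \<in> I")
    case True
    have "Cauchy (\<lambda>k. F k x)"
      unfolding Cauchy_def
    proof (intro allI impI)
      fix e :: real assume "0 < e"
      then obtain N where N: "\<forall>i\<ge>N. \<forall>j\<ge>N. Re (ell2_inner I (F i - F j) (F i - F j)) < e\<^sup>2"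
        using C[of e] by blast
      have "dist (F i x) (F j x) < e" if "i \<ge> N" "j \<ge> N" for i j
      proof -
        have "(cmod ((F i - F j) x))\<^sup>2 \<le> Re (ell2_inner I (F i - F j) (F i - F j))"
          using ell2_finite_sum_le[OF F_diff[OF F F], of "{x}" i j] True by simp
        also have "\<dots> < e\<^sup>2" using N that by blast
        finally show ?thesis
          using \<open>0 < e\<close> power_less_imp_less_base[of _ 2 e] by (simp add: dist_norm)
      qed
      then show "\<exists>M. \<forall>m\<ge>M. \<forall>n\<ge>M. dist (F m x) (F n x) < e" by blast
    qed
    then show ?thesis by (rule Cauchy_convergent)
  next
    case False
    then show ?thesis
      by (simp add: F_outside convergent_const)
  qed
  then obtain f where f: "\<And>x. (\<lambda>k. F k x) \<longlonglongrightarrow> f x"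
    unfolding convergent_def by metis
  have f_outside: "f x = 0" if "x \<notin> I" for x
    using f[of x] that by (simp add: F_outside LIMSEQ_const_iff)
  have close: "\<exists>N. \<forall>i\<ge>N. F i - f \<in> ell2 I \<and> Re (ell2_inner I (F i - f) (F i - f)) \<le> e\<^sup>2"
    if e: "0 < e" for e
  proof -
    obtain N where N: "\<forall>i\<ge>N. \<forall>j\<ge>N. Re (ell2_inner I (F i - F j) (F i - F j)) < e\<^sup>2"
      using C[OF e] by blast
    have "F i - f \<in> ell2 I \<and> Re (ell2_inner I (F i - f) (F i - f)) \<le> e\<^sup>2" if i: "i \<ge> N" for i
    proof -
      have sums: "(\<Sum>x\<in>S. (cmod ((F i - f) x))\<^sup>2) \<le> e\<^sup>2" if S: "finite S" "S \<subseteq> I" for S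
      proof (rule LIMSEQ_le_const2)
        show "(\<lambda>j. \<Sum>x\<in>S. (cmod ((F i - F j) x))\<^sup>2) \<longlonglongrightarrow> (\<Sum>x\<in>S. (cmod ((F i - f) x))\<^sup>2)"
          unfolding minus_apply by (intro tendsto_intros f)
        show "\<exists>M. \<forall>j\<ge>M. (\<Sum>x\<in>S. (cmod ((F i - F j) x))\<^sup>2) \<le> e\<^sup>2"
          using ell2_finite_sum_le[OF F_diff[OF F F] S] N i by (meson less_imp_le order_trans)
      qed
      have "F i - f \<in> functions_on I"
        using F_outside f_outside by (simp add: functions_on_def)
      from ell2_bounded_by_finite_sums[OF this sums] show ?thesis
        by blast
    qed
    then show ?thesis by blast
  qed
  obtain N where "F N - f \<in> ell2 I"
    using close[of 1] by auto
  then have "F N - (F N - f) \<in> ell2 I"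
    by (rule F_diff[OF F])
  moreover have "F N - (F N - f) = f" by (simp add: fun_eq_iff)
  ultimately have "f \<in> ell2 I" by simp
  moreover have "(\<lambda>k. sqrt (Re (ell2_inner I (F k - f) (F k - f)))) \<longlonglongrightarrow> 0"
  proof (rule LIMSEQ_I)
    fix e :: real assume "0 < e"
    then obtain N where N: "\<forall>i\<ge>N. Re (ell2_inner I (F i - f) (F i - f)) \<le> (e / 2)\<^sup>2"
      using close[of "e / 2"] by auto
    have "norm (sqrt (Re (ell2_inner I (F i - f) (F i - f))) - 0) < e" if "i \<ge> N" for i
    proof -
      have "0 \<le> Re (ell2_inner I (F i - f) (F i - f))"
        unfolding ell2_inner_self[OF F_diff[OF F \<open>f \<in> ell2 I\<close>]] by (auto intro: infsum_nonneg)
      moreover have "sqrt (Re (ell2_inner I (F i - f) (F i - f))) \<le> e / 2"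
        using N that \<open>0 < e\<close> by (intro real_le_lsqrt) auto
      ultimately show ?thesis
        using \<open>0 < e\<close> by simp
    qed
    then show "\<exists>N. \<forall>i\<ge>N. norm (sqrt (Re (ell2_inner I (F i - f) (F i - f))) - 0) < e"
      by blast
  qed
  ultimately show ?thesis by blast
qed

lemma ell2_unit: "i \<in> I \<Longrightarrow> (\<lambda>j. of_bool (j = i)) \<in> ell2 I"
proof -
  assume i: "i \<in> I"
  have "(\<lambda>j. (cmod (of_bool (j = i)))\<^sup>2) summable_on {i}"
    by simp
  then have "(\<lambda>j. (cmod (of_bool (j = i)))\<^sup>2) summable_on I"
    by (rule summable_on_cong_neutral[THEN iffD1, rotated -1]) (use i in auto)
  then show ?thesis
    using i by (auto simp: ell2_def functions_on_def)
qed

text \<open>Square-summable families are functions on \<open>I\<close>, and the unit vectors act as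
  kernel functions for the Kronecker delta. This makes the Hilbert space lemmas of the locale, above
  all the projection, available for coefficient families.\<close>

lemma ell2_Hilbert_space:
  "reproducing_kernel_Hilbert_space I (\<lambda>i j. of_bool (i = j)) (ell2 I) (ell2_inner I)"
proof
  show "ell2 I \<subseteq> functions_on I" by (auto simp: ell2_def)
  show "0 \<in> ell2 I" by (rule ell2_zero)
  show "f + g \<in> ell2 I" if "f \<in> ell2 I" "g \<in> ell2 I" for f g :: "'a \<Rightarrow> complex"
    using that by (rule ell2_add)
  show "scale_fun a f \<in> ell2 I" if "f \<in> ell2 I" for a and f :: "'a \<Rightarrow> complex"
    using that by (rule ell2_scale)
  show "ell2_inner I (f + g) h = ell2_inner I f h + ell2_inner I g h"
    if "f \<in> ell2 I" "g \<in> ell2 I" "h \<in> ell2 I" for f g h :: "'a \<Rightarrow> complex"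
    unfolding ell2_inner_def plus_fun_apply distrib_right
    by (intro infsum_add ell2_mult_summable that)
  show "ell2_inner I (scale_fun a f) g = a * ell2_inner I f g" for a and f g :: "'a \<Rightarrow> complex"
    by (simp add: ell2_inner_def scale_fun_def mult.assoc infsum_cmult_right')
  show "ell2_inner I g f = cnj (ell2_inner I f g)" for f g :: "'a \<Rightarrow> complex"
    by (simp add: ell2_inner_def infsum_cnj[symmetric] mult.commute del: infsum_cnj)
  show "0 \<le> Re (ell2_inner I f f)" if "f \<in> ell2 I" for f :: "'a \<Rightarrow> complex"
    using that by (auto simp: ell2_inner_self intro: infsum_nonneg)
  show "f = 0" if f: "f \<in> ell2 I" "ell2_inner I f f = 0" for f :: "'a \<Rightarrow> complex"
  proof
    fix x
    show "f x = 0 x"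
    proof (cases "x \<in> I")
      case True
      then show ?thesis
        using ell2_finite_sum_le[OF f(1), of "{x}"] f(2) by simp
    next
      case False
      then show ?thesis using f(1) by (simp add: ell2_def functions_on_def)
    qed
  qed
  show "\<exists>f\<in>ell2 I. (\<lambda>k. sqrt (Re (ell2_inner I (F k - f) (F k - f)))) \<longlonglongrightarrow> 0"
    if "\<And>k. F k \<in> ell2 I"
      "\<And>e. 0 < e \<Longrightarrow> \<exists>N. \<forall>i\<ge>N. \<forall>j\<ge>N. sqrt (Re (ell2_inner I (F i - F j) (F i - F j))) < e"
    for F :: "nat \<Rightarrow> 'a \<Rightarrow> complex"
    using that by (rule ell2_complete)
  have unit: "restrict0 I (\<lambda>y. of_bool (y = x)) = (\<lambda>y. of_bool (y = x))" if "x \<in> I" for x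
    using that by (auto simp: restrict0_def)
  show "restrict0 I (\<lambda>y. of_bool (y = x)) \<in> ell2 I" if "x \<in> I" for x
    unfolding unit[OF that] using that by (rule ell2_unit)
  show "ell2_inner I f (restrict0 I (\<lambda>y. of_bool (y = x))) = f x" if "x \<in> I" "f \<in> ell2 I" for x f
  proof -
    have "ell2_inner I f (\<lambda>y. of_bool (y = x)) = infsum (\<lambda>i. f i * cnj (of_bool (i = x))) {x}"
      unfolding ell2_inner_def by (rule infsum_cong_neutral) (use that in auto)
    then show ?thesis
      unfolding unit[OF that(1)] by simp
  qed
qed

text \<open>Only the values of a kernel on \<open>X\<close> times \<open>X\<close> enter the
  axioms.\<close>

lemma rkhs_kernel_cong:
  assumes "reproducing_kernel_Hilbert_space X K H ip"
    and eq: "\<And>x. x \<in> X \<Longrightarrow> restrict0 X (\<lambda>y. K' y x) = restrict0 X (\<lambda>y. K y x)"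
  shows "reproducing_kernel_Hilbert_space X K' H ip"
proof -
  interpret reproducing_kernel_Hilbert_space X K H ip by fact
  show ?thesis
  proof (unfold_locales, rule subset_functions, rule zero_mem)
    show "restrict0 X (\<lambda>y. K' y x) \<in> H" if "x \<in> X" for x
      unfolding eq[OF that] by (rule kernel_mem[OF that])
    show "ip f (restrict0 X (\<lambda>y. K' y x)) = f x" if "x \<in> X" "f \<in> H" for x f
      unfolding eq[OF that(1)] by (rule reproducing[OF that])
  qed (fact add_mem scale_mem ip_add ip_scale ip_cnj ip_nonneg ip_definite complete)+
qed

section \<open>Kernel spaces synthesised from a feature map\<close>

locale feature_map = reproducing_kernel_Hilbert_space Y L G ip
  for Y :: "'y set" and L G ip +
  fixes X :: "'x set" and c :: "'x \<Rightarrow> 'y \<Rightarrow> complex"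
  assumes feature_mem: "x \<in> X \<Longrightarrow> c x \<in> G"
begin

text \<open>Pairs one vector of the auxiliary space with all features. For the Gram kernel
  \<open>ip (c y) (c x)\<close> these functions are exactly the elements of the kernel
  space.\<close>

definition syn :: "('y \<Rightarrow> complex) \<Rightarrow> 'x \<Rightarrow> complex" where
  "syn a = restrict0 X (\<lambda>x. ip a (c x))"

definition syn_ker :: "('y \<Rightarrow> complex) set" where
  "syn_ker = {a \<in> G. syn a = 0}"

definition syn_perp :: "('y \<Rightarrow> complex) set" where
  "syn_perp = {a \<in> G. \<forall>b\<in>syn_ker. ip a b = 0}"

text \<open>For a function in the range of \<open>syn\<close> this is its preimage of least norm;
  elsewhere the value is arbitrary.\<close>

definition rep :: "('x \<Rightarrow> complex) \<Rightarrow> 'y \<Rightarrow> complex" where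
  "rep = inv_into syn_perp syn"

lemma syn_add: "a \<in> G \<Longrightarrow> b \<in> G \<Longrightarrow> syn (a + b) = syn a + syn b"
  by (auto simp: syn_def restrict0_def ip_add feature_mem)

lemma syn_scale: "a \<in> G \<Longrightarrow> syn (scale_fun z a) = scale_fun z (syn a)"
  by (auto simp: fun_eq_iff syn_def restrict0_def ip_scale feature_mem scale_fun_apply)

lemma syn_diff: "a \<in> G \<Longrightarrow> b \<in> G \<Longrightarrow> syn (a - b) = syn a - syn b"
  by (auto simp: syn_def restrict0_def ip_diff feature_mem)

lemma syn_zero: "syn 0 = 0"
  by (rule ext) (simp add: syn_def restrict0_def ip_zero_left feature_mem)

lemma syn_ker_iff: "a \<in> syn_ker \<longleftrightarrow> a \<in> G \<and> (\<forall>x\<in>X. ip a (c x) = 0)"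
  by (auto simp: syn_ker_def syn_def restrict0_def fun_eq_iff)

lemma perp_mem: "a \<in> syn_perp \<Longrightarrow> a \<in> G"
  by (simp add: syn_perp_def)

lemma tendsto_ip:
  assumes "\<And>k. F k \<in> G" "f \<in> G" "(\<lambda>k. nrm (F k - f)) \<longlonglongrightarrow> 0" "b \<in> G"
  shows "(\<lambda>k. ip (F k) b) \<longlonglongrightarrow> ip f b"
proof -
  have *: "(\<lambda>k. nrm (F k - f) * nrm b) \<longlonglongrightarrow> 0"
    using tendsto_mult_right[OF assms(3), of "nrm b"] by simp
  have "cmod (ip (F k) b - ip f b) \<le> nrm (F k - f) * nrm b" for k
    using Cauchy_Schwarz[OF diff_mem[OF assms(1,2)] assms(4), of k]
    by (simp only: ip_diff[OF assms(1,2,4)])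
  then have "(\<lambda>k. ip (F k) b - ip f b) \<longlonglongrightarrow> 0"
    by (intro Lim_null_comparison[OF always_eventually *]) blast
  then show ?thesis
    by (simp add: LIM_zero_iff)
qed

text \<open>Subtracting the projection onto \<open>syn_ker\<close> does not change the function. The
  kernel is closed because pairing with a fixed feature is continuous.\<close>

lemma ex_perp:
  assumes a: "a \<in> G"
  shows "\<exists>a'\<in>syn_perp. syn a' = syn a"
proof -
  have "\<exists>g\<in>syn_ker. \<forall>h\<in>syn_ker. ip (a - g) h = 0"
  proof (rule projection_exists[OF _ _ _ _ _ a])
    show "syn_ker \<subseteq> G" by (auto simp: syn_ker_def)
    show "0 \<in> syn_ker"
      by (simp add: syn_ker_iff zero_mem feature_mem ip_zero_left)
    show "f + g \<in> syn_ker" if "f \<in> syn_ker" "g \<in> syn_ker" for f g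
      using that by (simp add: syn_ker_iff add_mem ip_add feature_mem)
    show "scale_fun z f \<in> syn_ker" if "f \<in> syn_ker" for z f
      using that by (simp add: syn_ker_iff scale_mem ip_scale feature_mem)
    show "f \<in> syn_ker" if F: "\<And>k. F k \<in> syn_ker" and f: "f \<in> G" "(\<lambda>k. nrm (F k - f)) \<longlonglongrightarrow> 0" for F f
    proof -
      have "ip f (c x) = 0" if "x \<in> X" for x
      proof -
        have "(\<lambda>k. ip (F k) (c x)) \<longlonglongrightarrow> ip f (c x)"
          using F f that by (intro tendsto_ip feature_mem) (auto simp: syn_ker_iff)
        then show ?thesis
          using F that by (simp add: syn_ker_iff LIMSEQ_const_iff)
      qed
      then show ?thesis
        using f by (simp add: syn_ker_iff)
    qed
  qed
  then obtain g where g: "g \<in> syn_ker" "\<forall>h\<in>syn_ker. ip (a - g) h = 0" by blast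
  have gG: "g \<in> G" "syn g = 0" using g by (auto simp: syn_ker_def)
  then have "a - g \<in> syn_perp"
    using g a by (simp add: syn_perp_def diff_mem)
  moreover have "syn (a - g) = syn a"
    by (simp only: syn_diff[OF a gG(1)] gG(2) diff_zero)
  ultimately show ?thesis by blast
qed

lemma syn_image_perp: "syn ` syn_perp = syn ` G"
proof
  show "syn ` syn_perp \<subseteq> syn ` G"
    by (intro image_mono subsetI perp_mem)
  show "syn ` G \<subseteq> syn ` syn_perp"
  proof (rule image_subsetI)
    fix a assume "a \<in> G"
    then obtain a' where "a' \<in> syn_perp" "syn a' = syn a"
      using ex_perp by blast
    then show "syn a \<in> syn ` syn_perp"
      by (metis imageI)
  qed
qed

lemma perp_add: "a \<in> syn_perp \<Longrightarrow> b \<in> syn_perp \<Longrightarrow> a + b \<in> syn_perp"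
  by (auto simp: syn_perp_def syn_ker_def add_mem ip_add)

lemma perp_scale: "a \<in> syn_perp \<Longrightarrow> scale_fun z a \<in> syn_perp"
  by (auto simp: syn_perp_def syn_ker_def scale_mem ip_scale)

lemma perp_diff: "a \<in> syn_perp \<Longrightarrow> b \<in> syn_perp \<Longrightarrow> a - b \<in> syn_perp"
  by (auto simp: syn_perp_def syn_ker_def diff_mem ip_diff)

lemma inj_on_syn_perp: "inj_on syn syn_perp"
proof (rule inj_onI)
  fix a b assume ab: "a \<in> syn_perp" "b \<in> syn_perp" "syn a = syn b"
  have "syn (a - b) = 0"
    using syn_diff[OF ab(1,2)[THEN perp_mem]] by (simp only: ab(3) diff_self)
  then have "a - b \<in> syn_ker"
    using ab by (simp add: syn_ker_def diff_mem perp_mem)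
  then have "ip (a - b) (a - b) = 0"
    using perp_diff[OF ab(1,2)] by (simp add: syn_perp_def)
  then have "a - b = 0"
    using ip_definite[OF diff_mem] ab perp_mem by blast
  then show "a = b" by simp
qed

lemma rep_syn: "a \<in> syn_perp \<Longrightarrow> rep (syn a) = a"
  unfolding rep_def by (rule inv_into_f_f[OF inj_on_syn_perp])

text \<open>
  Since \<open>syn\<close> need not be injective, its range carries the quotient norm, realised as the norm
  of the unique preimage orthogonal to the kernel.
\<close>

lemma synthesis_rkhs:
  "reproducing_kernel_Hilbert_space X (\<lambda>x y. ip (c y) (c x)) (syn ` syn_perp)
     (\<lambda>f g. ip (rep f) (rep g))"
proof
  note [simp] = rep_syn perp_mem
  show "syn ` syn_perp \<subseteq> functions_on X"
    by (auto simp: syn_def restrict0_def functions_on_def)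
  have zero_perp: "0 \<in> syn_perp"
    unfolding syn_perp_def syn_ker_def using zero_mem ip_zero_left by blast
  then show "0 \<in> syn ` syn_perp"
    using syn_zero by (metis imageI)
  show "f + g \<in> syn ` syn_perp" if "f \<in> syn ` syn_perp" "g \<in> syn ` syn_perp" for f g
    using that by (auto simp: syn_add[symmetric] intro!: imageI perp_add)
  show "scale_fun a f \<in> syn ` syn_perp" if "f \<in> syn ` syn_perp" for a f
    using that by (auto simp: syn_scale[symmetric] intro!: imageI perp_scale)
  have rep_diff: "rep (syn a - syn b) = a - b" if "a \<in> syn_perp" "b \<in> syn_perp" for a b
    using that by (simp only: syn_diff[symmetric] perp_mem rep_syn perp_diff)
  show "ip (rep (f + g)) (rep h) = ip (rep f) (rep h) + ip (rep g) (rep h)"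
    if "f \<in> syn ` syn_perp" "g \<in> syn ` syn_perp" "h \<in> syn ` syn_perp" for f g h
    using that by (auto simp: syn_add[symmetric] perp_add ip_add)
  show "ip (rep (scale_fun a f)) (rep g) = a * ip (rep f) (rep g)"
    if "f \<in> syn ` syn_perp" "g \<in> syn ` syn_perp" for a f g
    using that by (auto simp: syn_scale[symmetric] perp_scale ip_scale)
  show "ip (rep g) (rep f) = cnj (ip (rep f) (rep g))"
    if "f \<in> syn ` syn_perp" "g \<in> syn ` syn_perp" for f g
    using that by (auto intro: ip_cnj)
  show "0 \<le> Re (ip (rep f) (rep f))" if "f \<in> syn ` syn_perp" for f
    using that by (auto intro: ip_nonneg)
  show "f = 0" if f: "f \<in> syn ` syn_perp" "ip (rep f) (rep f) = 0" for f
  proof -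
    obtain a where a: "a \<in> syn_perp" "f = syn a" using f(1) by blast
    then have "ip a a = 0" using f(2) by simp
    then have "a = 0" using ip_definite[OF perp_mem[OF a(1)]] by blast
    then show ?thesis using a(2) syn_zero by simp
  qed
  show "\<exists>f\<in>syn ` syn_perp. (\<lambda>k. sqrt (Re (ip (rep (F k - f)) (rep (F k - f))))) \<longlonglongrightarrow> 0"
    if F: "\<And>k. F k \<in> syn ` syn_perp"
      and Cauchy: "\<And>e. 0 < e \<Longrightarrow> \<exists>N. \<forall>i\<ge>N. \<forall>j\<ge>N. sqrt (Re (ip (rep (F i - F j)) (rep (F i - F j)))) < e"
    for F :: "nat \<Rightarrow> 'x \<Rightarrow> complex"
  proof -
    have "\<exists>a. a \<in> syn_perp \<and> F k = syn a" for k
      using F[of k] by blast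
    then obtain A where A: "\<And>k. A k \<in> syn_perp" "\<And>k. F k = syn (A k)"
      by metis
    have "\<exists>f\<in>G. (\<lambda>k. sqrt (Re (ip (A k - f) (A k - f)))) \<longlonglongrightarrow> 0"
      by (rule complete[OF perp_mem[OF A(1)]]) (use Cauchy in \<open>simp add: A rep_diff\<close>)
    then obtain f where f: "f \<in> G" "(\<lambda>k. nrm (A k - f)) \<longlonglongrightarrow> 0"
      by (auto simp: nrm_def)
    have "ip f b = 0" if "b \<in> syn_ker" for b
    proof -
      have "(\<lambda>k. ip (A k) b) \<longlonglongrightarrow> ip f b"
        by (rule tendsto_ip[OF perp_mem[OF A(1)] f]) (use that in \<open>simp add: syn_ker_iff\<close>)
      moreover have "ip (A k) b = 0" for k
        using A(1)[of k] that unfolding syn_perp_def by blast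
      ultimately show ?thesis
        by (simp only: LIMSEQ_const_iff)
    qed
    then have "f \<in> syn_perp" using f unfolding syn_perp_def by blast
    then show ?thesis
      using f(2) by (intro bexI[of _ "syn f"]) (simp_all add: A rep_diff nrm_def)
  qed
  \<comment> \<open>A feature is orthogonal to whatever all features annihilate, so it is its own
    least-norm representative, and the reproducing property reduces to the definition of
    \<open>syn\<close>.\<close>
  have kernel: "restrict0 X (\<lambda>y. ip (c x) (c y)) = syn (c x)" "c x \<in> syn_perp" if "x \<in> X" for x
  proof -
    show "restrict0 X (\<lambda>y. ip (c x) (c y)) = syn (c x)" by (simp add: syn_def)
    show "c x \<in> syn_perp"
      using ip_cnj[OF _ feature_mem[OF that]] feature_mem[OF that] that
      unfolding syn_perp_def by (auto simp: syn_ker_iff)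
  qed
  show "restrict0 X (\<lambda>y. ip (c x) (c y)) \<in> syn ` syn_perp" if "x \<in> X" for x
    using kernel[OF that] by simp
  show "ip (rep f) (rep (restrict0 X (\<lambda>y. ip (c x) (c y)))) = f x"
    if "x \<in> X" "f \<in> syn ` syn_perp" for x f
    using that by (auto simp: kernel) (simp add: syn_def restrict0_def)
qed

text \<open>Uniqueness transfers the model to the chosen space. The norm formula is restricted to
  \<open>syn_perp\<close>, as any other preimage of the same function has a larger norm.\<close>

theorem rkhs_synthesis:
  assumes "\<And>x y. x \<in> X \<Longrightarrow> y \<in> X \<Longrightarrow> K x y = ip (c y) (c x)"
  shows "rkhs_space X K = syn ` G"
    and "a \<in> syn_perp \<Longrightarrow> rkhs_norm X K (syn a) = nrm a"
    and "reproducing_kernel_Hilbert_space X K (rkhs_space X K) (snd (rkhs X K))"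
proof -
  have eq: "restrict0 X (\<lambda>y. K y x) = restrict0 X (\<lambda>y. ip (c x) (c y))" if "x \<in> X" for x
    using assms that by (auto simp: restrict0_def)
  have R: "reproducing_kernel_Hilbert_space X K (syn ` syn_perp) (\<lambda>f g. ip (rep f) (rep g))"
    by (rule rkhs_kernel_cong[OF synthesis_rkhs eq])
  show "rkhs_space X K = syn ` G"
    using rkhs_unique(1)[OF R] syn_image_perp by simp
  show "rkhs_norm X K (syn a) = nrm a" if "a \<in> syn_perp"
    using rkhs_unique(2)[OF R, of "syn a"] that by (simp add: rep_syn nrm_def)
  show "reproducing_kernel_Hilbert_space X K (rkhs_space X K) (snd (rkhs X K))"
    by (rule rkhs_is_rkhs[OF R])
qed

end

section \<open>The word expansion of the Drury--Arveson kernel\<close>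

lemma has_sum_product_abs:
  fixes f :: "'x \<Rightarrow> 'c::{real_normed_field,banach}" and g :: "'y \<Rightarrow> 'c"
  assumes f: "(\<lambda>x. norm (f x)) summable_on A" and g: "(\<lambda>y. norm (g y)) summable_on B"
  shows "(\<lambda>(x, y). norm (f x * g y)) summable_on A \<times> B"
    and "((\<lambda>(x, y). f x * g y) has_sum (infsum f A * infsum g B)) (A \<times> B)"
proof -
  have "(\<lambda>p. norm (f (fst p) * g (snd p))) summable_on A \<times> B"
  proof (rule summable_on_SigmaI)
    show "((\<lambda>y. norm (f (fst (x, y)) * g (snd (x, y)))) has_sum norm (f x) * infsum (\<lambda>y. norm (g y)) B) B" for x
      using has_sum_cmult_right[OF has_sum_infsum[OF g], of "norm (f x)"] by (simp add: norm_mult)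
    show "(\<lambda>x. norm (f x) * infsum (\<lambda>y. norm (g y)) B) summable_on A"
      by (rule summable_on_cmult_left[OF f])
  qed auto
  then show *: "(\<lambda>(x, y). norm (f x * g y)) summable_on A \<times> B"
    by (simp add: case_prod_unfold)
  show "((\<lambda>(x, y). f x * g y) has_sum (infsum f A * infsum g B)) (A \<times> B)"
  proof (rule has_sum_SigmaI)
    show "((\<lambda>y. case (x, y) of (x, y) \<Rightarrow> f x * g y) has_sum (f x * infsum g B)) B" for x
      using has_sum_cmult_right[OF has_sum_infsum[OF abs_summable_summable[OF g]], of "f x"] by simp
    show "((\<lambda>x. f x * infsum g B) has_sum (infsum f A * infsum g B)) A"
      by (rule has_sum_cmult_left[OF has_sum_infsum[OF abs_summable_summable[OF f]]])
    show "(\<lambda>(x, y). f x * g y) summable_on A \<times> B"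
      by (rule abs_summable_summable) (use * in \<open>simp add: case_prod_unfold\<close>)
  qed
qed

text \<open>Generic in the monoid, so that one notation gives the monomial at a point, the product
  of the square roots of the weights, and the frequency of a word. As the target is commutative,
  only the letter counts matter.\<close>

definition wprod :: "('j \<Rightarrow> 'a::comm_monoid_mult) \<Rightarrow> 'j list \<Rightarrow> 'a" where
  "wprod z w = prod_list (map z w)"

lemma wprod_Nil [simp]: "wprod z [] = 1"
  and wprod_Cons [simp]: "wprod z (j # w) = z j * wprod z w"
  and wprod_append [simp]: "wprod z (v @ w) = wprod z v * wprod z w"
  by (simp_all add: wprod_def)

lemma wprod_mult: "wprod (\<lambda>j. y j * z j) w = wprod y w * wprod z w"
  by (induction w) (simp_all add: mult_ac)

lemma norm_wprod: "norm (wprod z w) = wprod (\<lambda>j. norm (z j)) w"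
  for z :: "'j \<Rightarrow> 'a::real_normed_field"
  by (induction w) (simp_all add: norm_mult)

lemma cnj_wprod: "cnj (wprod z w) = wprod (\<lambda>j. cnj (z j)) w"
  by (induction w) simp_all

definition words_of_length :: "'j set \<Rightarrow> nat \<Rightarrow> 'j list set" where
  "words_of_length I k = {w \<in> lists I. length w = k}"

lemma words_of_length_0: "words_of_length I 0 = {[]}"
  by (auto simp: words_of_length_def)

lemma words_of_length_Suc:
  "words_of_length I (Suc k) = (\<lambda>(j, w). j # w) ` (I \<times> words_of_length I k)"
  by (auto simp: words_of_length_def length_Suc_conv image_iff)

text \<open>The power of a sum, multiplied out one letter at a time.\<close>

lemma has_sum_words_of_length:
  fixes u :: "'j \<Rightarrow> 'a::{real_normed_field,banach}"
  assumes "(\<lambda>j. norm (u j)) summable_on I"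
  shows "(\<lambda>w. norm (wprod u w)) summable_on words_of_length I k \<and>
    (wprod u has_sum infsum u I ^ k) (words_of_length I k)"
proof (induction k)
  case 0
  then show ?case
    by (auto simp: words_of_length_0 has_sum_finite_iff)
next
  case (Suc k)
  have inj: "inj_on (\<lambda>(j, w). j # w) (I \<times> words_of_length I k)"
    by (auto simp: inj_on_def)
  have 1: "(\<lambda>(j, w). norm (u j * wprod u w)) summable_on I \<times> words_of_length I k"
    and 2: "((\<lambda>(j, w). u j * wprod u w) has_sum infsum u I * infsum (wprod u) (words_of_length I k))
       (I \<times> words_of_length I k)"
    using has_sum_product_abs[OF assms, of "wprod u"] Suc.IH by auto
  have "infsum (wprod u) (words_of_length I k) = infsum u I ^ k"
    using Suc.IH infsumI by blast
  with 1 2 show ?case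
    unfolding words_of_length_Suc summable_on_reindex[OF inj] has_sum_reindex[OF inj]
    by (simp add: comp_def case_prod_unfold)
qed

lemma lists_eq_words: "lists I = snd ` Sigma UNIV (words_of_length I)"
  by (force simp: words_of_length_def)

lemma inj_on_words: "inj_on snd (Sigma UNIV (words_of_length I))"
  by (auto simp: inj_on_def words_of_length_def)

text \<open>Words of length \<open>k\<close> contribute the \<open>k\<close>-th power of the sum, so
  the total is a geometric series. Running the argument with norms first yields the absolute
  convergence that justifies the grouping by length.\<close>

lemma has_sum_words:
  fixes u :: "'j \<Rightarrow> 'a::{real_normed_field,banach}"
  assumes u: "(\<lambda>j. norm (u j)) summable_on I" and lt1: "(\<Sum>\<^sub>\<infinity>j\<in>I. norm (u j)) < 1"
  shows "(\<lambda>w. norm (wprod u w)) summable_on lists I"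
    and "(wprod u has_sum 1 / (1 - infsum u I)) (lists I)"
proof -
  let ?R = "\<Sum>\<^sub>\<infinity>j\<in>I. norm (u j)"
  have R: "0 \<le> ?R" by (rule infsum_nonneg) auto
  have nn: "((\<lambda>w. norm (wprod u w)) has_sum ?R ^ k) (words_of_length I k)" for k
  proof -
    have "(wprod (\<lambda>j. norm (u j)) has_sum ?R ^ k) (words_of_length I k)"
      using has_sum_words_of_length[of "\<lambda>j. norm (u j)" I k] u by simp
    then show ?thesis by (simp add: norm_wprod[abs_def])
  qed
  have "(\<lambda>p. norm (wprod u (snd p))) summable_on Sigma UNIV (words_of_length I)"
  proof (rule summable_on_SigmaI)
    show "((\<lambda>w. norm (wprod u (snd (k, w)))) has_sum ?R ^ k) (words_of_length I k)" for k
      using nn by simp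
    show "(\<lambda>k. ?R ^ k) summable_on UNIV"
      using R lt1 by (intro summable_nonneg_imp_summable_on) (auto intro: summable_geometric)
  qed auto
  then show *: "(\<lambda>w. norm (wprod u w)) summable_on lists I"
    unfolding lists_eq_words summable_on_reindex[OF inj_on_words] by (simp add: comp_def)
  have S: "norm (infsum u I) < 1"
    using norm_infsum_bound[OF u] lt1 by simp
  have "((\<lambda>p. wprod u (snd p)) has_sum 1 / (1 - infsum u I)) (Sigma UNIV (words_of_length I))"
  proof (rule has_sum_SigmaI)
    show "((\<lambda>w. wprod u (snd (k, w))) has_sum infsum u I ^ k) (words_of_length I k)" for k
      using has_sum_words_of_length[OF u, of k] by simp
    show "((\<lambda>k. infsum u I ^ k) has_sum 1 / (1 - infsum u I)) UNIV"
      using S by (intro norm_summable_imp_has_sum)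
        (auto simp: norm_power intro: summable_geometric geometric_sums)
    show "(\<lambda>p. wprod u (snd p)) summable_on Sigma UNIV (words_of_length I)"
      using abs_summable_summable[OF *]
      unfolding lists_eq_words summable_on_reindex[OF inj_on_words] by (simp add: comp_def)
  qed
  then show "(wprod u has_sum 1 / (1 - infsum u I)) (lists I)"
    unfolding lists_eq_words has_sum_reindex[OF inj_on_words] by (simp add: comp_def)
qed

abbreviation words :: "enat \<Rightarrow> nat list set" where
  "words d \<equiv> lists (index_set d)"

text \<open>
  Coefficients are indexed by noncommutative words rather than multi-indices. Words that are
  permutations of each other give the same monomial, so the coefficients of a function are not
  unique, but no combinatorial weights appear in the expansion of the kernel.
\<close>

locale ball_map =
  fixes d :: enat and X :: "'x set" and F :: "'x \<Rightarrow> nat \<Rightarrow> complex"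
  assumes F_ball: "x \<in> X \<Longrightarrow> F x \<in> unit_ball d"
begin

text \<open>Conjugated, so that pairing a family with \<open>feat x\<close> in the second slot of
  the inner product evaluates its power series at \<open>F x\<close> without conjugates.\<close>

definition feat :: "'x \<Rightarrow> nat list \<Rightarrow> complex" where
  "feat x = restrict0 (words d) (\<lambda>w. cnj (wprod (F x) w))"

lemma square_summable: "x \<in> X \<Longrightarrow> (\<lambda>j. (cmod (F x j))\<^sup>2) summable_on index_set d"
  and square_sum_less_1: "x \<in> X \<Longrightarrow> (\<Sum>\<^sub>\<infinity>j\<in>index_set d. (cmod (F x j))\<^sup>2) < 1"
  using F_ball[of x] by (auto simp: unit_ball_def C_space_def)

text \<open>The inequality of arithmetic and geometric means bounds each product by the mean of the
  squares. So the absolute sum, and not only the inner product, stays below 1, as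
  \<open>has_sum_words\<close> demands.\<close>

lemma cross_summable:
  assumes "x \<in> X" "y \<in> X"
  shows "(\<lambda>j. norm (F x j * cnj (F y j))) summable_on index_set d"
    and "(\<Sum>\<^sub>\<infinity>j\<in>index_set d. norm (F x j * cnj (F y j))) < 1"
proof -
  let ?I = "index_set d"
  let ?g = "\<lambda>j. (1/2) * (cmod (F x j))\<^sup>2 + (1/2) * (cmod (F y j))\<^sup>2"
  have g: "?g summable_on ?I"
    by (intro summable_on_add summable_on_cmult_right square_summable assms)
  have le: "norm (F x j * cnj (F y j)) \<le> ?g j" for j
    using sum_squares_bound[of "cmod (F x j)" "cmod (F y j)"] by (simp add: norm_mult)
  show *: "(\<lambda>j. norm (F x j * cnj (F y j))) summable_on ?I"
    by (rule summable_on_comparison_test[OF g le]) auto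
  have "(\<Sum>\<^sub>\<infinity>j\<in>?I. norm (F x j * cnj (F y j))) \<le> infsum ?g ?I"
    by (rule infsum_mono[OF * g le])
  also have "\<dots> = (1/2) * (\<Sum>\<^sub>\<infinity>j\<in>?I. (cmod (F x j))\<^sup>2) + (1/2) * (\<Sum>\<^sub>\<infinity>j\<in>?I. (cmod (F y j))\<^sup>2)"
    by (simp only: infsum_add summable_on_cmult_right square_summable assms infsum_cmult_right')
  also have "\<dots> < 1"
    using square_sum_less_1[OF assms(1)] square_sum_less_1[OF assms(2)] by simp
  finally show "(\<Sum>\<^sub>\<infinity>j\<in>?I. norm (F x j * cnj (F y j))) < 1" .
qed

lemma wprod_square_summable:
  assumes "x \<in> X"
  shows "(\<lambda>w. (cmod (wprod (F x) w))\<^sup>2) summable_on words d"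
proof -
  have "(cmod (wprod (F x) w))\<^sup>2 = norm (wprod (\<lambda>j. F x j * cnj (F x j)) w)" for w
    by (simp add: wprod_mult norm_mult cnj_wprod[symmetric] power2_eq_square)
  then show ?thesis
    using has_sum_words(1)[OF cross_summable[OF assms assms]] by simp
qed

lemma feat_mem: "x \<in> X \<Longrightarrow> feat x \<in> ell2 (words d)"
  using wprod_square_summable[of x]
  by (simp add: ell2_def functions_on_def feat_def restrict0_def cong: summable_on_cong)

lemma feat_inner:
  assumes "x \<in> X" "y \<in> X"
  shows "ell2_inner (words d) (feat y) (feat x) = DA_kernel d (F x) (F y)"
proof -
  have "ell2_inner (words d) (feat y) (feat x) = infsum (wprod (\<lambda>j. F x j * cnj (F y j))) (words d)"
    unfolding ell2_inner_def by (rule infsum_cong) (simp add: feat_def restrict0_def wprod_mult cnj_wprod)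
  also have "\<dots> = DA_kernel d (F x) (F y)"
    unfolding DA_kernel_def C_inner_def
    by (rule infsumI[OF has_sum_words(2)[OF cross_summable[OF assms]]])
  finally show ?thesis .
qed

sublocale feature_map "words d" "\<lambda>v w. of_bool (v = w)" "ell2 (words d)" "ell2_inner (words d)" X feat
  by (intro feature_map.intro ell2_Hilbert_space feature_map_axioms.intro feat_mem)

lemma inner_feat: "ell2_inner (words d) a (feat x) = (\<Sum>\<^sub>\<infinity>w\<in>words d. a w * wprod (F x) w)"
  unfolding ell2_inner_def by (rule infsum_cong) (simp add: feat_def restrict0_def)

lemma syn_apply: "x \<in> X \<Longrightarrow> syn a x = (\<Sum>\<^sub>\<infinity>w\<in>words d. a w * wprod (F x) w)"
  by (simp add: syn_def restrict0_def inner_feat)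

lemma syn_outside: "x \<notin> X \<Longrightarrow> syn a x = 0"
  by (simp add: syn_def restrict0_def)

lemma coeff_summable:
  assumes "a \<in> ell2 (words d)" "x \<in> X"
  shows "(\<lambda>w. norm (a w * wprod (F x) w)) summable_on words d"
  by (rule abs_summable_mult_square)
    (use assms wprod_square_summable in \<open>auto simp: ell2_def\<close>)

end

section \<open>Uniqueness of Dirichlet coefficients\<close>

text \<open>Once the coefficients below \<open>N\<close> vanish, the \<open>N\<close>-th term is
  minus the tail. Raising the abscissa by \<open>k\<close> scales the term by \<open>N^(-k)\<close>
  and the absolute values in the tail by at most \<open>(N+1)^(-k)\<close>, so growing
  \<open>k\<close> forces the coefficient to be 0.\<close>

lemma Dirichlet_series_unique:
  fixes A :: "nat \<Rightarrow> complex"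
  assumes summable: "\<And>\<sigma>. \<sigma> > \<rho> \<Longrightarrow> (\<lambda>N. norm (A N * of_real (real N powr - \<sigma>))) summable_on UNIV"
    and zero: "\<And>\<sigma>. \<sigma> > \<rho> \<Longrightarrow> (\<Sum>\<^sub>\<infinity>N. A N * of_real (real N powr - \<sigma>)) = 0"
    and "1 \<le> N"
  shows "A N = 0"
  using \<open>1 \<le> N\<close>
proof (induction N rule: less_induct)
  case (less N)
  define \<sigma>0 where "\<sigma>0 = \<rho> + 1"
  define C where "C = (\<Sum>\<^sub>\<infinity>M\<in>{N<..}. norm (A M * of_real (real M powr - \<sigma>0)))"
  have sub: "(\<lambda>M. norm (A M * of_real (real M powr - \<sigma>))) summable_on {N<..}" if "\<sigma> > \<rho>" for \<sigma>
    using summable_on_subset_banach[OF summable[OF that]] by blast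
  have bound: "norm (A N) * real N powr - \<sigma>0 \<le> C * (real N / real (Suc N)) ^ k" for k
  proof -
    let ?\<sigma> = "\<sigma>0 + real k"
    let ?f = "\<lambda>M. A M * of_real (real M powr - ?\<sigma>)"
    have \<sigma>: "?\<sigma> > \<rho>" by (simp add: \<sigma>0_def)
    \<comment> \<open>The induction hypothesis covers positive indices; index 0 contributes nothing
      since \<open>0 powr x = 0\<close>.\<close>
    have f0: "?f M = 0" if "M < N" for M
      using less.IH[OF that] by (cases "M = 0") auto
    have "0 = infsum ?f UNIV" using zero[OF \<sigma>] by simp
    also have "\<dots> = infsum ?f (insert N {N<..})"
    proof (rule infsum_cong_neutral)
      fix M assume "M \<in> UNIV - insert N {N<..}"
      then show "?f M = 0" by (intro f0) auto
    qed auto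
    also have "\<dots> = ?f N + infsum ?f {N<..}"
      by (rule infsum_insert) (use abs_summable_summable[OF sub[OF \<sigma>]] in auto)
    finally have "?f N = - infsum ?f {N<..}" by (simp add: add_eq_0_iff)
    then have "norm (?f N) \<le> (\<Sum>\<^sub>\<infinity>M\<in>{N<..}. norm (?f M))"
      using norm_infsum_bound[OF sub[OF \<sigma>]] by simp
    also have "\<dots> \<le> (\<Sum>\<^sub>\<infinity>M\<in>{N<..}. norm (A M * of_real (real M powr - \<sigma>0)) * (1 / real (Suc N) ^ k))"
    proof (rule infsum_mono)
      show "(\<lambda>M. norm (?f M)) summable_on {N<..}" by (rule sub[OF \<sigma>])
      show "(\<lambda>M. norm (A M * of_real (real M powr - \<sigma>0)) * (1 / real (Suc N) ^ k)) summable_on {N<..}"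
        by (intro summable_on_cmult_left sub) (simp add: \<sigma>0_def)
      show "norm (?f M) \<le> norm (A M * of_real (real M powr - \<sigma>0)) * (1 / real (Suc N) ^ k)"
        if "M \<in> {N<..}" for M
      proof -
        have "real M powr - ?\<sigma> = real M powr - \<sigma>0 * (1 / real M ^ k)"
          using that by (simp add: powr_diff powr_realpow)
        also have "1 / real M ^ k \<le> 1 / real (Suc N) ^ k"
          using that by (intro divide_left_mono power_mono mult_pos_pos zero_less_power) auto
        finally have "real M powr - ?\<sigma> \<le> real M powr - \<sigma>0 * (1 / real (Suc N) ^ k)"
          by (simp add: mult_left_mono)
        then have "norm (A M) * real M powr - ?\<sigma> \<le> norm (A M) * (real M powr - \<sigma>0 * (1 / real (Suc N) ^ k))"
          by (rule mult_left_mono) simp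
        then show ?thesis by (simp add: norm_mult mult.assoc)
      qed
    qed
    also have "\<dots> = C * (1 / real (Suc N) ^ k)"
      unfolding C_def by (rule infsum_cmult_left')
    finally have "norm (A N) * real N powr - \<sigma>0 * (1 / real N ^ k) \<le> C * (1 / real (Suc N) ^ k)"
      using less.prems by (simp add: norm_mult norm_divide norm_power powr_diff powr_realpow)
    then show ?thesis
      using less.prems by (simp add: field_simps power_divide)
  qed
  have "(\<lambda>k. C * (real N / real (Suc N)) ^ k) \<longlonglongrightarrow> C * 0"
    by (intro tendsto_mult tendsto_const LIMSEQ_realpow_zero) auto
  then have "norm (A N) * real N powr - \<sigma>0 \<le> 0"
    using bound by (intro LIMSEQ_le_const[of _ _ "norm (A N) * real N powr - \<sigma>0"]) auto
  then show ?case
    using less.prems by (simp add: mult_le_0_iff)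
qed

text \<open>Summation by the fibres of \<open>\<nu>\<close>: over \<open>N\<close> the factor
  \<open>h (\<nu> t)\<close> is the constant \<open>h N\<close> and comes out of the sum.\<close>

lemma regroup:
  fixes Q :: "'t \<Rightarrow> complex" and \<nu> :: "'t \<Rightarrow> nat" and h :: "nat \<Rightarrow> complex"
  assumes "(\<lambda>t. norm (Q t * h (\<nu> t))) summable_on T"
  shows "(\<lambda>N. norm ((\<Sum>\<^sub>\<infinity>t\<in>{t \<in> T. \<nu> t = N}. Q t) * h N)) summable_on UNIV"
    and "(\<Sum>\<^sub>\<infinity>t\<in>T. Q t * h (\<nu> t)) = (\<Sum>\<^sub>\<infinity>N. (\<Sum>\<^sub>\<infinity>t\<in>{t \<in> T. \<nu> t = N}. Q t) * h N)"
proof -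
  let ?B = "\<lambda>N. {t \<in> T. \<nu> t = N}"
  let ?f = "\<lambda>p. Q (snd p) * h (\<nu> (snd p))"
  have T: "T = snd ` Sigma UNIV ?B" by force
  have inj: "inj_on snd (Sigma UNIV ?B)" by (auto simp: inj_on_def)
  have "(\<lambda>t. norm (Q t * h (\<nu> t))) summable_on snd ` Sigma UNIV ?B"
    using assms T by simp
  then have *: "(\<lambda>p. norm (?f p)) summable_on Sigma UNIV ?B"
    unfolding summable_on_reindex[OF inj] by (simp add: comp_def)
  have inner: "(\<Sum>\<^sub>\<infinity>t\<in>?B N. ?f (N, t)) = (\<Sum>\<^sub>\<infinity>t\<in>?B N. Q t) * h N" for N
  proof -
    have "(\<Sum>\<^sub>\<infinity>t\<in>?B N. ?f (N, t)) = (\<Sum>\<^sub>\<infinity>t\<in>?B N. Q t * h N)"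
      by (rule infsum_cong) simp
    then show ?thesis by (simp add: infsum_cmult_left')
  qed
  have "infsum (\<lambda>t. Q t * h (\<nu> t)) (snd ` Sigma UNIV ?B) = infsum ?f (Sigma UNIV ?B)"
    unfolding infsum_reindex[OF inj] by (simp add: comp_def)
  also have "\<dots> = (\<Sum>\<^sub>\<infinity>N. \<Sum>\<^sub>\<infinity>t\<in>?B N. ?f (N, t))"
    by (rule infsum_Sigma_banach[OF abs_summable_summable[OF *], symmetric])
  finally show "(\<Sum>\<^sub>\<infinity>t\<in>T. Q t * h (\<nu> t)) = (\<Sum>\<^sub>\<infinity>N. (\<Sum>\<^sub>\<infinity>t\<in>?B N. Q t) * h N)"
    unfolding inner using T by simp
  have 1: "(\<lambda>t. norm (?f (N, t))) summable_on ?B N" for N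
    using * unfolding Infinite_Sum.abs_summable_on_Sigma_iff by auto
  have 2: "(\<lambda>N. norm (\<Sum>\<^sub>\<infinity>t\<in>?B N. norm (?f (N, t)))) summable_on UNIV"
    using * unfolding Infinite_Sum.abs_summable_on_Sigma_iff by auto
  have "(\<lambda>N. norm (\<Sum>\<^sub>\<infinity>t\<in>?B N. ?f (N, t))) summable_on UNIV"
  proof (rule summable_on_comparison_test[OF 2])
    show "norm (\<Sum>\<^sub>\<infinity>t\<in>?B N. ?f (N, t)) \<le> norm (\<Sum>\<^sub>\<infinity>t\<in>?B N. norm (?f (N, t)))" for N
      using norm_infsum_bound[OF 1, of N] by (rule order_trans) simp
  qed auto
  then show "(\<lambda>N. norm ((\<Sum>\<^sub>\<infinity>t\<in>?B N. Q t) * h N)) summable_on UNIV"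
    unfolding inner .
qed

text \<open>Both sides are regrouped by frequency and uniqueness is applied to the difference. Two
  index types are allowed because one side may run over pairs of words and the other over
  words.\<close>

lemma grouped_coefficients_eq:
  fixes Q :: "'t \<Rightarrow> complex" and Q' :: "'u \<Rightarrow> complex" and \<nu> :: "'t \<Rightarrow> nat" and \<nu>' :: "'u \<Rightarrow> nat"
  assumes s: "\<And>\<sigma>. \<sigma> > \<rho> \<Longrightarrow> (\<lambda>t. norm (Q t * of_real (real (\<nu> t) powr - \<sigma>))) summable_on T"
    and s': "\<And>\<sigma>. \<sigma> > \<rho> \<Longrightarrow> (\<lambda>t. norm (Q' t * of_real (real (\<nu>' t) powr - \<sigma>))) summable_on T'"
    and eq: "\<And>\<sigma>. \<sigma> > \<rho> \<Longrightarrow> (\<Sum>\<^sub>\<infinity>t\<in>T. Q t * of_real (real (\<nu> t) powr - \<sigma>)) =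
      (\<Sum>\<^sub>\<infinity>t\<in>T'. Q' t * of_real (real (\<nu>' t) powr - \<sigma>))"
    and "1 \<le> N"
  shows "(\<Sum>\<^sub>\<infinity>t\<in>{t \<in> T. \<nu> t = N}. Q t) = (\<Sum>\<^sub>\<infinity>t\<in>{t \<in> T'. \<nu>' t = N}. Q' t)"
proof -
  define A where "A N = (\<Sum>\<^sub>\<infinity>t\<in>{t \<in> T. \<nu> t = N}. Q t)" for N
  define A' where "A' N = (\<Sum>\<^sub>\<infinity>t\<in>{t \<in> T'. \<nu>' t = N}. Q' t)" for N
  let ?h = "\<lambda>\<sigma> N. complex_of_real (real N powr - \<sigma>)"
  have A: "(\<lambda>N. norm (A N * ?h \<sigma> N)) summable_on UNIV"
    "(\<lambda>N. norm (A' N * ?h \<sigma> N)) summable_on UNIV"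
    "(\<Sum>\<^sub>\<infinity>N. A N * ?h \<sigma> N) = (\<Sum>\<^sub>\<infinity>N. A' N * ?h \<sigma> N)" if "\<sigma> > \<rho>" for \<sigma>
    using regroup[OF s[OF that]] regroup[OF s'[OF that]] eq[OF that] by (simp_all add: A_def A'_def)
  have "A N - A' N = 0"
  proof (rule Dirichlet_series_unique[OF _ _ \<open>1 \<le> N\<close>])
    fix \<sigma> assume \<sigma>: "\<sigma> > \<rho>"
    show "(\<lambda>N. norm ((A N - A' N) * ?h \<sigma> N)) summable_on UNIV"
    proof (rule summable_on_comparison_test[OF summable_on_add[OF A(1,2)[OF \<sigma>]]])
      show "norm ((A N - A' N) * ?h \<sigma> N) \<le> norm (A N * ?h \<sigma> N) + norm (A' N * ?h \<sigma> N)" for N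
        unfolding left_diff_distrib by (rule norm_triangle_ineq4)
    qed auto
    have "((\<lambda>N. A N * ?h \<sigma> N) has_sum (\<Sum>\<^sub>\<infinity>N. A N * ?h \<sigma> N)) UNIV"
      "((\<lambda>N. - (A' N * ?h \<sigma> N)) has_sum - (\<Sum>\<^sub>\<infinity>N. A' N * ?h \<sigma> N)) UNIV"
      using A(1,2)[OF \<sigma>, THEN abs_summable_summable] by (auto simp: has_sum_uminus)
    from has_sum_add[OF this] show "(\<Sum>\<^sub>\<infinity>N. (A N - A' N) * ?h \<sigma> N) = 0"
      by (intro infsumI) (simp add: A(3)[OF \<sigma>] left_diff_distrib)
  qed
  then show ?thesis by (simp add: A_def A'_def)
qed

text \<open>
  A linear relation between evaluations of words under one weight and frequency datum
  holds, by uniqueness of Dirichlet coefficients, separately on each set of words of equal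
  frequency; the hypothesis \<open>same\<close> makes these sets and, up to a factor, the weights on them
  agree for both data.
\<close>

lemma transfer_relation:
  fixes \<beta> \<gamma> :: "nat \<Rightarrow> real" and n m :: "nat \<Rightarrow> nat" and h :: "nat \<Rightarrow> complex"
    and q :: "'t \<Rightarrow> complex" and q' :: "'u \<Rightarrow> complex"
  assumes pos: "\<And>w. w \<in> lists I \<Longrightarrow> 0 < wprod \<beta> w" "\<And>w. w \<in> lists I \<Longrightarrow> 1 \<le> wprod n w"
    and same: "\<And>v w. v \<in> lists I \<Longrightarrow> w \<in> lists I \<Longrightarrow> wprod n v = wprod n w \<longleftrightarrow> wprod m v = wprod m w"
      "\<And>v w. v \<in> lists I \<Longrightarrow> w \<in> lists I \<Longrightarrow> wprod n v = wprod n w \<Longrightarrow>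
        wprod \<gamma> v * wprod \<beta> w = wprod \<gamma> w * wprod \<beta> v"
    and \<omega>: "\<omega> ` T \<subseteq> lists I" "\<omega>' ` T' \<subseteq> lists I"
    and s: "\<And>\<sigma>. \<sigma> > \<rho> \<Longrightarrow> (\<lambda>t. norm (q t * of_real (wprod \<beta> (\<omega> t)) *
        of_real (real (wprod n (\<omega> t)) powr - \<sigma>))) summable_on T"
      "\<And>\<sigma>. \<sigma> > \<rho> \<Longrightarrow> (\<lambda>t. norm (q' t * of_real (wprod \<beta> (\<omega>' t)) *
        of_real (real (wprod n (\<omega>' t)) powr - \<sigma>))) summable_on T'"
    and eq: "\<And>\<sigma>. \<sigma> > \<rho> \<Longrightarrow>
      (\<Sum>\<^sub>\<infinity>t\<in>T. q t * of_real (wprod \<beta> (\<omega> t)) * of_real (real (wprod n (\<omega> t)) powr - \<sigma>)) =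
      (\<Sum>\<^sub>\<infinity>t\<in>T'. q' t * of_real (wprod \<beta> (\<omega>' t)) * of_real (real (wprod n (\<omega>' t)) powr - \<sigma>))"
    and s2: "(\<lambda>t. norm (q t * of_real (wprod \<gamma> (\<omega> t)) * h (wprod m (\<omega> t)))) summable_on T"
      "(\<lambda>t. norm (q' t * of_real (wprod \<gamma> (\<omega>' t)) * h (wprod m (\<omega>' t)))) summable_on T'"
  shows "(\<Sum>\<^sub>\<infinity>t\<in>T. q t * of_real (wprod \<gamma> (\<omega> t)) * h (wprod m (\<omega> t))) =
    (\<Sum>\<^sub>\<infinity>t\<in>T'. q' t * of_real (wprod \<gamma> (\<omega>' t)) * h (wprod m (\<omega>' t)))"
proof -
  have *: "(\<Sum>\<^sub>\<infinity>t\<in>{t \<in> T. wprod n (\<omega> t) = N}. q t * of_real (wprod \<beta> (\<omega> t))) =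
    (\<Sum>\<^sub>\<infinity>t\<in>{t \<in> T'. wprod n (\<omega>' t) = N}. q' t * of_real (wprod \<beta> (\<omega>' t)))" if "1 \<le> N" for N
    by (rule grouped_coefficients_eq[OF s eq that])
  have "(\<Sum>\<^sub>\<infinity>t\<in>{t \<in> T. wprod m (\<omega> t) = N}. q t * of_real (wprod \<gamma> (\<omega> t))) =
    (\<Sum>\<^sub>\<infinity>t\<in>{t \<in> T'. wprod m (\<omega>' t) = N}. q' t * of_real (wprod \<gamma> (\<omega>' t)))" for N
  proof (cases "\<exists>v\<in>lists I. wprod m v = N")
    case True
    then obtain v where v: "v \<in> lists I" "wprod m v = N" by blast
    \<comment> \<open>Conversion factor of the class of \<open>v\<close>: by \<open>same(2)\<close>
      the quotient of the two weights takes this value at every word of the class.\<close>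
    let ?r = "complex_of_real (wprod \<gamma> v / wprod \<beta> v)"
    have scale: "(\<Sum>\<^sub>\<infinity>t\<in>{t \<in> S. wprod m (\<tau> t) = N}. p t * of_real (wprod \<gamma> (\<tau> t))) =
      (\<Sum>\<^sub>\<infinity>t\<in>{t \<in> S. wprod n (\<tau> t) = wprod n v}. p t * of_real (wprod \<beta> (\<tau> t))) * ?r"
      if S: "\<tau> ` S \<subseteq> lists I" for S \<tau> and p :: "'s \<Rightarrow> complex"
    proof -
      have "{t \<in> S. wprod m (\<tau> t) = N} = {t \<in> S. wprod n (\<tau> t) = wprod n v}"
        using same(1) S v by (auto simp: image_subset_iff)
      moreover have "p t * of_real (wprod \<gamma> (\<tau> t)) = p t * of_real (wprod \<beta> (\<tau> t)) * ?r"
        if "t \<in> S" "wprod n (\<tau> t) = wprod n v" for t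
      proof -
        have "\<tau> t \<in> lists I" using S that by auto
        then have "wprod \<gamma> (\<tau> t) = wprod \<beta> (\<tau> t) * (wprod \<gamma> v / wprod \<beta> v)"
          using same(2)[of "\<tau> t" v] v that pos(1)[OF v(1)] by (simp add: field_simps)
        then show ?thesis by simp
      qed
      ultimately have "(\<Sum>\<^sub>\<infinity>t\<in>{t \<in> S. wprod m (\<tau> t) = N}. p t * of_real (wprod \<gamma> (\<tau> t))) =
        (\<Sum>\<^sub>\<infinity>t\<in>{t \<in> S. wprod n (\<tau> t) = wprod n v}. p t * of_real (wprod \<beta> (\<tau> t)) * ?r)"
        by (intro infsum_cong_neutral) auto
      then show ?thesis by (simp only: infsum_cmult_left')
    qed
    show ?thesis
      unfolding scale[OF \<omega>(1)] scale[OF \<omega>(2)] using *[OF pos(2)[OF v(1)]] by simp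
  next
    case False
    then have "{t \<in> T. wprod m (\<omega> t) = N} = {}" "{t \<in> T'. wprod m (\<omega>' t) = N} = {}"
      using \<omega> by auto
    then show ?thesis by (simp only: infsum_empty)
  qed
  then show ?thesis
    unfolding regroup(2)[OF s2(1)] regroup(2)[OF s2(2)] by simp
qed

section \<open>Multiplicative relations between frequencies\<close>

lemma wprod_eq_prod_count:
  assumes "finite S" "set w \<subseteq> S"
  shows "wprod x w = (\<Prod>j\<in>S. x j ^ count_list w j)"
  using assms(2)
proof (induction w)
  case (Cons i w)
  have "(\<Prod>j\<in>S. x j ^ count_list (i # w) j) = (\<Prod>j\<in>S. (if j = i then x j else 1) * x j ^ count_list w j)"
    by (rule prod.cong) auto
  also have "\<dots> = (\<Prod>j\<in>S. if j = i then x j else 1) * (\<Prod>j\<in>S. x j ^ count_list w j)"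
    by (rule prod.distrib)
  also have "(\<Prod>j\<in>S. if j = i then x j else 1) = x i"
    using assms(1) Cons.prems by (simp add: prod.delta)
  finally show ?case using Cons by simp
qed simp

lemma of_nat_wprod: "of_nat (wprod n w) = wprod (\<lambda>j. of_nat (n j) :: 'a::comm_semiring_1) w"
  by (induction w) simp_all

lemma wprod_pos: "(\<And>j. j \<in> I \<Longrightarrow> 0 < x j) \<Longrightarrow> w \<in> lists I \<Longrightarrow> 0 < wprod x w" for x :: "'j \<Rightarrow> real"
  by (induction w) auto

text \<open>Logarithms turn equality of two monomials into an integer linear relation whose
  coefficients are the differences of letter counts. This is the dictionary between words and
  rational dependence.\<close>

lemma wprod_eq_iff_log:
  fixes x :: "'j \<Rightarrow> real"
  assumes "finite S" "set v \<subseteq> S" "set w \<subseteq> S" "\<And>j. j \<in> S \<Longrightarrow> 0 < x j"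
  shows "wprod x v = wprod x w \<longleftrightarrow>
    (\<Sum>j\<in>S. of_int (int (count_list v j) - int (count_list w j)) * ln (x j)) = 0"
proof -
  have nz: "x j \<noteq> 0" if "j \<in> S" for j
    using assms(4)[OF that] by simp
  have log: "ln (wprod x u) = (\<Sum>j\<in>S. real (count_list u j) * ln (x j))" if "set u \<subseteq> S" for u
    unfolding wprod_eq_prod_count[OF assms(1) that]
    by (subst ln_prod) (simp_all add: assms nz ln_realpow)
  have pos: "0 < wprod x u" if "set u \<subseteq> S" for u
    by (rule wprod_pos[of S]) (use assms(4) that in auto)
  have "wprod x v = wprod x w \<longleftrightarrow> ln (wprod x v) = ln (wprod x w)"
    using pos assms(2,3) by simp
  then show ?thesis
    unfolding log[OF assms(2)] log[OF assms(3)]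
    by (simp add: left_diff_distrib sum_subtractf)
qed

lemma ex_word_count:
  assumes "finite S"
  shows "\<exists>w\<in>lists S. \<forall>j\<in>S. count_list w j = \<beta> j"
proof -
  have "\<exists>w\<in>lists S. \<forall>j. count_list w j = (if j \<in> S then \<beta> j else 0)"
    using assms
  proof (induction S)
    case empty
    show ?case by auto
  next
    case (insert i S)
    then obtain w where w: "w \<in> lists S" "\<And>j. count_list w j = (if j \<in> S then \<beta> j else 0)"
      by blast
    have rep: "count_list (replicate k i) j = (if j = i then k else 0)" for k j
      by (induction k) auto
    show ?case
      using w insert.hyps
      by (intro bexI[of _ "replicate (\<beta> i) i @ w"]) (auto simp: rep)
  qed
  then obtain w where "w \<in> lists S" "\<And>j. count_list w j = (if j \<in> S then \<beta> j else 0)"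
    by blast
  then show ?thesis by (intro bexI[of _ w]) auto
qed

text \<open>The positive part of \<open>\<gamma>\<close> is spelled out by \<open>v\<close>, the
  negative part by \<open>w\<close>. The pair does not depend on \<open>x\<close>, so the same two
  words test the relation for both frequency tuples.\<close>

lemma ex_words_exponent:
  fixes \<gamma> :: "'j \<Rightarrow> int"
  assumes "finite S"
  obtains v w where "v \<in> lists S" "w \<in> lists S"
    "\<And>x :: 'j \<Rightarrow> real. (\<And>j. j \<in> S \<Longrightarrow> 0 < x j) \<Longrightarrow>
      wprod x v = wprod x w \<longleftrightarrow> (\<Sum>j\<in>S. of_int (\<gamma> j) * ln (x j)) = 0"
proof -
  obtain v where v: "v \<in> lists S" "\<forall>j\<in>S. count_list v j = nat (\<gamma> j)"
    using ex_word_count[OF assms, of "\<lambda>j. nat (\<gamma> j)"] by blast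
  obtain w where w: "w \<in> lists S" "\<forall>j\<in>S. count_list w j = nat (- \<gamma> j)"
    using ex_word_count[OF assms, of "\<lambda>j. nat (- \<gamma> j)"] by blast
  have "wprod x v = wprod x w \<longleftrightarrow> (\<Sum>j\<in>S. of_int (\<gamma> j) * ln (x j)) = 0"
    if pos: "\<And>j. j \<in> S \<Longrightarrow> 0 < x j" for x :: "'j \<Rightarrow> real"
  proof -
    have "(\<Sum>j\<in>S. of_int (int (count_list v j) - int (count_list w j)) * ln (x j)) =
      (\<Sum>j\<in>S. of_int (\<gamma> j) * ln (x j))"
      by (rule sum.cong) (use v w in auto)
    moreover have "set v \<subseteq> S" "set w \<subseteq> S" using v(1) w(1) by auto
    ultimately show ?thesis
      using wprod_eq_iff_log[OF assms, of v w x] pos by metis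
  qed
  then show ?thesis
    using that v w by blast
qed

section \<open>Rational dependence of logarithms and its circuits\<close>

interpretation rat_real: module "\<lambda>(q::rat) (x::real). of_rat q * x"
  by unfold_locales (simp_all add: algebra_simps of_rat_add of_rat_mult)

lemma common_denominator:
  fixes r :: "'j \<Rightarrow> rat"
  assumes "finite S"
  shows "\<exists>D::int. D > 0 \<and> (\<forall>j\<in>S. \<exists>k::int. of_int D * r j = of_int k)"
  using assms
proof (induction S)
  case empty
  show ?case by (auto intro: exI[of _ 1])
next
  case (insert i S)
  then obtain D where D: "D > 0" "\<forall>j\<in>S. \<exists>k::int. of_int D * r j = of_int k" by blast
  obtain a b where ab: "r i = Fract a b" "b > 0"
    using Rat_cases by blast
  have "\<exists>k::int. of_int (D * b) * r j = of_int k" if j: "j \<in> insert i S" for j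
  proof (cases "j = i")
    case True
    have "of_int (D * b) * r i = of_int (D * a)"
      using ab by (simp add: Fract_of_int_quotient)
    then show ?thesis using True by blast
  next
    case False
    then obtain k where "of_int D * r j = of_int k" using D j by auto
    then have "of_int (D * b) * r j = of_int (b * k)"
      by (simp add: mult_ac)
    then show ?thesis by blast
  qed
  then show ?case
    using D ab by (intro exI[of _ "D * b"]) auto
qed

text \<open>Denominators are cleared, and by injectivity of \<open>n\<close> the relation is
  reindexed from the values \<open>ln (n j)\<close> to the indices \<open>j\<close>.\<close>

lemma log_dependent_iff:
  assumes inj: "inj_on n J" and pos: "\<And>j. j \<in> J \<Longrightarrow> 0 < n j"
  shows "log_dependent n J \<longleftrightarrow>
    (\<exists>S (\<gamma> :: nat \<Rightarrow> int). finite S \<and> S \<subseteq> J \<and>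
       (\<Sum>j\<in>S. of_int (\<gamma> j) * ln (real (n j))) = 0 \<and> (\<exists>j\<in>S. \<gamma> j \<noteq> 0))"
proof
  let ?f = "\<lambda>j. ln (real (n j))"
  have injf: "inj_on ?f J"
    using inj pos by (fastforce simp: inj_on_def)
  {
    assume "log_dependent n J"
    then obtain t u where t: "finite t" "t \<subseteq> ?f ` J" "(\<Sum>v\<in>t. of_rat (u v) * v) = 0" "\<exists>v\<in>t. u v \<noteq> 0"
      unfolding log_dependent_def rat_real.dependent_explicit by blast
    obtain S where S: "S \<subseteq> J" "finite S" "t = ?f ` S"
      using finite_subset_image[OF t(1,2)] by blast
    have injS: "inj_on ?f S" using injf S inj_on_subset by blast
    obtain D :: int where D: "D > 0" "\<forall>j\<in>S. \<exists>k::int. of_int D * u (?f j) = of_int k"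
      using common_denominator[OF S(2), of "\<lambda>j. u (?f j)"] by blast
    then obtain \<gamma> :: "nat \<Rightarrow> int" where \<gamma>: "\<And>j. j \<in> S \<Longrightarrow> of_int D * u (?f j) = of_int (\<gamma> j)"
      by metis
    have "(\<Sum>j\<in>S. of_int (\<gamma> j) * ?f j) = (\<Sum>j\<in>S. of_int D * (of_rat (u (?f j)) * ?f j))"
    proof (rule sum.cong)
      fix j assume "j \<in> S"
      then have "of_rat (of_int D * u (?f j)) = (of_rat (of_int (\<gamma> j)) :: real)" using \<gamma> by simp
      then show "of_int (\<gamma> j) * ?f j = of_int D * (of_rat (u (?f j)) * ?f j)"
        by (simp add: of_rat_mult)
    qed simp
    also have "\<dots> = of_int D * (\<Sum>v\<in>t. of_rat (u v) * v)"
      unfolding S(3) sum.reindex[OF injS] by (simp add: sum_distrib_left)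
    finally have "(\<Sum>j\<in>S. of_int (\<gamma> j) * ?f j) = 0" using t by simp
    moreover have "\<exists>j\<in>S. \<gamma> j \<noteq> 0"
    proof -
      obtain j where "j \<in> S" "u (?f j) \<noteq> 0" using t(4) S by blast
      then show ?thesis using \<gamma>[of j] D(1) by (intro bexI[of _ j]) auto
    qed
    ultimately show "\<exists>S (\<gamma> :: nat \<Rightarrow> int). finite S \<and> S \<subseteq> J \<and>
       (\<Sum>j\<in>S. of_int (\<gamma> j) * ?f j) = 0 \<and> (\<exists>j\<in>S. \<gamma> j \<noteq> 0)"
      using S by blast
  }
  assume "\<exists>S (\<gamma> :: nat \<Rightarrow> int). finite S \<and> S \<subseteq> J \<and>
       (\<Sum>j\<in>S. of_int (\<gamma> j) * ?f j) = 0 \<and> (\<exists>j\<in>S. \<gamma> j \<noteq> 0)"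
  then obtain S and \<gamma> :: "nat \<Rightarrow> int" where S: "finite S" "S \<subseteq> J"
    "(\<Sum>j\<in>S. of_int (\<gamma> j) * ?f j) = 0" "\<exists>j\<in>S. \<gamma> j \<noteq> 0"
    by blast
  have injS: "inj_on ?f S" using injf S inj_on_subset by blast
  define u where "u v = rat_of_int (\<gamma> (inv_into S ?f v))" for v
  have u: "u (?f j) = of_int (\<gamma> j)" if "j \<in> S" for j
    unfolding u_def inv_into_f_f[OF injS that] ..
  have "(\<Sum>v\<in>?f ` S. of_rat (u v) * v) = (\<Sum>j\<in>S. of_int (\<gamma> j) * ?f j)"
    unfolding sum.reindex[OF injS] by (rule sum.cong) (simp_all add: u)
  then show "log_dependent n J"
    unfolding log_dependent_def rat_real.dependent_explicit
    using S u by (intro exI[of _ "?f ` S"] exI[of _ u]) auto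
qed

lemma ex_minimal_dependent:
  assumes "finite S" "S \<subseteq> index_set d" "log_dependent n S"
  shows "\<exists>J\<subseteq>S. J \<in> minimal_dependent d n"
  using assms
proof (induction S rule: finite_psubset_induct)
  case (psubset S)
  show ?case
  proof (cases "\<exists>J'. J' \<subset> S \<and> log_dependent n J'")
    case True
    then show ?thesis
      using psubset by (meson order_trans psubset_imp_subset)
  next
    case False
    then show ?thesis
      using psubset by (auto simp: minimal_dependent_def)
  qed
qed

locale frequencies =
  fixes d :: enat and n :: "nat \<Rightarrow> nat"
  assumes freq_ge_2: "j \<in> index_set d \<Longrightarrow> 2 \<le> n j"
    and freq_inj: "inj_on n (index_set d)"
begin

lemma log_dependent_iff':
  assumes "J \<subseteq> index_set d"
  shows "log_dependent n J \<longleftrightarrow>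
    (\<exists>S (\<gamma> :: nat \<Rightarrow> int). finite S \<and> S \<subseteq> J \<and>
       (\<Sum>j\<in>S. of_int (\<gamma> j) * ln (real (n j))) = 0 \<and> (\<exists>j\<in>S. \<gamma> j \<noteq> 0))"
  by (rule log_dependent_iff)
    (use assms freq_inj freq_ge_2 in \<open>force intro: inj_on_subset\<close>)+

text \<open>The support of a nontrivial relation inside \<open>J\<close> is already dependent, so by
  minimality it is all of \<open>J\<close>. Hence \<open>J\<close> is finite and no coefficient
  vanishes.\<close>

lemma minimal_dependent_exponent:
  assumes J: "J \<in> minimal_dependent d n"
  obtains \<gamma> :: "nat \<Rightarrow> int" where "finite J" "J \<noteq> {}" "\<And>j. j \<in> J \<Longrightarrow> \<gamma> j \<noteq> 0"
    "(\<Sum>j\<in>J. of_int (\<gamma> j) * ln (real (n j))) = 0"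
proof -
  have JI: "J \<subseteq> index_set d" using J by (simp add: minimal_dependent_def)
  have "log_dependent n J" using J by (simp add: minimal_dependent_def)
  then obtain S and \<gamma> :: "nat \<Rightarrow> int" where S: "finite S" "S \<subseteq> J"
    "(\<Sum>j\<in>S. of_int (\<gamma> j) * ln (real (n j))) = 0" "\<exists>j\<in>S. \<gamma> j \<noteq> 0"
    unfolding log_dependent_iff'[OF JI] by blast
  let ?T = "{j \<in> S. \<gamma> j \<noteq> 0}"
  have T0: "(\<Sum>j\<in>?T. of_int (\<gamma> j) * ln (real (n j))) = 0"
    using S(3) by (subst sum.mono_neutral_left[OF S(1)]) auto
  have "log_dependent n ?T"
    using S T0 JI by (subst log_dependent_iff') (auto intro!: exI[of _ ?T] exI[of _ \<gamma>])
  then have "\<not> ?T \<subset> J" using J by (auto simp: minimal_dependent_def)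
  then have TJ: "?T = J" using S(2) by blast
  show ?thesis
  proof (rule that[of \<gamma>])
    show "finite J" unfolding TJ[symmetric] using S(1) by simp
    show "J \<noteq> {}" unfolding TJ[symmetric] using S(4) by blast
    show "\<gamma> j \<noteq> 0" if "j \<in> J" for j using that TJ by blast
    show "(\<Sum>j\<in>J. of_int (\<gamma> j) * ln (real (n j))) = 0"
      using T0 unfolding TJ .
  qed
qed

text \<open>The support of a relation contains a circuit, and eliminating one of its indices shrinks
  the support; the induction is on the size of the support. The family \<open>l\<close> is
  arbitrary: later it is the logarithm of the other frequencies or of the weight quotients.\<close>

lemma linear_relation_of_circuits:
  fixes l :: "nat \<Rightarrow> real"
  assumes circ: "\<And>J. J \<in> minimal_dependent d n \<Longrightarrow> \<exists>\<delta> :: nat \<Rightarrow> int. (\<forall>j\<in>J. \<delta> j \<noteq> 0) \<and>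
      (\<Sum>j\<in>J. of_int (\<delta> j) * ln (real (n j))) = 0 \<and> (\<Sum>j\<in>J. of_int (\<delta> j) * l j) = 0"
    and S: "finite S" "S \<subseteq> index_set d"
    and "(\<Sum>j\<in>S. of_int (\<gamma> j) * ln (real (n j))) = 0"
  shows "(\<Sum>j\<in>S. of_int (\<gamma> j) * l j) = 0"
  using assms(4)
proof (induction "card {j \<in> S. \<gamma> j \<noteq> 0}" arbitrary: \<gamma> rule: less_induct)
  case less
  let ?T = "{j \<in> S. \<gamma> j \<noteq> 0}"
  have T: "finite ?T" "?T \<subseteq> index_set d" using S by auto
  show ?case
  proof (cases "?T = {}")
    case True
    then show ?thesis by (intro sum.neutral) auto
  next
    case False
    have "(\<Sum>j\<in>?T. of_int (\<gamma> j) * ln (real (n j))) = 0"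
      using less.prems S by (subst sum.mono_neutral_left[OF S(1)]) auto
    then have "log_dependent n ?T"
      using False T(1) by (subst log_dependent_iff'[OF T(2)]) (blast intro: exI[of _ ?T])
    then obtain J where J: "J \<subseteq> ?T" "J \<in> minimal_dependent d n"
      using ex_minimal_dependent[OF T] by blast
    then obtain \<delta> :: "nat \<Rightarrow> int" where \<delta>: "\<And>j. j \<in> J \<Longrightarrow> \<delta> j \<noteq> 0"
      "(\<Sum>j\<in>J. of_int (\<delta> j) * ln (real (n j))) = 0" "(\<Sum>j\<in>J. of_int (\<delta> j) * l j) = 0"
      using circ by blast
    obtain i where i: "i \<in> J"
      using J(2) minimal_dependent_exponent by blast
    \<comment> \<open>Cross-multiplication instead of division keeps the coefficients integral. The
      index \<open>i\<close> cancels, and nothing outside the old support appears since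
      \<open>J\<close> lies in it.\<close>
    define \<gamma>' where "\<gamma>' j = \<delta> i * \<gamma> j - \<gamma> i * (if j \<in> J then \<delta> j else 0)" for j
    have lin: "(\<Sum>j\<in>S. of_int (\<gamma>' j) * y j) =
        of_int (\<delta> i) * (\<Sum>j\<in>S. of_int (\<gamma> j) * y j) - of_int (\<gamma> i) * (\<Sum>j\<in>J. of_int (\<delta> j) * y j)"
      for y :: "nat \<Rightarrow> real"
    proof -
      have "(\<Sum>j\<in>J. of_int (\<delta> j) * y j) = (\<Sum>j\<in>S. of_int (if j \<in> J then \<delta> j else 0) * y j)"
        using S(1) J(1) by (intro sum.mono_neutral_cong_left) auto
      then show ?thesis
        by (simp only: \<gamma>'_def of_int_diff of_int_mult left_diff_distrib sum_subtractf sum_distrib_left mult.assoc)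
    qed
    have "{j \<in> S. \<gamma>' j \<noteq> 0} \<subset> ?T"
    proof
      show "{j \<in> S. \<gamma>' j \<noteq> 0} \<subseteq> ?T"
        using J(1) by (auto simp: \<gamma>'_def split: if_splits)
      have "i \<in> ?T" "\<gamma>' i = 0" using i J(1) by (auto simp: \<gamma>'_def)
      then show "{j \<in> S. \<gamma>' j \<noteq> 0} \<noteq> ?T" by blast
    qed
    then have "card {j \<in> S. \<gamma>' j \<noteq> 0} < card ?T"
      by (rule psubset_card_mono[OF T(1)])
    moreover have "(\<Sum>j\<in>S. of_int (\<gamma>' j) * ln (real (n j))) = 0"
      unfolding lin using \<delta> less.prems by simp
    ultimately have "(\<Sum>j\<in>S. of_int (\<gamma>' j) * l j) = 0"
      by (rule less.hyps)
    then show ?thesis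
      unfolding lin using \<delta>(1)[OF i] \<delta>(3) by simp
  qed
qed

lemma wprod_ge_1: "w \<in> words d \<Longrightarrow> 1 \<le> wprod n w"
proof (induction w)
  case (Cons j w)
  then show ?case using freq_ge_2[of j] by (auto simp: Suc_le_eq)
qed simp

lemma wprod_freq_eq_iff:
  "wprod n v = wprod n w \<longleftrightarrow> wprod (\<lambda>j. real (n j)) v = wprod (\<lambda>j. real (n j)) w"
  by (simp only: of_nat_wprod[symmetric] of_nat_eq_iff)

end

lemma prod_power_eq_iff_log:
  fixes x :: "nat \<Rightarrow> real"
  assumes "finite J1" "finite J2" "J1 \<inter> J2 = {}" "\<And>j. j \<in> J1 \<union> J2 \<Longrightarrow> 0 < x j"
  shows "(\<Prod>i\<in>J1. x i ^ \<beta> i) = (\<Prod>i\<in>J2. x i ^ \<beta> i) \<longleftrightarrow>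
    (\<Sum>j\<in>J1 \<union> J2. of_int (if j \<in> J1 then int (\<beta> j) else - int (\<beta> j)) * ln (x j)) = 0"
proof -
  have log: "ln (\<Prod>i\<in>S. x i ^ \<beta> i) = (\<Sum>i\<in>S. real (\<beta> i) * ln (x i))"
    "0 < (\<Prod>i\<in>S. x i ^ \<beta> i)" if "finite S" "S \<subseteq> J1 \<union> J2" for S
    proof -
      have pos: "0 < x i" if "i \<in> S" for i
        using assms(4) \<open>S \<subseteq> J1 \<union> J2\<close> that by blast
      then have "x i ^ \<beta> i \<noteq> 0" if "i \<in> S" for i
        using that by fastforce
      then show "ln (\<Prod>i\<in>S. x i ^ \<beta> i) = (\<Sum>i\<in>S. real (\<beta> i) * ln (x i))"
        by (subst ln_prod) (simp_all add: \<open>finite S\<close> ln_realpow pos)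
      show "0 < (\<Prod>i\<in>S. x i ^ \<beta> i)"
        by (intro prod_pos zero_less_power pos)
    qed
  have "(\<Prod>i\<in>J1. x i ^ \<beta> i) = (\<Prod>i\<in>J2. x i ^ \<beta> i) \<longleftrightarrow>
    ln (\<Prod>i\<in>J1. x i ^ \<beta> i) = ln (\<Prod>i\<in>J2. x i ^ \<beta> i)"
    using log(2)[of J1] log(2)[of J2] assms(1,2) by simp
  also have "\<dots> \<longleftrightarrow> (\<Sum>i\<in>J1. real (\<beta> i) * ln (x i)) = (\<Sum>i\<in>J2. real (\<beta> i) * ln (x i))"
    using log(1)[of J1] log(1)[of J2] assms(1,2) by simp
  also have "\<dots> \<longleftrightarrow> (\<Sum>j\<in>J1 \<union> J2. of_int (if j \<in> J1 then int (\<beta> j) else - int (\<beta> j)) * ln (x j)) = 0"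
  proof -
    have "(\<Sum>j\<in>J2. of_int (if j \<in> J1 then int (\<beta> j) else - int (\<beta> j)) * ln (x j)) =
        - (\<Sum>i\<in>J2. real (\<beta> i) * ln (x i))"
      unfolding sum_negf[symmetric] by (rule sum.cong) (use assms(3) in auto)
    then show ?thesis
      by (subst sum.union_disjoint[OF assms(1-3)]) simp
  qed
  finally show ?thesis .
qed

context frequencies
begin

text \<open>An integer relation with full support is split by sign into two sides, and its exponents
  are divided by their gcd. Neither side is empty, since a nonempty product of positive powers of
  integers at least 2 is not 1.\<close>

lemma ex_associated_relation:
  assumes J: "J \<in> minimal_dependent d n"
  shows "\<exists>J1 J2 \<beta>. associated_relation n J J1 J2 \<beta>"
proof -
  obtain \<gamma> :: "nat \<Rightarrow> int" where fin: "finite J" and ne: "J \<noteq> {}" and nz: "\<And>j. j \<in> J \<Longrightarrow> \<gamma> j \<noteq> 0"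
    and rel: "(\<Sum>j\<in>J. of_int (\<gamma> j) * ln (real (n j))) = 0"
    using minimal_dependent_exponent[OF J] by blast
  have JI: "J \<subseteq> index_set d" using J by (simp add: minimal_dependent_def)
  define \<beta>0 where "\<beta>0 j = nat \<bar>\<gamma> j\<bar>" for j
  define G where "G = Gcd (\<beta>0 ` J)"
  define \<beta> where "\<beta> j = \<beta>0 j div G" for j
  define J1 where "J1 = {j \<in> J. 0 < \<gamma> j}"
  define J2 where "J2 = {j \<in> J. \<gamma> j < 0}"
  have \<beta>0: "0 < \<beta>0 j" if "j \<in> J" for j using nz[OF that] by (simp add: \<beta>0_def)
  obtain i where i: "i \<in> J" using ne by blast
  have dvd: "G dvd \<beta>0 j" if "j \<in> J" for j
    unfolding G_def by (rule Gcd_dvd) (rule imageI[OF that])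
  have G: "0 < G"
    by (rule dvd_pos_nat[OF \<beta>0[OF i] dvd[OF i]])
  have \<beta>: "\<beta>0 j = G * \<beta> j" if "j \<in> J" for j
    unfolding \<beta>_def by (rule dvd_mult_div_cancel[OF dvd[OF that], symmetric])
  have "\<beta>0 ` J = (*) G ` (\<beta> ` J)"
    unfolding image_image by (rule image_cong) (simp_all add: \<beta>)
  then have "G = G * Gcd (\<beta> ` J)"
    using Gcd_mult[of G "\<beta> ` J"] by (metis G_def normalize_nat_def id_apply)
  then have gcd: "Gcd (\<beta> ` J) = 1" using G by simp
  have \<beta>1: "1 \<le> \<beta> j" if "j \<in> J" for j
    using \<beta>0[OF that] \<beta>[OF that] by (cases "\<beta> j") auto
  have part: "J1 \<inter> J2 = {}" "J1 \<union> J2 = J"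
    using nz by (auto simp: J1_def J2_def) (metis linorder_neqE_linordered_idom)
  have fin12: "finite J1" "finite J2" using fin by (auto simp: J1_def J2_def)
  have pos: "0 < real (n j)" if "j \<in> J1 \<union> J2" for j
    using freq_ge_2[of j] that JI part by auto
  have "of_int (\<gamma> j) * ln (real (n j)) =
      real G * (of_int (if j \<in> J1 then int (\<beta> j) else - int (\<beta> j)) * ln (real (n j)))" if "j \<in> J" for j
  proof -
    have "\<gamma> j = int G * (if j \<in> J1 then int (\<beta> j) else - int (\<beta> j))"
    proof -
      have "int (\<beta>0 j) = \<bar>\<gamma> j\<bar>" by (simp add: \<beta>0_def)
      then have "\<bar>\<gamma> j\<bar> = int G * int (\<beta> j)" by (simp add: \<beta>[OF that])
      then show ?thesis using that by (auto simp: J1_def abs_if split: if_splits)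
    qed
    then show ?thesis by simp
  qed
  from sum.cong[OF refl this, of J "\<lambda>j. j"]
  have "real G * (\<Sum>j\<in>J1 \<union> J2. of_int (if j \<in> J1 then int (\<beta> j) else - int (\<beta> j)) * ln (real (n j))) = 0"
    unfolding part(2) sum_distrib_left using rel by simp
  then have sum0: "(\<Sum>j\<in>J1 \<union> J2. of_int (if j \<in> J1 then int (\<beta> j) else - int (\<beta> j)) * ln (real (n j))) = 0"
    using G by simp
  have "(\<Prod>i\<in>J1. real (n i) ^ \<beta> i) = (\<Prod>i\<in>J2. real (n i) ^ \<beta> i)"
    by (rule prod_power_eq_iff_log[THEN iffD2, OF fin12 part(1) pos sum0])
  then have eq: "(\<Prod>i\<in>J1. n i ^ \<beta> i) = (\<Prod>i\<in>J2. n i ^ \<beta> i)"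
    by (simp only: of_nat_power[symmetric] of_nat_prod[symmetric] of_nat_eq_iff)
  have ne_1: "(\<Prod>i\<in>S. n i ^ \<beta> i) \<noteq> 1" if S: "S \<subseteq> J" "S \<noteq> {}" for S
  proof -
    obtain k where k: "k \<in> S" using S by blast
    have "n k ^ \<beta> k \<noteq> 1"
      using freq_ge_2[of k] \<beta>1[of k] k S JI by auto
    moreover have "finite S" using S fin finite_subset by blast
    ultimately show ?thesis using k prod_eq_1_iff[of S "\<lambda>i. n i ^ \<beta> i"] by metis
  qed
  have "J1 \<noteq> {}"
  proof
    assume "J1 = {}"
    then show False using ne_1[of J2] eq ne part(2) by simp
  qed
  moreover have "J2 \<noteq> {}"
  proof
    assume "J2 = {}"
    then show False using ne_1[of J1] eq ne part(2) by simp
  qed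
  ultimately have "associated_relation n J J1 J2 \<beta>"
    unfolding associated_relation_def using part \<beta>1 gcd eq by blast
  then show ?thesis by blast
qed

text \<open>The difference of the letter counts of \<open>v\<close> and \<open>w\<close> is a
  relation between the \<open>ln (n j)\<close>, hence a rational combination of circuit relations,
  and the \<open>ln (f j)\<close> satisfy each of these. Applied with \<open>f\<close> the other
  frequencies and with \<open>f\<close> the quotients of the square roots of the weights.\<close>

lemma wprod_eq_of_circuits:
  fixes f :: "nat \<Rightarrow> real"
  assumes pos: "\<And>j. j \<in> index_set d \<Longrightarrow> 0 < f j"
    and circ: "\<And>J. J \<in> minimal_dependent d n \<Longrightarrow>
      \<exists>J1 J2 \<beta>. associated_relation n J J1 J2 \<beta> \<and> (\<Prod>i\<in>J1. f i ^ \<beta> i) = (\<Prod>i\<in>J2. f i ^ \<beta> i)"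
    and vw: "v \<in> words d" "w \<in> words d" "wprod n v = wprod n w"
  shows "wprod f v = wprod f w"
proof -
  define S where "S = set v \<union> set w"
  have S: "finite S" "S \<subseteq> index_set d" "set v \<subseteq> S" "set w \<subseteq> S"
    using vw by (auto simp: S_def)
  have npos: "0 < real (n j)" if "j \<in> index_set d" for j
    using freq_ge_2[OF that] by simp
  have "(\<Sum>j\<in>S. of_int (int (count_list v j) - int (count_list w j)) * ln (f j)) = 0"
  proof (rule linear_relation_of_circuits[OF _ S(1,2)])
    fix J assume J: "J \<in> minimal_dependent d n"
    then obtain J1 J2 \<beta> where R: "associated_relation n J J1 J2 \<beta>"
      and f: "(\<Prod>i\<in>J1. f i ^ \<beta> i) = (\<Prod>i\<in>J2. f i ^ \<beta> i)"
      using circ by blast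
    have J12: "J1 \<inter> J2 = {}" "J = J1 \<union> J2" "\<And>j. j \<in> J \<Longrightarrow> 1 \<le> \<beta> j"
      "(\<Prod>i\<in>J1. n i ^ \<beta> i) = (\<Prod>i\<in>J2. n i ^ \<beta> i)"
      using R by (auto simp: associated_relation_def)
    have fin: "finite J1" "finite J2"
      using minimal_dependent_exponent[OF J] J12(2) by (metis finite_Un)+
    have JI: "J1 \<union> J2 \<subseteq> index_set d"
      using J J12 by (simp add: minimal_dependent_def)
    have n: "(\<Prod>i\<in>J1. real (n i) ^ \<beta> i) = (\<Prod>i\<in>J2. real (n i) ^ \<beta> i)"
      using J12(4) by (simp only: of_nat_power[symmetric] of_nat_prod[symmetric])
    let ?\<delta> = "\<lambda>j. if j \<in> J1 then int (\<beta> j) else - int (\<beta> j)"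
    have "?\<delta> j \<noteq> 0" if "j \<in> J" for j
      using J12(3)[OF that] by auto
    moreover have "(\<Sum>j\<in>J. of_int (?\<delta> j) * ln (real (n j))) = 0"
      unfolding J12(2)
      by (rule prod_power_eq_iff_log[THEN iffD1, OF fin J12(1) _ n]) (use npos JI in blast)
    moreover have "(\<Sum>j\<in>J. of_int (?\<delta> j) * ln (f j)) = 0"
      unfolding J12(2)
      by (rule prod_power_eq_iff_log[THEN iffD1, OF fin J12(1) _ f]) (use pos JI in blast)
    ultimately show "\<exists>\<delta> :: nat \<Rightarrow> int. (\<forall>j\<in>J. \<delta> j \<noteq> 0) \<and>
      (\<Sum>j\<in>J. of_int (\<delta> j) * ln (real (n j))) = 0 \<and> (\<Sum>j\<in>J. of_int (\<delta> j) * ln (f j)) = 0"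
      by (intro exI[of _ ?\<delta>]) simp
  next
    have p: "0 < real (n j)" if "j \<in> S" for j using that S(2) npos by blast
    show "(\<Sum>j\<in>S. of_int (int (count_list v j) - int (count_list w j)) * ln (real (n j))) = 0"
      using vw(3) wprod_eq_iff_log[OF S(1,3,4), of "\<lambda>j. real (n j)"] p
      unfolding wprod_freq_eq_iff by blast
  qed
  moreover have "0 < f j" if "j \<in> S" for j using that S(2) pos by blast
  ultimately show ?thesis
    using wprod_eq_iff_log[OF S(1,3,4), of f] by metis
qed

text \<open>Each side of the associated relation is spelled as a word in which the letter
  \<open>i\<close> occurs \<open>\<beta> i\<close> times.\<close>

lemma circuit_relation_of_words:
  fixes f :: "nat \<Rightarrow> real"
  assumes f: "\<And>v w. v \<in> words d \<Longrightarrow> w \<in> words d \<Longrightarrow> wprod n v = wprod n w \<Longrightarrow> wprod f v = wprod f w"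
    and J: "J \<in> minimal_dependent d n" and R: "associated_relation n J J1 J2 \<beta>"
  shows "(\<Prod>i\<in>J1. f i ^ \<beta> i) = (\<Prod>i\<in>J2. f i ^ \<beta> i)"
proof -
  have J12: "J1 \<union> J2 = J" "(\<Prod>i\<in>J1. n i ^ \<beta> i) = (\<Prod>i\<in>J2. n i ^ \<beta> i)"
    using R by (auto simp: associated_relation_def)
  have fin: "finite J1" "finite J2"
    using minimal_dependent_exponent[OF J] J12(1) by (metis finite_Un)+
  have JI: "J1 \<subseteq> index_set d" "J2 \<subseteq> index_set d"
    using J J12 by (auto simp: minimal_dependent_def)
  obtain v where v: "v \<in> lists J1" "\<forall>j\<in>J1. count_list v j = \<beta> j"
    using ex_word_count[OF fin(1), of \<beta>] by blast
  obtain w where w: "w \<in> lists J2" "\<forall>j\<in>J2. count_list w j = \<beta> j"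
    using ex_word_count[OF fin(2), of \<beta>] by blast
  have sub: "set v \<subseteq> J1" "set w \<subseteq> J2" using v(1) w(1) by auto
  have "wprod n v = wprod n w"
    unfolding wprod_eq_prod_count[OF fin(1) sub(1)] wprod_eq_prod_count[OF fin(2) sub(2)]
    using J12(2) v(2) w(2) by simp
  moreover have "v \<in> words d" "w \<in> words d"
    using sub JI by auto
  ultimately have "wprod f v = wprod f w" using f by blast
  then show ?thesis
    unfolding wprod_eq_prod_count[OF fin(1) sub(1)] wprod_eq_prod_count[OF fin(2) sub(2)]
    using v(2) w(2) by simp
qed

text \<open>An integer relation for \<open>n\<close> is realised by two words, carried over by
  \<open>eq\<close>, and read back as the same integer relation for \<open>m\<close>.\<close>

lemma log_dependent_transfer:
  assumes m: "frequencies d m"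
    and eq: "\<And>v w. v \<in> words d \<Longrightarrow> w \<in> words d \<Longrightarrow> wprod n v = wprod n w \<Longrightarrow> wprod m v = wprod m w"
    and S: "S \<subseteq> index_set d" "log_dependent n S"
  shows "log_dependent m S"
proof -
  interpret m: frequencies d m by fact
  obtain T and \<gamma> :: "nat \<Rightarrow> int" where T: "finite T" "T \<subseteq> S"
    "(\<Sum>j\<in>T. of_int (\<gamma> j) * ln (real (n j))) = 0" "\<exists>j\<in>T. \<gamma> j \<noteq> 0"
    using S(2) unfolding log_dependent_iff'[OF S(1)] by blast
  obtain v w where vw: "v \<in> lists T" "w \<in> lists T"
    "\<And>x :: nat \<Rightarrow> real. (\<And>j. j \<in> T \<Longrightarrow> 0 < x j) \<Longrightarrow>
      wprod x v = wprod x w \<longleftrightarrow> (\<Sum>j\<in>T. of_int (\<gamma> j) * ln (x j)) = 0"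
    using ex_words_exponent[OF T(1), of \<gamma>] by blast
  have TI: "T \<subseteq> index_set d" using T S by blast
  have pos: "0 < real (n j)" "0 < real (m j)" if "j \<in> T" for j
    using freq_ge_2[of j] m.freq_ge_2[of j] that TI by auto
  have "wprod n v = wprod n w"
    unfolding wprod_freq_eq_iff using vw(3)[of "\<lambda>j. real (n j)"] pos T(3) by blast
  then have "wprod m v = wprod m w"
    using eq vw(1,2) TI by blast
  then have "(\<Sum>j\<in>T. of_int (\<gamma> j) * ln (real (m j))) = 0"
    unfolding m.wprod_freq_eq_iff using vw(3)[of "\<lambda>j. real (m j)"] pos by blast
  then show ?thesis
    using T unfolding m.log_dependent_iff'[OF S(1)] by blast
qed

text \<open>Minimality also asserts independence of the proper subsets, so dependence must be
  carried back from \<open>m\<close> to \<open>n\<close> as well; hence the equivalence in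
  \<open>eq\<close>.\<close>

lemma minimal_dependent_subset:
  assumes m: "frequencies d m"
    and eq: "\<And>v w. v \<in> words d \<Longrightarrow> w \<in> words d \<Longrightarrow> wprod n v = wprod n w \<longleftrightarrow> wprod m v = wprod m w"
  shows "minimal_dependent d n \<subseteq> minimal_dependent d m"
proof
  interpret m: frequencies d m by fact
  fix J assume "J \<in> minimal_dependent d n"
  then have J: "J \<subseteq> index_set d" "log_dependent n J" "\<And>J'. J' \<subset> J \<Longrightarrow> \<not> log_dependent n J'"
    by (auto simp: minimal_dependent_def)
  have "log_dependent m J"
    by (rule log_dependent_transfer[OF m _ J(1,2)]) (use eq in blast)
  moreover have "\<not> log_dependent m J'" if J': "J' \<subset> J" for J'
  proof
    assume "log_dependent m J'"
    then have "log_dependent n J'"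
      by (rule m.log_dependent_transfer[OF frequencies_axioms, rotated -1]) (use eq J' J(1) in blast)+
    then show False using J(3)[OF J'] by blast
  qed
  ultimately show "J \<in> minimal_dependent d m"
    using J(1) by (simp add: minimal_dependent_def)
qed

end

text \<open>The form of the pattern that power series see directly, with arbitrary words in place of
  circuits. Proportionality of the weights on a class is cross-multiplied, so that no reference word
  has to be chosen.\<close>

definition word_pattern ::
  "enat \<Rightarrow> (nat \<Rightarrow> real) \<Rightarrow> (nat \<Rightarrow> nat) \<Rightarrow> (nat \<Rightarrow> real) \<Rightarrow> (nat \<Rightarrow> nat) \<Rightarrow> bool" where
  "word_pattern d b n c m \<longleftrightarrow> (\<forall>v\<in>words d. \<forall>w\<in>words d.
     (wprod n v = wprod n w \<longleftrightarrow> wprod m v = wprod m w) \<and>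
     (wprod n v = wprod n w \<longrightarrow>
        wprod (\<lambda>j. sqrt (c j)) v * wprod (\<lambda>j. sqrt (b j)) w =
        wprod (\<lambda>j. sqrt (c j)) w * wprod (\<lambda>j. sqrt (b j)) v))"

text \<open>The embedding carries square roots of the weights, the pattern the weights themselves.
  Squaring is injective on nonnegative reals, so the two identities agree.\<close>

lemma sqrt_quotient_prod:
  fixes b c :: "nat \<Rightarrow> real"
  assumes "\<And>j. j \<in> J1 \<union> J2 \<Longrightarrow> 0 < b j" "\<And>j. j \<in> J1 \<union> J2 \<Longrightarrow> 0 < c j"
  shows "(\<Prod>i\<in>J1. (sqrt (c i) / sqrt (b i)) ^ \<beta> i) = (\<Prod>i\<in>J2. (sqrt (c i) / sqrt (b i)) ^ \<beta> i) \<longleftrightarrow>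
    (\<Prod>i\<in>J1. c i ^ \<beta> i) * (\<Prod>i\<in>J2. b i ^ \<beta> i) = (\<Prod>i\<in>J2. c i ^ \<beta> i) * (\<Prod>i\<in>J1. b i ^ \<beta> i)"
proof -
  have sq: "(\<Prod>i\<in>S. (sqrt (c i) / sqrt (b i)) ^ \<beta> i)\<^sup>2 = (\<Prod>i\<in>S. c i ^ \<beta> i) / (\<Prod>i\<in>S. b i ^ \<beta> i)"
    if "S \<subseteq> J1 \<union> J2" for S
  proof -
    have "((sqrt (c i) / sqrt (b i)) ^ \<beta> i)\<^sup>2 = c i ^ \<beta> i / b i ^ \<beta> i" if "i \<in> S" for i
    proof -
      have "0 < b i" "0 < c i" using assms \<open>S \<subseteq> J1 \<union> J2\<close> that by auto
      then have "(sqrt (c i) / sqrt (b i))\<^sup>2 = c i / b i" by (simp add: power_divide)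
      then show ?thesis by (metis power_commutes power_divide power_mult mult.commute)
    qed
    then have "(\<Prod>i\<in>S. ((sqrt (c i) / sqrt (b i)) ^ \<beta> i)\<^sup>2) = (\<Prod>i\<in>S. c i ^ \<beta> i / b i ^ \<beta> i)"
      by (rule prod.cong[OF refl])
    then show ?thesis
      by (simp only: prod_power_distrib prod_dividef)
  qed
  have nonneg: "0 \<le> (\<Prod>i\<in>S. (sqrt (c i) / sqrt (b i)) ^ \<beta> i)" if "S \<subseteq> J1 \<union> J2" for S
    using assms that by (intro prod_nonneg zero_le_power divide_nonneg_nonneg) (auto intro!: less_imp_le)
  have pos: "0 < (\<Prod>i\<in>S. b i ^ \<beta> i)" if "S \<subseteq> J1 \<union> J2" for S
    using assms that by (intro prod_pos zero_less_power) auto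
  have "(\<Prod>i\<in>J1. (sqrt (c i) / sqrt (b i)) ^ \<beta> i) = (\<Prod>i\<in>J2. (sqrt (c i) / sqrt (b i)) ^ \<beta> i) \<longleftrightarrow>
    (\<Prod>i\<in>J1. (sqrt (c i) / sqrt (b i)) ^ \<beta> i)\<^sup>2 = (\<Prod>i\<in>J2. (sqrt (c i) / sqrt (b i)) ^ \<beta> i)\<^sup>2"
    using nonneg[of J1] nonneg[of J2] by (simp add: power2_eq_iff_nonneg)
  also have "\<dots> \<longleftrightarrow>
    (\<Prod>i\<in>J1. c i ^ \<beta> i) * (\<Prod>i\<in>J2. b i ^ \<beta> i) = (\<Prod>i\<in>J2. c i ^ \<beta> i) * (\<Prod>i\<in>J1. b i ^ \<beta> i)"
    using pos[of J1] pos[of J2] by (simp add: sq frac_eq_eq)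
  finally show ?thesis .
qed

lemma wprod_divide: "wprod (\<lambda>j. x j / y j) w = wprod x w / (wprod y w :: real)"
  by (induction w) simp_all

lemma word_pattern_weights:
  fixes b c :: "nat \<Rightarrow> real"
  assumes "\<And>j. j \<in> index_set d \<Longrightarrow> 0 < b j" "v \<in> words d" "w \<in> words d"
  shows "wprod (\<lambda>j. sqrt (c j)) v * wprod (\<lambda>j. sqrt (b j)) w =
        wprod (\<lambda>j. sqrt (c j)) w * wprod (\<lambda>j. sqrt (b j)) v \<longleftrightarrow>
    wprod (\<lambda>j. sqrt (c j) / sqrt (b j)) v = wprod (\<lambda>j. sqrt (c j) / sqrt (b j)) w"
proof -
  have "0 < wprod (\<lambda>j. sqrt (b j)) u" if "u \<in> words d" for u
    by (rule wprod_pos[OF _ that]) (simp add: assms(1))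
  from this[OF assms(2)] this[OF assms(3)] show ?thesis
    unfolding wprod_divide by (simp add: frac_eq_eq)
qed

lemma similar_pattern_sym:
  assumes S: "similar_pattern d b n c m"
  shows "similar_pattern d c m b n"
  unfolding similar_pattern_def
proof (intro conjI ballI)
  show eq: "minimal_dependent d m = minimal_dependent d n"
    using S by (simp add: similar_pattern_def)
  fix J assume "J \<in> minimal_dependent d m"
  then obtain J1 J2 \<beta> where R: "associated_relation n J J1 J2 \<beta>" "associated_relation m J J1 J2 \<beta>"
    "(\<Prod>i\<in>J1. c i ^ \<beta> i) * (\<Prod>i\<in>J2. b i ^ \<beta> i) = (\<Prod>i\<in>J2. c i ^ \<beta> i) * (\<Prod>i\<in>J1. b i ^ \<beta> i)"
    using S unfolding similar_pattern_def by blast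
  have "(\<Prod>i\<in>J1. b i ^ \<beta> i) * (\<Prod>i\<in>J2. c i ^ \<beta> i) = (\<Prod>i\<in>J2. b i ^ \<beta> i) * (\<Prod>i\<in>J1. c i ^ \<beta> i)"
    using R(3) by (simp only: mult.commute)
  then show "\<exists>J1 J2 \<beta>. associated_relation m J J1 J2 \<beta> \<and> associated_relation n J J1 J2 \<beta> \<and>
        (\<Prod>i\<in>J1. b i ^ \<beta> i) * (\<Prod>i\<in>J2. c i ^ \<beta> i) =
        (\<Prod>i\<in>J2. b i ^ \<beta> i) * (\<Prod>i\<in>J1. c i ^ \<beta> i)"
    using R(1,2) by blast
qed

text \<open>From circuits to words, relations are combined linearly; from words to circuits, each
  associated relation is spelled by two words. In the latter direction the relation is picked for
  \<open>n\<close>, and the common word classes show that it serves for \<open>m\<close>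
  too.\<close>

theorem similar_pattern_iff_word_pattern:
  assumes n: "frequencies d n" and m: "frequencies d m"
    and b: "\<And>j. j \<in> index_set d \<Longrightarrow> 0 < b j" and c: "\<And>j. j \<in> index_set d \<Longrightarrow> 0 < c j"
  shows "similar_pattern d b n c m \<longleftrightarrow> word_pattern d b n c m"
proof
  let ?x = "\<lambda>j. sqrt (c j) / sqrt (b j)"
  \<comment> \<open>Stated for arbitrary data, since the swapped pair yields the converse
    implication between the word classes.\<close>
  have freq: "wprod m' v = wprod m' w"
    if S: "similar_pattern d b' n' c' m'" and n': "frequencies d n'" and m': "frequencies d m'"
      and vw: "v \<in> words d" "w \<in> words d" "wprod n' v = wprod n' w"
    for b' n' c' m' v w
  proof -
    have "wprod (\<lambda>j. real (m' j)) v = wprod (\<lambda>j. real (m' j)) w"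
    proof (rule frequencies.wprod_eq_of_circuits[OF n' _ _ vw])
      show "0 < real (m' j)" if "j \<in> index_set d" for j
        using frequencies.freq_ge_2[OF m' that] by simp
      fix J assume "J \<in> minimal_dependent d n'"
      then obtain J1 J2 \<beta> where R: "associated_relation n' J J1 J2 \<beta>" "associated_relation m' J J1 J2 \<beta>"
        using S unfolding similar_pattern_def by blast
      then have "(\<Prod>i\<in>J1. real (m' i) ^ \<beta> i) = (\<Prod>i\<in>J2. real (m' i) ^ \<beta> i)"
        by (simp only: associated_relation_def of_nat_power[symmetric] of_nat_prod[symmetric])
      then show "\<exists>J1 J2 \<beta>. associated_relation n' J J1 J2 \<beta> \<and>
          (\<Prod>i\<in>J1. real (m' i) ^ \<beta> i) = (\<Prod>i\<in>J2. real (m' i) ^ \<beta> i)"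
        using R by blast
    qed
    then show ?thesis
      by (simp only: of_nat_wprod[symmetric] of_nat_eq_iff)
  qed
  {
    assume S: "similar_pattern d b n c m"
    have x: "wprod ?x v = wprod ?x w" if vw: "v \<in> words d" "w \<in> words d" "wprod n v = wprod n w" for v w
    proof (rule frequencies.wprod_eq_of_circuits[OF n _ _ vw])
      show "0 < ?x j" if "j \<in> index_set d" for j using b c that by simp
      fix J assume J: "J \<in> minimal_dependent d n"
      then obtain J1 J2 \<beta> where R: "associated_relation n J J1 J2 \<beta>"
        "(\<Prod>i\<in>J1. c i ^ \<beta> i) * (\<Prod>i\<in>J2. b i ^ \<beta> i) = (\<Prod>i\<in>J2. c i ^ \<beta> i) * (\<Prod>i\<in>J1. b i ^ \<beta> i)"
        using S unfolding similar_pattern_def by blast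
      have "J1 \<union> J2 \<subseteq> index_set d"
        using J R(1) by (auto simp: minimal_dependent_def associated_relation_def)
      then have "(\<Prod>i\<in>J1. ?x i ^ \<beta> i) = (\<Prod>i\<in>J2. ?x i ^ \<beta> i)"
        using R(2) b c by (subst sqrt_quotient_prod) auto
      then show "\<exists>J1 J2 \<beta>. associated_relation n J J1 J2 \<beta> \<and>
          (\<Prod>i\<in>J1. ?x i ^ \<beta> i) = (\<Prod>i\<in>J2. ?x i ^ \<beta> i)"
        using R by blast
    qed
    show "word_pattern d b n c m"
      unfolding word_pattern_def
    proof (intro ballI conjI impI iffI)
      fix v w assume vw: "v \<in> words d" "w \<in> words d"
      show "wprod m v = wprod m w" if "wprod n v = wprod n w"
        by (rule freq[OF S n m vw that])
      show "wprod n v = wprod n w" if "wprod m v = wprod m w"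
        by (rule freq[OF similar_pattern_sym[OF S] m n vw that])
      show "wprod (\<lambda>j. sqrt (c j)) v * wprod (\<lambda>j. sqrt (b j)) w =
        wprod (\<lambda>j. sqrt (c j)) w * wprod (\<lambda>j. sqrt (b j)) v" if "wprod n v = wprod n w"
        by (rule word_pattern_weights[THEN iffD2, OF b vw x[OF vw that]])
    qed
  }
  assume W: "word_pattern d b n c m"
  then have eq: "wprod n v = wprod n w \<longleftrightarrow> wprod m v = wprod m w" if "v \<in> words d" "w \<in> words d" for v w
    using that unfolding word_pattern_def by blast
  have x: "wprod ?x v = wprod ?x w" if "v \<in> words d" "w \<in> words d" "wprod n v = wprod n w" for v w
    using W that word_pattern_weights[of d b v w c, OF b that(1,2)] unfolding word_pattern_def by metis
  have min: "minimal_dependent d n = minimal_dependent d m"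
  proof
    show "minimal_dependent d n \<subseteq> minimal_dependent d m"
      by (rule frequencies.minimal_dependent_subset[OF n m eq])
    show "minimal_dependent d m \<subseteq> minimal_dependent d n"
      by (rule frequencies.minimal_dependent_subset[OF m n]) (simp only: eq)
  qed
  have "\<exists>J1 J2 \<beta>. associated_relation n J J1 J2 \<beta> \<and> associated_relation m J J1 J2 \<beta> \<and>
        (\<Prod>i\<in>J1. c i ^ \<beta> i) * (\<Prod>i\<in>J2. b i ^ \<beta> i) =
        (\<Prod>i\<in>J2. c i ^ \<beta> i) * (\<Prod>i\<in>J1. b i ^ \<beta> i)" if J: "J \<in> minimal_dependent d n" for J
  proof -
    obtain J1 J2 \<beta> where R: "associated_relation n J J1 J2 \<beta>"
      using frequencies.ex_associated_relation[OF n J] by blast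
    have "wprod (\<lambda>j. real (m j)) v = wprod (\<lambda>j. real (m j)) w"
      if "v \<in> words d" "w \<in> words d" "wprod n v = wprod n w" for v w
      using eq that by (simp only: of_nat_wprod[symmetric])
    then have "(\<Prod>i\<in>J1. real (m i) ^ \<beta> i) = (\<Prod>i\<in>J2. real (m i) ^ \<beta> i)"
      using frequencies.circuit_relation_of_words[OF n _ J R, of "\<lambda>j. real (m j)"] by blast
    then have "(\<Prod>i\<in>J1. m i ^ \<beta> i) = (\<Prod>i\<in>J2. m i ^ \<beta> i)"
      by (simp only: of_nat_power[symmetric] of_nat_prod[symmetric] of_nat_eq_iff)
    then have "associated_relation m J J1 J2 \<beta>"
      using R by (simp add: associated_relation_def)
    moreover have "(\<Prod>i\<in>J1. ?x i ^ \<beta> i) = (\<Prod>i\<in>J2. ?x i ^ \<beta> i)"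
      using frequencies.circuit_relation_of_words[OF n x J R] by blast
    moreover have "J1 \<union> J2 \<subseteq> index_set d"
      using J R by (auto simp: minimal_dependent_def associated_relation_def)
    ultimately show ?thesis
      using R b c by (subst (asm) sqrt_quotient_prod) auto
  qed
  then show "similar_pattern d b n c m"
    using min unfolding similar_pattern_def by blast
qed

context reproducing_kernel_Hilbert_space
begin

lemma mult_add_mem: "\<phi> * h \<in> H \<Longrightarrow> \<psi> * h \<in> H \<Longrightarrow> (\<phi> + \<psi>) * h \<in> H"
  by (simp only: distrib_right add_mem)

lemma mult_scale_mem:
  assumes "\<phi> * h \<in> H"
  shows "scale_fun a \<phi> * h \<in> H"
proof -
  have "scale_fun a \<phi> * h = scale_fun a (\<phi> * h)"
    by (auto simp: scale_fun_def mult.assoc)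
  then show ?thesis using scale_mem[OF assms] by simp
qed

end

section \<open>Multipliers and the embedding of the half-plane\<close>

lemma
  assumes R: "reproducing_kernel_Hilbert_space X K (rkhs_space X K) ip"
    and \<phi>: "\<phi> \<in> multipliers X K"
  shows multipliers_add: "\<psi> \<in> multipliers X K \<Longrightarrow> \<phi> + \<psi> \<in> multipliers X K"
    and multipliers_scale: "scale_fun a \<phi> \<in> multipliers X K"
    and multipliers_diff: "\<psi> \<in> multipliers X K \<Longrightarrow> \<phi> - \<psi> \<in> multipliers X K"
proof -
  interpret reproducing_kernel_Hilbert_space X K "rkhs_space X K" ip by fact
  have add: "\<phi> + \<psi> \<in> multipliers X K" if "\<phi> \<in> multipliers X K" "\<psi> \<in> multipliers X K" for \<phi> \<psi>
    using that mult_add_mem by (simp add: multipliers_def functions_on_def)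
  have scale: "scale_fun a \<phi> \<in> multipliers X K" if "\<phi> \<in> multipliers X K" for a \<phi>
  proof -
    have "scale_fun a \<phi> \<in> functions_on X"
      using that by (simp add: multipliers_def functions_on_def scale_fun_def)
    then show ?thesis
      using that mult_scale_mem unfolding multipliers_def by blast
  qed
  show "scale_fun a \<phi> \<in> multipliers X K" by (rule scale[OF \<phi>])
  show "\<phi> + \<psi> \<in> multipliers X K" if "\<psi> \<in> multipliers X K" by (rule add[OF \<phi> that])
  show "\<phi> - \<psi> \<in> multipliers X K" if "\<psi> \<in> multipliers X K"
    unfolding minus_eq_add_scale[of \<phi>] by (rule add[OF \<phi> scale[OF that]])
qed

context ball_map
begin

lemma Nil_word: "[] \<in> words d" by simp

lemma syn_unit: "syn (\<lambda>w. of_bool (w = [])) = restrict0 X (\<lambda>_. 1)"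
proof
  fix x
  show "syn (\<lambda>w. of_bool (w = [])) x = restrict0 X (\<lambda>_. 1) x"
  proof (cases "x \<in> X")
    case True
    have "(\<Sum>\<^sub>\<infinity>w\<in>words d. of_bool (w = []) * wprod (F x) w) =
      (\<Sum>\<^sub>\<infinity>w\<in>{[]}. of_bool (w = []) * wprod (F x) w)"
      by (rule infsum_cong_neutral) auto
    then show ?thesis using True by (simp add: syn_apply restrict0_def)
  qed (simp add: syn_outside restrict0_def)
qed

lemma unit_mem: "restrict0 X (\<lambda>_. 1) \<in> syn ` ell2 (words d)"
  unfolding syn_unit[symmetric] by (intro imageI ell2_unit Nil_word)

text \<open>The constant 1 is synthesised from the empty word and so lies in the space; a multiplier
  is its own product with 1. This gives multipliers a power series.\<close>

lemma multiplier_mem_space: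
  assumes "rkhs_space X K = syn ` ell2 (words d)" "\<phi> \<in> multipliers X K"
  shows "\<phi> \<in> syn ` ell2 (words d)"
proof -
  have "\<phi> * restrict0 X (\<lambda>_. 1) = \<phi>"
    using assms(2) by (auto simp: multipliers_def functions_on_def restrict0_def fun_eq_iff)
  then show ?thesis
    using assms unit_mem unfolding multipliers_def by force
qed

end

lemma ball_map_unit_ball: "ball_map d (unit_ball d) (\<lambda>z. z)"
  by unfold_locales

text \<open>With the ball itself as parameter set, the construction yields the Drury--Arveson space.
  The space of a datum then uses the same coefficient families, evaluated along its
  embedding.\<close>

interpretation DA: ball_map d "unit_ball d" "\<lambda>z. z" for d
  by (rule ball_map_unit_ball)

lemma DA_space: "rkhs_space (unit_ball d) (DA_kernel d) = DA.syn d ` ell2 (words d)"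
  by (rule DA.rkhs_synthesis(1)) (simp add: DA.feat_inner)

lemma DA_rkhs: "reproducing_kernel_Hilbert_space (unit_ball d) (DA_kernel d)
    (rkhs_space (unit_ball d) (DA_kernel d)) (snd (rkhs (unit_ball d) (DA_kernel d)))"
  by (rule DA.rkhs_synthesis(3)) (simp add: DA.feat_inner)

lemmas DA_multipliers_add = multipliers_add[OF DA_rkhs, folded DA_multipliers_def]
  and DA_multipliers_scale = multipliers_scale[OF DA_rkhs, folded DA_multipliers_def]
  and DA_multipliers_diff = multipliers_diff[OF DA_rkhs, folded DA_multipliers_def]

lemma DA_multiplier_syn: "g \<in> DA_multipliers d \<Longrightarrow> \<exists>a\<in>ell2 (words d). g = DA.syn d a"
  using DA.multiplier_mem_space[OF DA_space] unfolding DA_multipliers_def by blast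

text \<open>Multiplication by the monomial of \<open>v\<close> prepends \<open>v\<close> to every
  word. This moves the coefficients injectively to the words beginning with \<open>v\<close>, so
  square-summability is preserved.\<close>

lemma monomial_multiplier:
  assumes v: "v \<in> words d"
  shows "restrict0 (unit_ball d) (\<lambda>z. wprod z v) \<in> DA_multipliers d"
proof -
  have inj: "inj_on ((@) v) (words d)" by (simp add: inj_on_def)
  have sub: "(@) v ` words d \<subseteq> words d" using v by auto
  have "restrict0 (unit_ball d) (\<lambda>z. wprod z v) * DA.syn d a \<in> DA.syn d ` ell2 (words d)"
    if a: "a \<in> ell2 (words d)" for a
  proof -
    define a' where "a' u = (if u \<in> (@) v ` words d then a (drop (length v) u) else 0)" for u
    have a': "a' (v @ w) = a w" if "w \<in> words d" for w
      using that by (auto simp: a'_def)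
    have "(\<lambda>w. (cmod (a w))\<^sup>2) summable_on words d"
      using a by (simp add: ell2_def)
    then have "((\<lambda>u. (cmod (a' u))\<^sup>2) \<circ> (@) v) summable_on words d"
      by (simp add: a' comp_def cong: summable_on_cong)
    then have "(\<lambda>u. (cmod (a' u))\<^sup>2) summable_on (@) v ` words d"
      by (simp only: summable_on_reindex[OF inj])
    then have "(\<lambda>u. (cmod (a' u))\<^sup>2) summable_on words d"
      by (rule summable_on_cong_neutral[THEN iffD1, rotated -1]) (use sub in \<open>auto simp: a'_def\<close>)
    then have "a' \<in> ell2 (words d)"
      using sub by (auto simp: ell2_def functions_on_def a'_def)
    moreover have "restrict0 (unit_ball d) (\<lambda>z. wprod z v) * DA.syn d a = DA.syn d a'"
    proof
      fix z
      show "(restrict0 (unit_ball d) (\<lambda>z. wprod z v) * DA.syn d a) z = DA.syn d a' z"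
      proof (cases "z \<in> unit_ball d")
        case True
        have "(\<Sum>\<^sub>\<infinity>u\<in>words d. a' u * wprod z u) = (\<Sum>\<^sub>\<infinity>u\<in>(@) v ` words d. a' u * wprod z u)"
          by (rule infsum_cong_neutral) (use sub in \<open>auto simp: a'_def\<close>)
        also have "\<dots> = (\<Sum>\<^sub>\<infinity>w\<in>words d. wprod z v * (a w * wprod z w))"
          unfolding infsum_reindex[OF inj] by (rule infsum_cong) (simp add: a')
        also have "\<dots> = wprod z v * (\<Sum>\<^sub>\<infinity>w\<in>words d. a w * wprod z w)"
          by (rule infsum_cmult_right')
        finally show ?thesis
          using True by (simp add: DA.syn_apply restrict0_def)
      qed (simp add: DA.syn_outside restrict0_def)
    qed
    ultimately show ?thesis by (metis imageI)
  qed
  then show ?thesis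
    by (auto simp: DA_multipliers_def multipliers_def DA_space functions_on_def restrict0_def)
qed

lemma const_multiplier: "restrict0 (unit_ball d) (\<lambda>_. 1) \<in> DA_multipliers d"
  using monomial_multiplier[of "[]" d] by simp

lemma complex_of_nat_mult_powr:
  "(of_nat a * of_nat b :: complex) powr s = of_nat a powr s * of_nat b powr s"
  by (rule powr_times_real) auto

lemma complex_of_nat_powr_real: "(of_nat N :: complex) powr of_real x = of_real (real N powr x)"
  using powr_of_real[of "real N" x] by simp

lemma norm_of_nat_powr: "cmod (of_nat N powr s) = real N powr Re s"
  using norm_powr_real_powr[of "of_nat N" s] by simp

section \<open>Kernel space, embedding and variety of a single datum\<close>

locale weighted_data = frequencies d n for d n +
  fixes b :: "nat \<Rightarrow> real" and \<rho> :: real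
  assumes weight_pos: "j \<in> index_set d \<Longrightarrow> 0 < b j"
    and admissible: "admissible_abscissa d b n \<rho>"
begin

lemma embedding_apply:
  "j \<in> index_set d \<Longrightarrow> embedding d b n s j = of_real (sqrt (b j)) * of_nat (n j) powr (- s)"
  by (simp add: embedding_def restrict0_def)

lemma embedding_square:
  assumes "j \<in> index_set d"
  shows "(cmod (embedding d b n s j))\<^sup>2 = b j * real (n j) powr (- 2 * Re s)"
proof -
  have "(real (n j) powr - Re s)\<^sup>2 = real (n j) powr (- 2 * Re s)"
    by (simp add: power2_eq_square powr_add[symmetric])
  then show ?thesis
    using weight_pos[OF assms]
    by (simp add: embedding_apply[OF assms] norm_mult norm_of_nat_powr power_mult_distrib)
qed

lemma embedding_ball:
  assumes "s \<in> half_plane \<rho>"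
  shows "embedding d b n s \<in> unit_ball d"
proof -
  have "(\<lambda>j. (cmod (embedding d b n s j))\<^sup>2) summable_on index_set d"
    "(\<Sum>\<^sub>\<infinity>j\<in>index_set d. (cmod (embedding d b n s j))\<^sup>2) < 1"
    using admissible assms unfolding admissible_abscissa_def
    by (simp_all add: embedding_square cong: summable_on_cong infsum_cong)
  then show ?thesis
    by (simp add: unit_ball_def C_space_def functions_on_def embedding_def restrict0_def)
qed

sublocale ball_map d "half_plane \<rho>" "embedding d b n"
  by unfold_locales (rule embedding_ball)

lemma kernel_eq:
  "Dirichlet_kernel d b n s u = DA_kernel d (embedding d b n s) (embedding d b n u)"
proof -
  have "embedding d b n s j * cnj (embedding d b n u j) = of_real (b j) * of_nat (n j) powr (- s - cnj u)"
    if j: "j \<in> index_set d" for j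
  proof -
    have "of_real (sqrt (b j)) * of_real (sqrt (b j)) = complex_of_real (b j)"
      using weight_pos[OF j] by (simp only: of_real_mult[symmetric]) simp
    moreover have "of_nat (n j) powr (- s) * of_nat (n j) powr (- cnj u) = (of_nat (n j) :: complex) powr (- s - cnj u)"
      by (simp add: powr_add[symmetric])
    moreover have "cnj (of_nat (n j) powr (- u)) = of_nat (n j) powr (- cnj u)"
      by (simp add: cnj_powr)
    ultimately show ?thesis
      unfolding embedding_apply[OF j] by (simp add: mult_ac)
  qed
  then show ?thesis
    by (simp add: Dirichlet_kernel_def DA_kernel_def C_inner_def cong: infsum_cong)
qed

text \<open>\<open>DA.nrm d\<close> is the norm of coefficient families and the same for every
  datum, which later makes the norms of two data comparable.\<close>

lemma space_eq: "rkhs_space (half_plane \<rho>) (Dirichlet_kernel d b n) = syn ` ell2 (words d)"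
  and norm_eq: "a \<in> syn_perp \<Longrightarrow> rkhs_norm (half_plane \<rho>) (Dirichlet_kernel d b n) (syn a) = DA.nrm d a"
  using rkhs_synthesis(1,2)[of "Dirichlet_kernel d b n"] by (simp_all add: feat_inner kernel_eq)

lemma wprod_embedding:
  assumes "w \<in> words d"
  shows "wprod (embedding d b n s) w =
    of_real (wprod (\<lambda>j. sqrt (b j)) w) * of_nat (wprod n w) powr (- s)"
  using assms
  by (induction w) (auto simp: embedding_apply complex_of_nat_mult_powr)

lemma syn_eq_composition: "syn a = composition_map d b n \<rho> (DA.syn d a)"
  by (auto simp: composition_map_def restrict0_def fun_eq_iff syn_apply DA.syn_apply
      embedding_ball syn_outside)

text \<open>Every function of the kernel space is a Drury--Arveson function composed with the
  embedding, so the product can be formed on the ball and then pulled back.\<close>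

lemma composition_multiplier:
  assumes g: "g \<in> DA_multipliers d"
  shows "composition_map d b n \<rho> g \<in> Dirichlet_multipliers d b n \<rho>"
proof -
  have "composition_map d b n \<rho> g * syn a \<in> syn ` ell2 (words d)" if a: "a \<in> ell2 (words d)" for a
  proof -
    have "g * DA.syn d a \<in> DA.syn d ` ell2 (words d)"
      using g a by (auto simp: DA_multipliers_def multipliers_def DA_space)
    then obtain a' where a': "a' \<in> ell2 (words d)" "g * DA.syn d a = DA.syn d a'" by blast
    have "composition_map d b n \<rho> g * syn a = composition_map d b n \<rho> (g * DA.syn d a)"
      by (auto simp: syn_eq_composition composition_map_def restrict0_def fun_eq_iff)
    also have "\<dots> = syn a'" by (simp only: a'(2) syn_eq_composition)
    finally show ?thesis using a'(1) by simp
  qed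
  then show ?thesis
    by (auto simp: Dirichlet_multipliers_def multipliers_def space_eq)
       (simp add: composition_map_def functions_on_def restrict0_def)
qed

abbreviation V :: "(nat \<Rightarrow> complex) set" where
  "V \<equiv> multiplier_variety d b n \<rho>"

lemma embedding_in_V: "s \<in> half_plane \<rho> \<Longrightarrow> embedding d b n s \<in> V"
  by (auto simp: multiplier_variety_def embedding_ball)

lemma half_plane_nonempty: "half_plane \<rho> \<noteq> {}"
proof -
  have "of_real (\<rho> + 1) \<in> half_plane \<rho>" by (simp add: half_plane_def)
  then show ?thesis by blast
qed

lemma composition_restrict: "composition_map d b n \<rho> (restrict0 V g) = composition_map d b n \<rho> g"
  using embedding_in_V by (auto simp: composition_map_def restrict0_def fun_eq_iff)

lemma composition_eq_0_iff:
  "composition_map d b n \<rho> g = 0 \<longleftrightarrow> (\<forall>w\<in>embedding d b n ` half_plane \<rho>. g w = 0)"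
  by (auto simp: composition_map_def restrict0_def fun_eq_iff)

text \<open>The variety contains the image of the embedding and, by definition, only points at which
  multipliers vanishing on that image vanish too. This replaces conditions on the variety by
  conditions on the image.\<close>

lemma restrict_V_eq_0_iff:
  assumes "g \<in> DA_multipliers d"
  shows "restrict0 V g = 0 \<longleftrightarrow> composition_map d b n \<rho> g = 0"
proof
  assume "restrict0 V g = 0"
  then have "composition_map d b n \<rho> (restrict0 V g) = 0"
    by (simp add: composition_eq_0_iff)
  then show "composition_map d b n \<rho> g = 0" by (simp add: composition_restrict)
next
  assume "composition_map d b n \<rho> g = 0"
  then show "restrict0 V g = 0"
    using assms unfolding composition_eq_0_iff
    by (auto simp: restrict0_def multiplier_variety_def fun_eq_iff)
qed

lemma inj_on_composition: "inj_on (composition_map d b n \<rho>) (variety_algebra d V)"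
proof (rule inj_onI)
  fix f g assume "f \<in> variety_algebra d V" "g \<in> variety_algebra d V"
    and eq: "composition_map d b n \<rho> f = composition_map d b n \<rho> g"
  then obtain f' g' where f': "f' \<in> DA_multipliers d" "f = restrict0 V f'"
    and g': "g' \<in> DA_multipliers d" "g = restrict0 V g'"
    by (auto simp: variety_algebra_def)
  have "composition_map d b n \<rho> (f' - g') = composition_map d b n \<rho> f' - composition_map d b n \<rho> g'"
    by (auto simp: composition_map_def restrict0_def fun_eq_iff)
  also have "\<dots> = 0"
    using eq unfolding f'(2) g'(2) composition_restrict by simp
  finally have "restrict0 V (f' - g') = 0"
    by (simp only: restrict_V_eq_0_iff[OF DA_multipliers_diff[OF f'(1) g'(1)]])
  then have "restrict0 V (f' - g') x = 0" for x by (simp only: zero_fun_apply)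
  then have "f' x = g' x" if "x \<in> V" for x
    using that unfolding restrict0_def minus_apply by (metis right_minus_eq)
  then show "f = g"
    unfolding f'(2) g'(2) by (auto simp: restrict0_def)
qed

text \<open>Injectivity of the composition map on the algebra of the variety evaluates its inverse
  at every pulled-back multiplier of the ball.\<close>

lemma inv_composition:
  assumes "g \<in> DA_multipliers d"
  shows "inv_into (variety_algebra d V) (composition_map d b n \<rho>) (composition_map d b n \<rho> g) = restrict0 V g"
proof -
  have "restrict0 V g \<in> variety_algebra d V"
    using assms by (simp add: variety_algebra_def)
  from inv_into_f_f[OF inj_on_composition this] show ?thesis
    by (simp only: composition_restrict)
qed

end

lemma word_pattern_sym:
  assumes W: "word_pattern d b n c m"
  shows "word_pattern d c m b n"
  unfolding word_pattern_def
proof (intro ballI conjI impI)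
  fix v w assume vw: "v \<in> words d" "w \<in> words d"
  note P = W[unfolded word_pattern_def, rule_format, OF vw]
  show eq: "wprod m v = wprod m w \<longleftrightarrow> wprod n v = wprod n w" using P by blast
  assume "wprod m v = wprod m w"
  then have "wprod (\<lambda>j. sqrt (c j)) v * wprod (\<lambda>j. sqrt (b j)) w =
        wprod (\<lambda>j. sqrt (c j)) w * wprod (\<lambda>j. sqrt (b j)) v" using P by blast
  then show "wprod (\<lambda>j. sqrt (b j)) v * wprod (\<lambda>j. sqrt (c j)) w =
        wprod (\<lambda>j. sqrt (b j)) w * wprod (\<lambda>j. sqrt (c j)) v"
    by (simp only: mult.commute)
qed

section \<open>Comparison of two data\<close>

text \<open>Each statement of the theorem is compared with this condition, which refers to the
  images of the embeddings alone.\<close>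

definition same_multiplier_zeros ::
  "enat \<Rightarrow> (nat \<Rightarrow> real) \<Rightarrow> (nat \<Rightarrow> nat) \<Rightarrow> real \<Rightarrow> (nat \<Rightarrow> real) \<Rightarrow> (nat \<Rightarrow> nat) \<Rightarrow> real \<Rightarrow> bool" where
  "same_multiplier_zeros d b n \<rho>1 c m \<rho>2 \<longleftrightarrow> (\<forall>g\<in>DA_multipliers d.
     composition_map d b n \<rho>1 g = 0 \<longleftrightarrow> composition_map d c m \<rho>2 g = 0)"

locale data_pair = E1: weighted_data d n b \<rho>1 + E2: weighted_data d m c \<rho>2
  for d n b \<rho>1 m c \<rho>2
begin

text \<open>\<open>transfer_relation\<close> for evaluations along the two embeddings. The relation
  is used at real points of the first half-plane and obtained at any \<open>s\<close> where the
  second pair of sums converges absolutely.\<close>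

lemma transfer:
  fixes q :: "'t \<Rightarrow> complex" and q' :: "'u \<Rightarrow> complex"
  assumes W: "word_pattern d b n c m"
    and \<omega>: "\<omega> ` T \<subseteq> words d" "\<omega>' ` T' \<subseteq> words d"
    and s1: "\<And>s. s \<in> half_plane \<rho>1 \<Longrightarrow> (\<lambda>t. norm (q t * wprod (embedding d b n s) (\<omega> t))) summable_on T"
      "\<And>s. s \<in> half_plane \<rho>1 \<Longrightarrow> (\<lambda>t. norm (q' t * wprod (embedding d b n s) (\<omega>' t))) summable_on T'"
    and eq: "\<And>s. s \<in> half_plane \<rho>1 \<Longrightarrow>
      (\<Sum>\<^sub>\<infinity>t\<in>T. q t * wprod (embedding d b n s) (\<omega> t)) = (\<Sum>\<^sub>\<infinity>t\<in>T'. q' t * wprod (embedding d b n s) (\<omega>' t))"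
    and s2: "(\<lambda>t. norm (q t * wprod (embedding d c m s) (\<omega> t))) summable_on T"
      "(\<lambda>t. norm (q' t * wprod (embedding d c m s) (\<omega>' t))) summable_on T'"
  shows "(\<Sum>\<^sub>\<infinity>t\<in>T. q t * wprod (embedding d c m s) (\<omega> t)) =
    (\<Sum>\<^sub>\<infinity>t\<in>T'. q' t * wprod (embedding d c m s) (\<omega>' t))"
proof -
  have e1: "z * wprod (embedding d b n (of_real \<sigma>)) w =
      z * of_real (wprod (\<lambda>j. sqrt (b j)) w) * of_real (real (wprod n w) powr - \<sigma>)"
    if "w \<in> words d" for z \<sigma> w
  proof -
    have "of_nat (wprod n w) powr (- complex_of_real \<sigma>) = of_real (real (wprod n w) powr - \<sigma>)"
      using complex_of_nat_powr_real[of "wprod n w" "- \<sigma>"] by simp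
    then show ?thesis
      by (simp add: E1.wprod_embedding[OF that])
  qed
  have e2: "z * wprod (embedding d c m s) w =
      z * of_real (wprod (\<lambda>j. sqrt (c j)) w) * of_nat (wprod m w) powr (- s)" if "w \<in> words d" for z w
    by (simp add: E2.wprod_embedding[OF that])
  have \<omega>T: "\<omega> t \<in> words d" if "t \<in> T" for t using \<omega>(1) that by blast
  have \<omega>T': "\<omega>' t \<in> words d" if "t \<in> T'" for t using \<omega>(2) that by blast
  have hp: "of_real \<sigma> \<in> half_plane \<rho>1" if "\<sigma> > \<rho>1" for \<sigma>
    using that by (simp add: half_plane_def)
  have "(\<Sum>\<^sub>\<infinity>t\<in>T. q t * of_real (wprod (\<lambda>j. sqrt (c j)) (\<omega> t)) * of_nat (wprod m (\<omega> t)) powr (- s)) =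
    (\<Sum>\<^sub>\<infinity>t\<in>T'. q' t * of_real (wprod (\<lambda>j. sqrt (c j)) (\<omega>' t)) * of_nat (wprod m (\<omega>' t)) powr (- s))"
  proof (rule transfer_relation[where \<beta> = "\<lambda>j. sqrt (b j)" and n = n and I = "index_set d"
        and h = "\<lambda>N. of_nat N powr (- s)" and \<rho> = \<rho>1, OF _ _ _ _ \<omega>])
    show "0 < wprod (\<lambda>j. sqrt (b j)) w" if "w \<in> words d" for w
      by (rule wprod_pos[OF _ that]) (simp add: E1.weight_pos)
    show "1 \<le> wprod n w" if "w \<in> words d" for w
      by (rule E1.wprod_ge_1[OF that])
    show "wprod n v = wprod n w \<longleftrightarrow> wprod m v = wprod m w" if "v \<in> words d" "w \<in> words d" for v w
      using W that unfolding word_pattern_def by blast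
    show "wprod (\<lambda>j. sqrt (c j)) v * wprod (\<lambda>j. sqrt (b j)) w =
        wprod (\<lambda>j. sqrt (c j)) w * wprod (\<lambda>j. sqrt (b j)) v"
      if "v \<in> words d" "w \<in> words d" "wprod n v = wprod n w" for v w
      using W that unfolding word_pattern_def by blast
    fix \<sigma> assume \<sigma>: "\<sigma> > \<rho>1"
    show "(\<lambda>t. norm (q t * of_real (wprod (\<lambda>j. sqrt (b j)) (\<omega> t)) *
        of_real (real (wprod n (\<omega> t)) powr - \<sigma>))) summable_on T"
      using s1(1)[OF hp[OF \<sigma>]] by (simp only: e1 \<omega>T cong: summable_on_cong)
    show "(\<lambda>t. norm (q' t * of_real (wprod (\<lambda>j. sqrt (b j)) (\<omega>' t)) *
        of_real (real (wprod n (\<omega>' t)) powr - \<sigma>))) summable_on T'"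
      using s1(2)[OF hp[OF \<sigma>]] by (simp only: e1 \<omega>T' cong: summable_on_cong)
    show "(\<Sum>\<^sub>\<infinity>t\<in>T. q t * of_real (wprod (\<lambda>j. sqrt (b j)) (\<omega> t)) * of_real (real (wprod n (\<omega> t)) powr - \<sigma>)) =
      (\<Sum>\<^sub>\<infinity>t\<in>T'. q' t * of_real (wprod (\<lambda>j. sqrt (b j)) (\<omega>' t)) * of_real (real (wprod n (\<omega>' t)) powr - \<sigma>))"
      using eq[OF hp[OF \<sigma>]] by (simp only: e1 \<omega>T \<omega>T' cong: infsum_cong)
  next
    show "(\<lambda>t. norm (q t * of_real (wprod (\<lambda>j. sqrt (c j)) (\<omega> t)) *
        of_nat (wprod m (\<omega> t)) powr (- s))) summable_on T"
      using s2(1) by (simp only: e2 \<omega>T cong: summable_on_cong)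
    show "(\<lambda>t. norm (q' t * of_real (wprod (\<lambda>j. sqrt (c j)) (\<omega>' t)) *
        of_nat (wprod m (\<omega>' t)) powr (- s))) summable_on T'"
      using s2(2) by (simp only: e2 \<omega>T' cong: summable_on_cong)
  qed
  then show ?thesis
    by (simp only: e2 \<omega>T \<omega>T' cong: infsum_cong)
qed

text \<open>Makes the transplant independent of the coefficients that represent a function: both
  sums run over words, and \<open>transfer\<close> applies.\<close>

lemma syn_eq_transfer:
  assumes W: "word_pattern d b n c m" and a: "a \<in> ell2 (words d)" "a' \<in> ell2 (words d)"
    and eq: "E1.syn a = E1.syn a'"
  shows "E2.syn a = E2.syn a'"
proof
  fix s
  show "E2.syn a s = E2.syn a' s"
  proof (cases "s \<in> half_plane \<rho>2")
    case True
    have "(\<Sum>\<^sub>\<infinity>w\<in>words d. a w * wprod (embedding d c m s) w) =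
      (\<Sum>\<^sub>\<infinity>w\<in>words d. a' w * wprod (embedding d c m s) w)"
    proof (rule transfer[OF W])
      fix u assume u: "u \<in> half_plane \<rho>1"
      then show "(\<Sum>\<^sub>\<infinity>w\<in>words d. a w * wprod (embedding d b n u) w) =
        (\<Sum>\<^sub>\<infinity>w\<in>words d. a' w * wprod (embedding d b n u) w)"
        using fun_cong[OF eq, of u] by (simp add: E1.syn_apply)
    qed (use a True in \<open>auto intro: E1.coeff_summable E2.coeff_summable\<close>)
    then show ?thesis using True by (simp add: E2.syn_apply)
  qed (simp add: E2.syn_outside)
qed

text \<open>A product of two expansions is a double sum in which the pair \<open>(v, w)\<close> is
  evaluated at the word \<open>v @ w\<close>. Equating it with the single sum of \<open>a''\<close>
  gives a relation that \<open>transfer\<close> carries over, with no need to collect the double sum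
  into coefficients.\<close>

lemma syn_mult_transfer:
  assumes W: "word_pattern d b n c m"
    and a: "a \<in> ell2 (words d)" "a' \<in> ell2 (words d)" "a'' \<in> ell2 (words d)"
    and eq: "E1.syn a * E1.syn a' = E1.syn a''"
  shows "E2.syn a * E2.syn a' = E2.syn a''"
proof
  fix s
  let ?T = "words d \<times> words d"
  have q: "(\<lambda>t. (case t of (v, w) \<Rightarrow> a v * a' w) * wprod z (case t of (v, w) \<Rightarrow> v @ w)) =
     (\<lambda>(v, w). (a v * wprod z v) * (a' w * wprod z w))" for z
    by (auto simp: mult_ac)
  have qn: "(\<lambda>t. norm ((case t of (v, w) \<Rightarrow> a v * a' w) * wprod z (case t of (v, w) \<Rightarrow> v @ w))) =
     (\<lambda>(v, w). norm ((a v * wprod z v) * (a' w * wprod z w)))" for z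
    by (auto simp: mult_ac)
  have P1: "(\<lambda>t. norm ((case t of (v, w) \<Rightarrow> a v * a' w) * wprod (embedding d b n u) (case t of (v, w) \<Rightarrow> v @ w)))
      summable_on ?T"
    "(\<Sum>\<^sub>\<infinity>t\<in>?T. (case t of (v, w) \<Rightarrow> a v * a' w) * wprod (embedding d b n u) (case t of (v, w) \<Rightarrow> v @ w)) =
      E1.syn a u * E1.syn a' u"
    if u: "u \<in> half_plane \<rho>1" for u
    unfolding q qn E1.syn_apply[OF u]
    using has_sum_product_abs[OF E1.coeff_summable[OF a(1) u] E1.coeff_summable[OF a(2) u]]
    by (auto intro: infsumI)
  have P2: "(\<lambda>t. norm ((case t of (v, w) \<Rightarrow> a v * a' w) * wprod (embedding d c m u) (case t of (v, w) \<Rightarrow> v @ w)))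
      summable_on ?T"
    "(\<Sum>\<^sub>\<infinity>t\<in>?T. (case t of (v, w) \<Rightarrow> a v * a' w) * wprod (embedding d c m u) (case t of (v, w) \<Rightarrow> v @ w)) =
      E2.syn a u * E2.syn a' u"
    if u: "u \<in> half_plane \<rho>2" for u
    unfolding q qn E2.syn_apply[OF u]
    using has_sum_product_abs[OF E2.coeff_summable[OF a(1) u] E2.coeff_summable[OF a(2) u]]
    by (auto intro: infsumI)
  show "(E2.syn a * E2.syn a') s = E2.syn a'' s"
  proof (cases "s \<in> half_plane \<rho>2")
    case True
    have "(\<Sum>\<^sub>\<infinity>t\<in>?T. (case t of (v, w) \<Rightarrow> a v * a' w) * wprod (embedding d c m s) (case t of (v, w) \<Rightarrow> v @ w)) =
      (\<Sum>\<^sub>\<infinity>w\<in>words d. a'' w * wprod (embedding d c m s) w)"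
    proof (rule transfer[OF W])
      show "(\<lambda>t. case t of (v, w) \<Rightarrow> v @ w) ` ?T \<subseteq> words d" "(\<lambda>w. w) ` words d \<subseteq> words d"
        by auto
      fix u assume u: "u \<in> half_plane \<rho>1"
      show "(\<Sum>\<^sub>\<infinity>t\<in>?T. (case t of (v, w) \<Rightarrow> a v * a' w) * wprod (embedding d b n u) (case t of (v, w) \<Rightarrow> v @ w)) =
        (\<Sum>\<^sub>\<infinity>w\<in>words d. a'' w * wprod (embedding d b n u) w)"
        using fun_cong[OF eq, of u] unfolding P1(2)[OF u] by (simp add: E1.syn_apply[OF u, of a''])
      show "(\<lambda>t. norm ((case t of (v, w) \<Rightarrow> a v * a' w) * wprod (embedding d b n u) (case t of (v, w) \<Rightarrow> v @ w)))
        summable_on ?T" by (rule P1(1)[OF u])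
      show "(\<lambda>w. norm (a'' w * wprod (embedding d b n u) w)) summable_on words d"
        by (rule E1.coeff_summable[OF a(3) u])
    next
      show "(\<lambda>t. norm ((case t of (v, w) \<Rightarrow> a v * a' w) * wprod (embedding d c m s) (case t of (v, w) \<Rightarrow> v @ w)))
        summable_on ?T" by (rule P2(1)[OF True])
      show "(\<lambda>w. norm (a'' w * wprod (embedding d c m s) w)) summable_on words d"
        by (rule E2.coeff_summable[OF a(3) True])
    qed
    then show ?thesis
      unfolding P2(2)[OF True] by (simp add: E2.syn_apply[OF True, of a''])
  qed (simp add: E2.syn_outside)
qed

text \<open>Reads off the least-norm coefficients of \<open>f\<close> for the first datum and
  evaluates them along the second embedding. Under the pattern any other coefficients of
  \<open>f\<close> give the same result.\<close>

definition transplant :: "(complex \<Rightarrow> complex) \<Rightarrow> complex \<Rightarrow> complex" where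
  "transplant f = E2.syn (E1.rep f)"

lemma rep_props:
  assumes "a \<in> ell2 (words d)"
  shows "E1.rep (E1.syn a) \<in> E1.syn_perp" "E1.syn (E1.rep (E1.syn a)) = E1.syn a"
proof -
  have "E1.syn a \<in> E1.syn ` E1.syn_perp"
    unfolding E1.syn_image_perp using assms by blast
  then show "E1.rep (E1.syn a) \<in> E1.syn_perp" "E1.syn (E1.rep (E1.syn a)) = E1.syn a"
    unfolding E1.rep_def by (rule inv_into_into, rule f_inv_into_f)
qed

lemma transplant_syn:
  assumes "word_pattern d b n c m" "a \<in> ell2 (words d)"
  shows "transplant (E1.syn a) = E2.syn a"
  unfolding transplant_def
  by (rule syn_eq_transfer[OF assms(1) E1.perp_mem[OF rep_props(1)] assms(2) rep_props(2)])
    (fact assms(2))+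

lemma syn_ker_transfer:
  assumes "word_pattern d b n c m"
  shows "E1.syn_ker \<subseteq> E2.syn_ker"
proof
  fix a assume "a \<in> E1.syn_ker"
  then have a: "a \<in> ell2 (words d)" "E1.syn a = E1.syn 0"
    by (simp_all add: E1.syn_ker_def E1.syn_zero)
  then have "E2.syn a = E2.syn 0"
    by (intro syn_eq_transfer[OF assms _ ell2_zero])
  then show "a \<in> E2.syn_ker"
    using a(1) by (simp add: E2.syn_ker_def E2.syn_zero)
qed

section \<open>The transplant as a unitary and as an isomorphism of multiplier algebras\<close>

abbreviation H1 where "H1 \<equiv> rkhs_space (half_plane \<rho>1) (Dirichlet_kernel d b n)"
abbreviation H2 where "H2 \<equiv> rkhs_space (half_plane \<rho>2) (Dirichlet_kernel d c m)"
abbreviation norm1 where "norm1 \<equiv> rkhs_norm (half_plane \<rho>1) (Dirichlet_kernel d b n)"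
abbreviation norm2 where "norm2 \<equiv> rkhs_norm (half_plane \<rho>2) (Dirichlet_kernel d c m)"

lemma swap: "data_pair d m c \<rho>2 n b \<rho>1"
  by unfold_locales

text \<open>The two synthesis maps annihilate the same families, so a family of least norm for one
  datum is so for the other. This is why the transplant is isometric.\<close>

lemma syn_perp_eq:
  assumes W: "word_pattern d b n c m"
  shows "E1.syn_perp = E2.syn_perp"
proof -
  have "E1.syn_ker = E2.syn_ker"
    using syn_ker_transfer[OF W] data_pair.syn_ker_transfer[OF swap word_pattern_sym[OF W]] by blast
  then show ?thesis
    unfolding E1.syn_perp_def E2.syn_perp_def by simp
qed

lemma transplant_mem:
  assumes "word_pattern d b n c m" "f \<in> H1"
  shows "transplant f \<in> H2"
  using assms transplant_syn[OF assms(1)] unfolding E1.space_eq E2.space_eq by auto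

lemma transplant_swap:
  assumes W: "word_pattern d b n c m" and f: "f \<in> H1"
  shows "data_pair.transplant d m c \<rho>2 n b \<rho>1 (transplant f) = f"
proof -
  obtain a where a: "a \<in> ell2 (words d)" "f = E1.syn a"
    using f unfolding E1.space_eq by blast
  show ?thesis
    unfolding a(2) transplant_syn[OF W a(1)] data_pair.transplant_syn[OF swap word_pattern_sym[OF W] a(1)] ..
qed

lemma norm_transplant:
  assumes W: "word_pattern d b n c m" and f: "f \<in> H1"
  shows "norm2 (transplant f) = norm1 f"
proof -
  have "f \<in> E1.syn ` E1.syn_perp"
    using f unfolding E1.space_eq E1.syn_image_perp .
  then obtain a where a: "a \<in> E1.syn_perp" "f = E1.syn a" by blast
  then have "a \<in> E2.syn_perp" "a \<in> ell2 (words d)"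
    using syn_perp_eq[OF W] E1.perp_mem by blast+
  then show ?thesis
    unfolding a(2) by (simp add: transplant_syn[OF W] E1.norm_eq[OF a(1)] E2.norm_eq)
qed

text \<open>\<open>H1\<close> need not be closed under products, hence the assumption on
  \<open>f * g\<close>; it holds whenever \<open>f\<close> is a multiplier.\<close>

lemma transplant_mult:
  assumes W: "word_pattern d b n c m" and "f \<in> H1" "g \<in> H1" "f * g \<in> H1"
  shows "transplant (f * g) = transplant f * transplant g"
proof -
  obtain a a' a'' where a: "a \<in> ell2 (words d)" "f = E1.syn a" "a' \<in> ell2 (words d)" "g = E1.syn a'"
    "a'' \<in> ell2 (words d)" "f * g = E1.syn a''"
    using assms(2-4) unfolding E1.space_eq by blast
  have "E2.syn a * E2.syn a' = E2.syn a''"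
    by (rule syn_mult_transfer[OF W a(1,3,5)]) (use a in simp)
  then show ?thesis
    unfolding a(6) unfolding a(2,4) by (simp only: transplant_syn[OF W] a(1,3,5))
qed

lemma transplant_add:
  assumes W: "word_pattern d b n c m" and "f \<in> H1" "g \<in> H1"
  shows "transplant (f + g) = transplant f + transplant g"
proof -
  obtain a a' where a: "a \<in> ell2 (words d)" "f = E1.syn a" "a' \<in> ell2 (words d)" "g = E1.syn a'"
    using assms(2-3) unfolding E1.space_eq by blast
  show ?thesis
    unfolding a(2,4) by (simp only: E1.syn_add[symmetric] E2.syn_add[symmetric] transplant_syn[OF W] a(1,3) ell2_add)
qed

lemma transplant_scale:
  assumes W: "word_pattern d b n c m" and "f \<in> H1"
  shows "transplant (scale_fun z f) = scale_fun z (transplant f)"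
proof -
  obtain a where a: "a \<in> ell2 (words d)" "f = E1.syn a"
    using assms(2) unfolding E1.space_eq by blast
  show ?thesis
    unfolding a(2) by (simp only: E1.syn_scale[symmetric] E2.syn_scale[symmetric] transplant_syn[OF W] a(1) ell2_scale)
qed

lemma multiplier_in_space: "\<phi> \<in> Dirichlet_multipliers d b n \<rho>1 \<Longrightarrow> \<phi> \<in> H1"
  using E1.multiplier_mem_space[OF E1.space_eq] unfolding Dirichlet_multipliers_def E1.space_eq by blast

lemma multiplier_mult: "\<phi> \<in> Dirichlet_multipliers d b n \<rho>1 \<Longrightarrow> h \<in> H1 \<Longrightarrow> \<phi> * h \<in> H1"
  unfolding Dirichlet_multipliers_def multipliers_def by blast

text \<open>A function of \<open>H2\<close> is moved back to \<open>H1\<close>, multiplied by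
  \<open>\<phi>\<close> there, and the product is transplanted again.\<close>

lemma transplant_multiplier:
  assumes W: "word_pattern d b n c m" and \<phi>: "\<phi> \<in> Dirichlet_multipliers d b n \<rho>1"
  shows "transplant \<phi> \<in> Dirichlet_multipliers d c m \<rho>2"
proof -
  interpret S: data_pair d m c \<rho>2 n b \<rho>1 by (rule swap)
  have "transplant \<phi> * h \<in> H2" if h: "h \<in> H2" for h
  proof -
    let ?h' = "S.transplant h"
    have h': "?h' \<in> H1" "transplant ?h' = h"
      using S.transplant_mem[OF word_pattern_sym[OF W] h] S.transplant_swap[OF word_pattern_sym[OF W] h] by simp_all
    have "transplant (\<phi> * ?h') \<in> H2"
      by (intro transplant_mem[OF W] multiplier_mult \<phi> h')
    then show ?thesis
      using transplant_mult[OF W multiplier_in_space[OF \<phi>] h'(1) multiplier_mult[OF \<phi> h'(1)]] h'(2) by simp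
  qed
  moreover have "transplant \<phi> \<in> functions_on (half_plane \<rho>2)"
    by (simp add: transplant_def functions_on_def E2.syn_outside)
  ultimately show ?thesis
    by (simp add: Dirichlet_multipliers_def multipliers_def)
qed

text \<open>The transplant is a norm-preserving bijection of the spaces compatible with
  multiplication by \<open>\<phi>\<close>, so the two sets under \<open>Sup\<close> are
  equal.\<close>

lemma multiplier_norm_transplant:
  assumes W: "word_pattern d b n c m" and \<phi>: "\<phi> \<in> Dirichlet_multipliers d b n \<rho>1"
  shows "Dirichlet_multiplier_norm d c m \<rho>2 (transplant \<phi>) = Dirichlet_multiplier_norm d b n \<rho>1 \<phi>"
proof -
  interpret S: data_pair d m c \<rho>2 n b \<rho>1 by (rule swap)
  have norm: "norm2 (transplant \<phi> * transplant h) = norm1 (\<phi> * h)" if h: "h \<in> H1" for h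
    using transplant_mult[OF W multiplier_in_space[OF \<phi>] h multiplier_mult[OF \<phi> h]]
      norm_transplant[OF W multiplier_mult[OF \<phi> h]] by simp
  have "{norm2 (transplant \<phi> * h) | h. h \<in> H2 \<and> norm2 h \<le> 1} = {norm1 (\<phi> * h) | h. h \<in> H1 \<and> norm1 h \<le> 1}"
  proof (intro subset_antisym subsetI)
    fix x assume "x \<in> {norm2 (transplant \<phi> * h) | h. h \<in> H2 \<and> norm2 h \<le> 1}"
    then obtain h where h: "x = norm2 (transplant \<phi> * h)" "h \<in> H2" "norm2 h \<le> 1" by blast
    let ?h' = "S.transplant h"
    have h': "?h' \<in> H1" "transplant ?h' = h" "norm1 ?h' = norm2 h"
      using S.transplant_mem[OF word_pattern_sym[OF W] h(2)] S.transplant_swap[OF word_pattern_sym[OF W] h(2)]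
        S.norm_transplant[OF word_pattern_sym[OF W] h(2)] by simp_all
    have "x = norm1 (\<phi> * ?h')"
      using norm[OF h'(1)] h(1) h'(2) by simp
    then show "x \<in> {norm1 (\<phi> * h) | h. h \<in> H1 \<and> norm1 h \<le> 1}"
      using h(3) h'(1,3) by auto
  next
    fix x assume "x \<in> {norm1 (\<phi> * h) | h. h \<in> H1 \<and> norm1 h \<le> 1}"
    then obtain h where h: "x = norm1 (\<phi> * h)" "h \<in> H1" "norm1 h \<le> 1" by blast
    then have "x = norm2 (transplant \<phi> * transplant h)" "transplant h \<in> H2" "norm2 (transplant h) \<le> 1"
      using norm[OF h(2)] transplant_mem[OF W h(2)] norm_transplant[OF W h(2)] by simp_all
    then show "x \<in> {norm2 (transplant \<phi> * h) | h. h \<in> H2 \<and> norm2 h \<le> 1}" by blast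
  qed
  then show ?thesis
    by (simp add: Dirichlet_multiplier_norm_def multiplier_norm_def)
qed

lemma transplant_isometric_isomorphism:
  assumes W: "word_pattern d b n c m"
  shows "isometric_isomorphism
      (Dirichlet_multipliers d b n \<rho>1) (Dirichlet_multiplier_norm d b n \<rho>1)
      (Dirichlet_multipliers d c m \<rho>2) (Dirichlet_multiplier_norm d c m \<rho>2) transplant"
proof -
  interpret S: data_pair d m c \<rho>2 n b \<rho>1 by (rule swap)
  note W' = word_pattern_sym[OF W]
  have "bij_betw transplant (Dirichlet_multipliers d b n \<rho>1) (Dirichlet_multipliers d c m \<rho>2)"
  proof (rule bij_betw_byWitness[where f' = S.transplant])
    show "\<forall>\<phi>\<in>Dirichlet_multipliers d b n \<rho>1. S.transplant (transplant \<phi>) = \<phi>"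
      using transplant_swap[OF W multiplier_in_space] by blast
    show "\<forall>\<phi>\<in>Dirichlet_multipliers d c m \<rho>2. transplant (S.transplant \<phi>) = \<phi>"
      using S.transplant_swap[OF W' S.multiplier_in_space] by blast
    show "transplant ` Dirichlet_multipliers d b n \<rho>1 \<subseteq> Dirichlet_multipliers d c m \<rho>2"
      using transplant_multiplier[OF W] by blast
    show "S.transplant ` Dirichlet_multipliers d c m \<rho>2 \<subseteq> Dirichlet_multipliers d b n \<rho>1"
      using S.transplant_multiplier[OF W'] by blast
  qed
  then show ?thesis
    unfolding isometric_isomorphism_def
    using transplant_add[OF W multiplier_in_space multiplier_in_space] transplant_scale[OF W multiplier_in_space]
      transplant_mult[OF W multiplier_in_space multiplier_in_space multiplier_mult[OF _ multiplier_in_space]]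
      multiplier_norm_transplant[OF W] by blast
qed

text \<open>One coefficient family of \<open>g\<close> on the ball represents both
  compositions.\<close>

lemma transplant_composition:
  assumes W: "word_pattern d b n c m" and g: "g \<in> DA_multipliers d"
  shows "transplant (composition_map d b n \<rho>1 g) = composition_map d c m \<rho>2 g"
proof -
  obtain a where a: "a \<in> ell2 (words d)" "g = DA.syn d a"
    using DA_multiplier_syn[OF g] by blast
  show ?thesis
    unfolding a(2) E1.syn_eq_composition[symmetric] E2.syn_eq_composition[symmetric]
    by (rule transplant_syn[OF W a(1)])
qed

lemma composition_eq_0_transfer:
  assumes W: "word_pattern d b n c m" and g: "g \<in> DA_multipliers d"
    and "composition_map d b n \<rho>1 g = 0"
  shows "composition_map d c m \<rho>2 g = 0"
proof -
  have "transplant (E1.syn 0) = E2.syn 0"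
    by (rule transplant_syn[OF W ell2_zero])
  then show ?thesis
    using transplant_composition[OF W g] assms(3) by (simp add: E1.syn_zero E2.syn_zero)
qed

lemma same_multiplier_zeros_of_pattern:
  assumes W: "word_pattern d b n c m"
  shows "same_multiplier_zeros d b n \<rho>1 c m \<rho>2"
  unfolding same_multiplier_zeros_def
  using composition_eq_0_transfer[OF W] data_pair.composition_eq_0_transfer[OF swap word_pattern_sym[OF W]]
  by blast

text \<open>A variety is the common zero set of the multipliers vanishing on the image; conversely,
  those multipliers are exactly the ones vanishing on the variety.\<close>

lemma same_zeros_iff_variety_eq:
  "same_multiplier_zeros d b n \<rho>1 c m \<rho>2 \<longleftrightarrow> E1.V = E2.V"
proof
  assume "same_multiplier_zeros d b n \<rho>1 c m \<rho>2"
  then show "E1.V = E2.V"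
    unfolding multiplier_variety_def E1.composition_eq_0_iff[symmetric] E2.composition_eq_0_iff[symmetric]
      same_multiplier_zeros_def by blast
next
  assume eq: "E1.V = E2.V"
  show "same_multiplier_zeros d b n \<rho>1 c m \<rho>2"
    unfolding same_multiplier_zeros_def
    using E1.restrict_V_eq_0_iff E2.restrict_V_eq_0_iff unfolding eq by blast
qed

section \<open>Recovering the common zeros and the pattern from the other statements\<close>

lemma relation_of_same_zeros:
  assumes Z: "same_multiplier_zeros d b n \<rho>1 c m \<rho>2"
    and vw: "v \<in> words d" "w \<in> words d" and eq: "wprod n v = wprod n w"
  shows "wprod m v = wprod m w"
    and "wprod (\<lambda>j. sqrt (c j)) v * wprod (\<lambda>j. sqrt (b j)) w =
        wprod (\<lambda>j. sqrt (c j)) w * wprod (\<lambda>j. sqrt (b j)) v"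
proof -
  let ?mon = "\<lambda>u. restrict0 (unit_ball d) (\<lambda>z. wprod z u)"
  let ?\<beta> = "wprod (\<lambda>j. sqrt (b j))" and ?\<gamma> = "wprod (\<lambda>j. sqrt (c j))"
  let ?g = "scale_fun (of_real (?\<beta> w)) (?mon v) - scale_fun (of_real (?\<beta> v)) (?mon w)"
  have g: "?g \<in> DA_multipliers d"
    by (intro DA_multipliers_diff DA_multipliers_scale monomial_multiplier vw)
  have "?g (embedding d b n s) = 0" if "s \<in> half_plane \<rho>1" for s
    using E1.embedding_ball[OF that] vw eq
    by (simp add: restrict0_def scale_fun_def E1.wprod_embedding)
  then have "composition_map d b n \<rho>1 ?g = 0"
    unfolding E1.composition_eq_0_iff by blast
  then have "composition_map d c m \<rho>2 ?g = 0"
    using Z g unfolding same_multiplier_zeros_def by blast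
  then have g0: "?g (embedding d c m s) = 0" if "s \<in> half_plane \<rho>2" for s
    using that unfolding E2.composition_eq_0_iff by blast
  let ?M = "real (wprod m v)" and ?N = "real (wprod m w)"
  have pos: "0 < ?M" "0 < ?N"
    using E2.wprod_ge_1[OF vw(1)] E2.wprod_ge_1[OF vw(2)] by simp_all
  have wt: "0 < ?\<beta> u" "0 < ?\<gamma> u" if "u \<in> words d" for u
    by (rule wprod_pos[OF _ that]; simp add: E1.weight_pos E2.weight_pos)+
  have rel: "?\<beta> w * ?\<gamma> v * ?M powr - \<sigma> = ?\<beta> v * ?\<gamma> w * ?N powr - \<sigma>" if "\<sigma> > \<rho>2" for \<sigma>
  proof -
    have hp: "of_real \<sigma> \<in> half_plane \<rho>2" using that by (simp add: half_plane_def)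
    have pw: "of_nat k powr (- complex_of_real \<sigma>) = of_real (real k powr - \<sigma>)" for k
      using complex_of_nat_powr_real[of k "- \<sigma>"] by simp
    have "complex_of_real (?\<beta> w * ?\<gamma> v * ?M powr - \<sigma>) = of_real (?\<beta> v * ?\<gamma> w * ?N powr - \<sigma>)"
      using g0[OF hp] E2.embedding_ball[OF hp] vw
      by (simp add: restrict0_def scale_fun_def E2.wprod_embedding pw mult.assoc)
    then show ?thesis by (simp only: of_real_eq_iff)
  qed
  \<comment> \<open>Two single-term Dirichlet series agree beyond \<open>\<rho>2\<close>. Their
    common value at \<open>\<rho>2 + 1\<close> is the positive number \<open>A\<close>, and passing
    to \<open>\<rho>2 + 2\<close> divides it by \<open>?M\<close> on one side and by
    \<open>?N\<close> on the other. So \<open>?M = ?N\<close>, after which the weights can be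
    compared.\<close>
  define A where "A = ?\<beta> w * ?\<gamma> v * ?M powr - (\<rho>2 + 1)"
  have A: "A = ?\<beta> v * ?\<gamma> w * ?N powr - (\<rho>2 + 1)" "A > 0"
    using rel[of "\<rho>2 + 1"] pos wt vw by (simp_all add: A_def)
  have shift: "x powr - (\<rho>2 + 2) = x powr - (\<rho>2 + 1) / x" if "x > 0" for x :: real
  proof -
    have "- (\<rho>2 + 2) = - (\<rho>2 + 1) - 1" by simp
    then show ?thesis using that by (simp only: powr_diff powr_one)
  qed
  have "?\<beta> w * ?\<gamma> v * ?M powr - (\<rho>2 + 2) = A / ?M" "?\<beta> v * ?\<gamma> w * ?N powr - (\<rho>2 + 2) = A / ?N"
    unfolding shift[OF pos(1)] shift[OF pos(2)] A_def using A(1) A_def by simp_all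
  then have "A / ?M = A / ?N" using rel[of "\<rho>2 + 2"] by simp
  then have MN: "?M = ?N" using A(2) pos by (simp add: field_simps)
  then show "wprod m v = wprod m w" by simp
  have "?\<beta> w * ?\<gamma> v = ?\<beta> v * ?\<gamma> w"
    using rel[of "\<rho>2 + 1"] pos unfolding MN by simp
  then show "?\<gamma> v * ?\<beta> w = ?\<gamma> w * ?\<beta> v" by (simp only: mult.commute)
qed

lemma pattern_of_same_zeros:
  assumes Z: "same_multiplier_zeros d b n \<rho>1 c m \<rho>2"
  shows "word_pattern d b n c m"
proof -
  interpret S: data_pair d m c \<rho>2 n b \<rho>1 by (rule swap)
  have Z': "same_multiplier_zeros d c m \<rho>2 b n \<rho>1"
    using Z unfolding same_multiplier_zeros_def by blast
  show ?thesis
    unfolding word_pattern_def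
    using relation_of_same_zeros[OF Z] S.relation_of_same_zeros(1)[OF Z'] by blast
qed

text \<open>\<open>T\<close> fixes 0, as the multiplier 0 shows, and is injective; so the
  restriction of \<open>g\<close> to one variety vanishes iff the other one does.\<close>

lemma same_zeros_of_identity:
  assumes T: "is_identity_map d E1.V E2.V T"
    and iso: "isometric_isomorphism (variety_algebra d E1.V) nA (variety_algebra d E2.V) nB T"
  shows "same_multiplier_zeros d b n \<rho>1 c m \<rho>2"
  unfolding same_multiplier_zeros_def
proof
  fix g assume g: "g \<in> DA_multipliers d"
  have zero: "(0 :: (nat \<Rightarrow> complex) \<Rightarrow> complex) \<in> DA_multipliers d"
    using DA_multipliers_diff[OF const_multiplier const_multiplier] by simp
  have r0: "restrict0 A 0 = (0 :: (nat \<Rightarrow> complex) \<Rightarrow> complex)" for A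
    by (auto simp: restrict0_def)
  have T0: "T 0 = 0"
    using T zero unfolding is_identity_map_def by (metis r0)
  have Tg: "T (restrict0 E1.V g) = restrict0 E2.V g"
    using T g unfolding is_identity_map_def by blast
  have mem: "restrict0 E1.V g \<in> variety_algebra d E1.V" "0 \<in> variety_algebra d E1.V"
    using g zero r0[of E1.V] unfolding variety_algebra_def by (blast, metis imageI)
  have "inj_on T (variety_algebra d E1.V)"
    using iso unfolding isometric_isomorphism_def bij_betw_def by blast
  then have "restrict0 E1.V g = 0 \<longleftrightarrow> restrict0 E2.V g = 0"
    using T0 Tg mem by (metis inj_onD)
  then show "composition_map d b n \<rho>1 g = 0 \<longleftrightarrow> composition_map d c m \<rho>2 g = 0"
    by (simp only: E1.restrict_V_eq_0_iff[OF g] E2.restrict_V_eq_0_iff[OF g])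
qed

text \<open>
  Off the range of the composition map, \<open>inv_into\<close> is a fixed junk value. It cannot interfere:
  it would have to equal \<open>g|V2\<close> and \<open>2 g|V2\<close>, hence \<open>0\<close>, and then \<open>1\<close> and \<open>1 + g\<close> show that
  the value in question lies in the range after all.
\<close>

lemma intertwining:
  assumes iso: "isometric_isomorphism (Dirichlet_multipliers d b n \<rho>1) nA
      (Dirichlet_multipliers d c m \<rho>2) nB \<Phi>"
    and id: "is_identity_map d E1.V E2.V
      (inv_into (variety_algebra d E2.V) (composition_map d c m \<rho>2) \<circ> \<Phi> \<circ> composition_map d b n \<rho>1)"
    and g: "g \<in> DA_multipliers d"
  shows "\<Phi> (composition_map d b n \<rho>1 g) = composition_map d c m \<rho>2 g"
proof -
  let ?C1 = "composition_map d b n \<rho>1" and ?C2 = "composition_map d c m \<rho>2"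
  let ?A = "variety_algebra d E2.V"
  let ?P = "\<lambda>g. \<Phi> (?C1 g)"
  have inv: "inv_into ?A ?C2 (?P g) = restrict0 E2.V g" if "g \<in> DA_multipliers d" for g
    using id that unfolding is_identity_map_def comp_def by (simp add: E1.composition_restrict)
  have P_range: "?P g = ?C2 g" if g: "g \<in> DA_multipliers d" "?P g \<in> ?C2 ` ?A" for g
    using f_inv_into_f[OF g(2)] unfolding inv[OF g(1)] E2.composition_restrict by simp
  have C1_add: "?C1 (f + g) = ?C1 f + ?C1 g" and C1_scale: "?C1 (scale_fun a f) = scale_fun a (?C1 f)" 
    and C2_add: "?C2 (f + g) = ?C2 f + ?C2 g" for f g a
    by (auto simp: composition_map_def restrict0_def fun_eq_iff scale_fun_def)
  have P_add: "?P (f + g) = ?P f + ?P g" and P_scale: "?P (scale_fun a f) = scale_fun a (?P f)"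
    if "f \<in> DA_multipliers d" "g \<in> DA_multipliers d" for f g a
    using iso that[THEN E1.composition_multiplier] unfolding isometric_isomorphism_def C1_add C1_scale by blast+
  have junk: "inv_into ?A ?C2 x = (SOME y. False)" if "x \<notin> ?C2 ` ?A" for x
  proof -
    have "(\<lambda>y. y \<in> ?A \<and> ?C2 y = x) = (\<lambda>y. False)" using that by auto
    then show ?thesis unfolding inv_into_def by simp
  qed
  show ?thesis
  proof (rule P_range[OF g], rule ccontr)
    assume out: "?P g \<notin> ?C2 ` ?A"
    let ?g2 = "scale_fun 2 g"
    have g2: "?g2 \<in> DA_multipliers d" by (rule DA_multipliers_scale[OF g])
    \<comment> \<open>If the image of the double lay in the range, linearity would put the image of
      \<open>g\<close> there as well. So both receive the same junk value, which makes the
      restriction of \<open>g\<close> equal to its double.\<close>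
    have "?P ?g2 \<notin> ?C2 ` ?A"
    proof
      assume "?P ?g2 \<in> ?C2 ` ?A"
      then have "?P ?g2 = ?C2 ?g2" by (rule P_range[OF g2])
      then have "scale_fun 2 (?P g) = scale_fun 2 (?C2 g)"
        unfolding P_scale[OF g g] by (auto simp: composition_map_def restrict0_def fun_eq_iff scale_fun_def)
      then have "?P g = ?C2 g"
        by (simp add: scale_fun_def fun_eq_iff)
      also have "\<dots> = ?C2 (restrict0 E2.V g)" by (simp only: E2.composition_restrict)
      finally show False using out g unfolding variety_algebra_def by blast
    qed
    then have "restrict0 E2.V ?g2 = restrict0 E2.V g"
      using junk[OF out] junk inv[OF g] inv[OF g2] by simp
    then have "restrict0 E2.V g = 0"
      by (auto simp: restrict0_def fun_eq_iff scale_fun_def split: if_splits)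
    then have u0: "(SOME y :: (nat \<Rightarrow> complex) \<Rightarrow> complex. False) = 0"
      using inv[OF g] junk[OF out] by simp
    let ?one = "restrict0 (unit_ball d) (\<lambda>_ :: nat \<Rightarrow> complex. 1 :: complex)"
    obtain s where s: "s \<in> half_plane \<rho>2" using E2.half_plane_nonempty by blast
    \<comment> \<open>The junk value is 0 by now, so a multiplier that is nonzero at an embedded
      point cannot receive it and must be sent into the range. The functions \<open>1\<close> and
      \<open>1 + g\<close> are of this kind, as \<open>g\<close> vanishes on
      \<open>E2.V\<close>.\<close>
    have "restrict0 E2.V f \<noteq> 0" if "f (embedding d c m s) \<noteq> 0" for f
      using E2.embedding_in_V[OF s] that by (auto simp: restrict0_def fun_eq_iff)
    then have in_range: "?P f = ?C2 f" if "f \<in> DA_multipliers d" "f (embedding d c m s) \<noteq> 0" for f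
      using P_range[OF that(1)] junk[of "?P f"] inv[OF that(1)] that(2) u0 by metis
    have one: "?one \<in> DA_multipliers d" "?one (embedding d c m s) = 1"
      using const_multiplier E2.embedding_ball[OF s] by (simp_all add: restrict0_def)
    have g_s: "g (embedding d c m s) = 0"
      using \<open>restrict0 E2.V g = 0\<close> E2.embedding_in_V[OF s] unfolding restrict0_def fun_eq_iff
      by (metis zero_fun_apply)
    have "?P (?one + g) = ?C2 (?one + g)"
      by (rule in_range) (simp_all add: DA_multipliers_add one g g_s)
    moreover have "?P ?one = ?C2 ?one"
      by (rule in_range) (simp_all add: one)
    ultimately have "?P g = ?C2 g"
      unfolding P_add[OF one(1) g] C2_add by simp
    then have "?P g = ?C2 (restrict0 E2.V g)" by (simp only: E2.composition_restrict)
    then show False using out g unfolding variety_algebra_def by blast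
  qed
qed

text \<open>\<open>\<Phi>\<close> carries one composition with \<open>g\<close> to the other, sends
  0 to 0 and is injective, so the two compositions vanish together.\<close>

lemma same_zeros_of_intertwining:
  assumes iso: "isometric_isomorphism (Dirichlet_multipliers d b n \<rho>1) nA
      (Dirichlet_multipliers d c m \<rho>2) nB \<Phi>"
    and id: "is_identity_map d E1.V E2.V
      (inv_into (variety_algebra d E2.V) (composition_map d c m \<rho>2) \<circ> \<Phi> \<circ> composition_map d b n \<rho>1)"
  shows "same_multiplier_zeros d b n \<rho>1 c m \<rho>2"
  unfolding same_multiplier_zeros_def
proof
  let ?C1 = "composition_map d b n \<rho>1" and ?C2 = "composition_map d c m \<rho>2"
  fix g assume g: "g \<in> DA_multipliers d"
  have zero: "(0 :: (nat \<Rightarrow> complex) \<Rightarrow> complex) \<in> DA_multipliers d"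
    using DA_multipliers_diff[OF const_multiplier const_multiplier] by simp
  have C0: "?C1 0 = 0" "?C2 0 = 0"
    by (auto simp: composition_map_def restrict0_def)
  have "\<Phi> 0 = 0"
    using intertwining[OF iso id zero] C0 by simp
  moreover have "inj_on \<Phi> (Dirichlet_multipliers d b n \<rho>1)"
    using iso unfolding isometric_isomorphism_def bij_betw_def by blast
  moreover have "?C1 g \<in> Dirichlet_multipliers d b n \<rho>1" "0 \<in> Dirichlet_multipliers d b n \<rho>1"
    using E1.composition_multiplier[OF g] E1.composition_multiplier[OF zero] C0 by simp_all
  ultimately show "?C1 g = 0 \<longleftrightarrow> ?C2 g = 0"
    using intertwining[OF iso id g] by (metis inj_onD)
qed

lemma transplant_induces_identity:
  assumes W: "word_pattern d b n c m"
  shows "is_identity_map d E1.V E2.V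
      (inv_into (variety_algebra d E2.V) (composition_map d c m \<rho>2) \<circ> transplant \<circ> composition_map d b n \<rho>1)"
  unfolding is_identity_map_def comp_def E1.composition_restrict
  by (simp add: transplant_composition[OF W] E2.inv_composition)

end

lemma weighted_dataI:
  assumes "weight_frequency_data d b n" "admissible_abscissa d b n \<rho>"
  shows "weighted_data d n b \<rho>"
  using assms by unfold_locales (auto simp: weight_frequency_data_def)

theorem theoremB:
  fixes d :: enat and b c :: "nat \<Rightarrow> real" and n m :: "nat \<Rightarrow> nat"
    and \<rho>1 \<rho>2 :: real and V1 V2 :: "(nat \<Rightarrow> complex) set"
  assumes "2 \<le> d"
    and "weight_frequency_data d b n"
    and "weight_frequency_data d c m"
    and "admissible_abscissa d b n \<rho>1"
    and "admissible_abscissa d c m \<rho>2"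
    and "V1 = multiplier_variety d b n \<rho>1"
    and "V2 = multiplier_variety d c m \<rho>2"
  shows "(similar_pattern d b n c m \<longleftrightarrow> V1 = V2) \<and>
    (V1 = V2 \<longleftrightarrow>
      (\<exists>T. is_identity_map d V1 V2 T \<and>
        isometric_isomorphism (variety_algebra d V1) (variety_norm d V1)
          (variety_algebra d V2) (variety_norm d V2) T)) \<and>
    ((\<exists>T. is_identity_map d V1 V2 T \<and>
        isometric_isomorphism (variety_algebra d V1) (variety_norm d V1)
          (variety_algebra d V2) (variety_norm d V2) T) \<longleftrightarrow>
      (\<exists>\<Phi>. isometric_isomorphism
          (Dirichlet_multipliers d b n \<rho>1) (Dirichlet_multiplier_norm d b n \<rho>1)
          (Dirichlet_multipliers d c m \<rho>2) (Dirichlet_multiplier_norm d c m \<rho>2) \<Phi> \<and>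
        is_identity_map d V1 V2
          (inv_into (variety_algebra d V2) (composition_map d c m \<rho>2) \<circ> \<Phi> \<circ>
           composition_map d b n \<rho>1)))"
proof -
  interpret E1: weighted_data d n b \<rho>1 by (rule weighted_dataI[OF assms(2,4)])
  interpret E2: weighted_data d m c \<rho>2 by (rule weighted_dataI[OF assms(3,5)])
  interpret P: data_pair d n b \<rho>1 m c \<rho>2 by unfold_locales
  let ?Z = "same_multiplier_zeros d b n \<rho>1 c m \<rho>2"
  let ?iii = "\<exists>T. is_identity_map d V1 V2 T \<and>
        isometric_isomorphism (variety_algebra d V1) (variety_norm d V1)
          (variety_algebra d V2) (variety_norm d V2) T"
  let ?iv = "\<exists>\<Phi>. isometric_isomorphism
          (Dirichlet_multipliers d b n \<rho>1) (Dirichlet_multiplier_norm d b n \<rho>1)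
          (Dirichlet_multipliers d c m \<rho>2) (Dirichlet_multiplier_norm d c m \<rho>2) \<Phi> \<and>
        is_identity_map d V1 V2
          (inv_into (variety_algebra d V2) (composition_map d c m \<rho>2) \<circ> \<Phi> \<circ>
           composition_map d b n \<rho>1)"
  have W: "word_pattern d b n c m \<longleftrightarrow> ?Z"
    using P.same_multiplier_zeros_of_pattern P.pattern_of_same_zeros by blast
  have i: "similar_pattern d b n c m \<longleftrightarrow> ?Z"
    unfolding W[symmetric]
    by (rule similar_pattern_iff_word_pattern[OF E1.frequencies_axioms E2.frequencies_axioms
          E1.weight_pos E2.weight_pos])
  have ii: "V1 = V2 \<longleftrightarrow> ?Z"
    unfolding assms(6,7) by (rule P.same_zeros_iff_variety_eq[symmetric])
  have iii: "?iii \<longleftrightarrow> ?Z"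
  proof
    assume ?iii
    then show ?Z unfolding assms(6,7) using P.same_zeros_of_identity by blast
  next
    assume ?Z
    then have eq: "V1 = V2" using ii by blast
    \<comment> \<open>For equal varieties the two algebras and their norms are the same objects, so
      the identity function serves as \<open>T\<close>.\<close>
    show ?iii
      unfolding eq by (rule exI[of _ "\<lambda>f. f"]) (simp add: is_identity_map_def isometric_isomorphism_def bij_betw_def)
  qed
  have iv: "?iv \<longleftrightarrow> ?Z"
  proof
    assume ?iv
    then show ?Z unfolding assms(6,7) using P.same_zeros_of_intertwining by blast
  next
    assume ?Z
    then have "word_pattern d b n c m" using W by blast
    then show ?iv
      unfolding assms(6,7) using P.transplant_isometric_isomorphism P.transplant_induces_identity by blast
  qed
  show ?thesis
    unfolding i ii iii iv by blast
qed

end
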